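(* Let $y$ be the log-price process $$y(t)=\sum_{k=1}^{N_1(t)}(\mu_1+e_{1,k}+\eta_{1,k})+\sum_{k=1}^{N_2(t)}(\mu_2+e_{2,k}+\eta_{2,k}),\qquad t\ge 0,$$ with point processes $N_i$, constants $\mu_i$, shocks $e_{i,k}$ and noises $\eta_{i,k}$ as described in the context. Assume: (a) the point processes $N_1$ and $N_2$ are mutually independent and there exists $\gamma\ge 1/2$ such that for $i=1,2$, as $n\to\infty$, the processes $\{n^{-\gamma}(N_i(nt)-\lambda_i nt),\,t\ge0\}$ converge in the sense of finite dimensional distributions to $A_i$, where $A_1,A_2$ are stochastic processes, at least one of which is nonzero; (b) for $i=1,2$, the sequence of processes $t\mapsto n^{-1/2}\sum_{k=1}^{[nt]}\eta_{i,k}$ converges in probability uniformly on compact sets to $0$. Set $\mu^*=\lambda_1\mu_1+\lambda_2\mu_2$. Then $y(t)/t\to\mu^*$ in probability as $t\to\infty$. Moreover, as $n\to\infty$, in the sense of convergence of finite dimensional distributions: (1) if $\gamma>1/2$, then $\{n^{-\gamma}(y(nt)-\mu^*nt),\,t\ge0\}$ converges to $\mu_1A_1+\mu_2A_2$; (2) if $\gamma=1/2$ or if $\mu_1=\mu_2=0$, then $\{n^{-1/2}(y(nt)-\mu^*nt),\,t\ge0\}$ converges to $\mu_1A_1+\mu_2A_2+\sigma B$, where $B$ is a standard Brownian motion independent of the processes $A_i$ and $\sigma$ is a positive constant.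
   Context: All random objects are defined on one probability space. $N_1,N_2$ are point processes on the real line, $N_i(t)$ denotes the number of points of $N_i$ in $(0,t]$, and the $N_i$ are not required to be stationary; $\lambda_1,\lambda_2$ are constants (the intensities of $N_1,N_2$ when these are stationary). $\mu_1,\mu_2$ are real constants, assumed not both zero in the model except where the case $\mu_1=\mu_2=0$ is explicitly mentioned in the claim. For $i=1,2$, the efficient shocks $\{e_{i,k}\}_{k\ge1}$, which are independent of $(N_1,N_2)$, are i.i.d. with mean zero and finite variance $\sigma_i^2$. The microstructure noise sequences $\{\eta_{i,k}\}_{k\ge1}$ are independent of the efficient shocks $\{e_{1,k}\},\{e_{2,k}\}$, but not necessarily of $(N_1,N_2)$. Empty sums are $0$ and $[x]$ is the integer part of $x$.
   Formalization: The limit of y(t)/t and the case μ1=μ2=0 of (2) assume γ<1; (2) also assumes the two shock sequences independent of each other; A1 and A2 are taken independent; σ is positive if some λ_i>0 has nonzero shock variance, otherwise only σ≥0. *)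

theory Defs
  imports "HOL-Probability.Probability"
begin

(* The sigma-algebra generated by a family of random variables is the one induced by the map into
   the product space. (The library's indep_var only covers two random variables
   with values in the same type, which is too narrow here.) *)
definition indep_families ::
  "'a measure \<Rightarrow> 'i set \<Rightarrow> ('i \<Rightarrow> 'a \<Rightarrow> 'b::topological_space) \<Rightarrow>
   'j set \<Rightarrow> ('j \<Rightarrow> 'a \<Rightarrow> 'c::topological_space) \<Rightarrow> bool" where
  "indep_families M I X J Y \<longleftrightarrow>
     (\<forall>i\<in>I. X i \<in> borel_measurable M) \<and> (\<forall>j\<in>J. Y j \<in> borel_measurable M) \<and>
     prob_space.indep_set M
       (sets (vimage_algebra (space M) (\<lambda>\<omega>. \<lambda>i\<in>I. X i \<omega>) (PiM I (\<lambda>_. borel))))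
       (sets (vimage_algebra (space M) (\<lambda>\<omega>. \<lambda>j\<in>J. Y j \<omega>) (PiM J (\<lambda>_. borel))))"

(* A point process is a random locally finite, integer-valued measure; points may be multiple. *)
definition point_process :: "'a measure \<Rightarrow> ('a \<Rightarrow> real measure) \<Rightarrow> bool" where
  "point_process M N \<longleftrightarrow>
     (\<forall>\<omega>\<in>space M. sets (N \<omega>) = sets borel \<and>
        (\<forall>S\<in>sets borel. bounded S \<longrightarrow> (\<exists>n::nat. emeasure (N \<omega>) S = of_nat n))) \<and>
     (\<forall>S\<in>sets borel. (\<lambda>\<omega>. emeasure (N \<omega>) S) \<in> borel_measurable M)"

(* The measure below is a natural number, so that the floor is only a conversion to nat. *)
definition num_points :: "('a \<Rightarrow> real measure) \<Rightarrow> real \<Rightarrow> 'a \<Rightarrow> nat" where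
  "num_points N t \<omega> = nat \<lfloor>measure (N \<omega>) {0<..t}\<rfloor>"

definition log_price ::
  "(nat \<Rightarrow> 'a \<Rightarrow> real measure) \<Rightarrow> (nat \<Rightarrow> real) \<Rightarrow> (nat \<Rightarrow> nat \<Rightarrow> 'a \<Rightarrow> real) \<Rightarrow>
   (nat \<Rightarrow> nat \<Rightarrow> 'a \<Rightarrow> real) \<Rightarrow> real \<Rightarrow> 'a \<Rightarrow> real" where
  "log_price N \<mu> e \<eta> t \<omega> =
     (\<Sum>k=1..num_points (N 1) t \<omega>. \<mu> 1 + e 1 k \<omega> + \<eta> 1 k \<omega>) +
     (\<Sum>k=1..num_points (N 2) t \<omega>. \<mu> 2 + e 2 k \<omega> + \<eta> 2 k \<omega>)"

definition conv_in_prob ::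
  "'a measure \<Rightarrow> ('t \<Rightarrow> 'a \<Rightarrow> real) \<Rightarrow> real \<Rightarrow> 't filter \<Rightarrow> bool" where
  "conv_in_prob M Z c F \<longleftrightarrow>
     (\<forall>\<epsilon>>0. ((\<lambda>t. measure M {\<omega>\<in>space M. \<bar>Z t \<omega> - c\<bar> > \<epsilon>}) \<longlongrightarrow> 0) F)"

(* The event says that the supremum of |Z n t| over t in K exceeds epsilon. *)
definition ucp_to_zero :: "'a measure \<Rightarrow> (nat \<Rightarrow> real \<Rightarrow> 'a \<Rightarrow> real) \<Rightarrow> bool" where
  "ucp_to_zero M Z \<longleftrightarrow>
     (\<forall>K. compact K \<and> K \<subseteq> {0..} \<longrightarrow>
        (\<forall>\<epsilon>>0. (\<lambda>n. measure M {\<omega>\<in>space M. \<exists>t\<in>K. \<bar>Z n t \<omega>\<bar> > \<epsilon>}) \<longlonglongrightarrow> 0))"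

(* For each finite set J of times, convergence in distribution of the random vectors indexed by J,
   tested on the bounded continuous functions on the product space R^J. The limit may
   live on a different probability space. *)
definition conv_fdd ::
  "'a measure \<Rightarrow> (nat \<Rightarrow> real \<Rightarrow> 'a \<Rightarrow> real) \<Rightarrow> 'b measure \<Rightarrow> (real \<Rightarrow> 'b \<Rightarrow> real) \<Rightarrow> bool" where
  "conv_fdd M X L Z \<longleftrightarrow>
     (\<forall>J f. finite J \<and> J \<subseteq> {0..} \<and>
        continuous_map (product_topology (\<lambda>_. euclideanreal) J) euclideanreal f \<and>
        bounded (f ` (J \<rightarrow>\<^sub>E UNIV)) \<longrightarrow>
        (\<lambda>n. \<integral>\<omega>. f (\<lambda>t\<in>J. X n t \<omega>) \<partial>M) \<longlonglongrightarrow> (\<integral>\<omega>. f (\<lambda>t\<in>J. Z t \<omega>) \<partial>L))"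

definition standard_brownian_motion :: "'a measure \<Rightarrow> (real \<Rightarrow> 'a \<Rightarrow> real) \<Rightarrow> bool" where
  "standard_brownian_motion P B \<longleftrightarrow>
     (\<forall>t\<ge>0. B t \<in> borel_measurable P) \<and>
     (AE \<omega> in P. B 0 \<omega> = 0) \<and>
     (\<forall>s t. 0 \<le> s \<and> s < t \<longrightarrow>
        distributed P lborel (\<lambda>\<omega>. B t \<omega> - B s \<omega>) (\<lambda>x. ennreal (normal_density 0 (sqrt (t - s)) x))) \<and>
     (\<forall>(m::nat) (\<tau>::nat \<Rightarrow> real). 0 \<le> \<tau> 0 \<and> mono \<tau> \<longrightarrow>
        prob_space.indep_vars P (\<lambda>_. borel) (\<lambda>j \<omega>. B (\<tau> (Suc j)) \<omega> - B (\<tau> j) \<omega>) {..<m}) \<and>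
     (AE \<omega> in P. continuous_on {0..} (\<lambda>t. B t \<omega>))"

end

theory Submission
  imports Defs
begin

text \<open>
  Subtracting the drift, the price splits into the counting fluctuations
  \<open>\<mu>\<^sub>i (N\<^sub>i(nt) - \<lambda>\<^sub>i nt)\<close>, the shock sums and the noise sums, both stopped at the random
  index \<open>N\<^sub>i(nt)\<close>. Since the shocks are independent of the counts, Chebyshev's inequality conditional
  on the count bounds the shock sum between two indices by the distance of the indices; hence the
  shock sum is negligible on the scale \<open>n\<^sup>\<gamma>\<close> for \<open>\<gamma> > 1/2\<close>, and on the scale \<open>n\<^sup>1\<^sup>/\<^sup>2\<close> its random index may
  be replaced by \<open>[\<lambda>\<^sub>i nt]\<close>. The noise sums are negligible by uniform convergence on compacts.
  The shock sums with deterministic indices have independent block increments that obey the central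
  limit theorem. They are independent of the counts, and weak limits of independent vectors combine
  jointly: for a bounded Lipschitz \<open>f\<close> the functions \<open>x \<mapsto> E f(x, Y\<^sub>n)\<close> are equi-Lipschitz and converge
  pointwise, which suffices for integration against the weakly convergent laws of \<open>X\<^sub>n\<close>.
\<close>

section \<open>Weak convergence in metric spaces\<close>

text \<open>A centred sum of \<open>K\<close> independent terms is of the order of the square root
  of \<open>K\<close>. Hence one condition, that \<open>(c t)\<^sup>2 * (K - m)\<close> vanishes in
  probability, decides whether the index \<open>K\<close> may be exchanged for \<open>m\<close>
  under the normalization \<open>c t\<close>. It is used with \<open>1 / t\<close>,
  \<open>n powr (- \<gamma>)\<close> and \<open>n powr (- 1 / 2)\<close>; with \<open>m = 0\<close>
  it discards the sum altogether. The noise may depend on the counts, so no conditioning is possible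
  there; the uniform hypothesis takes over, applied at a scale \<open>n\<close> of order
  \<open>1 / (c t)\<^sup>2\<close>, where the count is at most a constant times \<open>n\<close>
  with high probability. The condition \<gamma> < 1 turns the fluctuation hypothesis into a law of
  large numbers for the counts, which fixes both the drift and the variance of the Brownian part.
  Weak convergence is tested on Lipschitz functions because freezing one variable and averaging over
  the other preserves the constant; this is what lets independent limits combine.\<close>

definition weakly_conv ::
  "'a measure \<Rightarrow> (nat \<Rightarrow> 'a \<Rightarrow> 'v::metric_space) \<Rightarrow> 'b measure \<Rightarrow> ('b \<Rightarrow> 'v) \<Rightarrow> bool" where
  "weakly_conv M X L Z \<longleftrightarrow>
     (\<forall>f C. C-lipschitz_on UNIV f \<and> bounded (range f) \<longrightarrow>
        (\<lambda>n. \<integral>\<omega>. f (X n \<omega>) \<partial>M) \<longlonglongrightarrow> (\<integral>\<omega>. (f (Z \<omega>) :: real) \<partial>L))"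

lemma weakly_convD:
  fixes f :: "'v::metric_space \<Rightarrow> real"
  assumes "weakly_conv M X L Z" "C-lipschitz_on UNIV f" "\<And>x. \<bar>f x\<bar> \<le> K"
  shows "(\<lambda>n. \<integral>\<omega>. f (X n \<omega>) \<partial>M) \<longlonglongrightarrow> (\<integral>\<omega>. f (Z \<omega>) \<partial>L)"
  using assms unfolding weakly_conv_def by (metis bounded_real rangeE)

lemma (in prob_space) integrable_bounded_continuous:
  fixes f :: "'v::topological_space \<Rightarrow> real"
  assumes "X \<in> borel_measurable M" "continuous_on UNIV f" "\<And>x. \<bar>f x\<bar> \<le> K"
  shows "integrable M (\<lambda>\<omega>. f (X \<omega>))"
proof (rule integrable_const_bound[where B = K])
  show "(\<lambda>\<omega>. f (X \<omega>)) \<in> borel_measurable M"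
    using borel_measurable_continuous_onI[OF assms(2)] assms(1) by simp
qed (use assms in auto)

lemma lipschitz_on_UNIV_continuous: "C-lipschitz_on UNIV f \<Longrightarrow> continuous_on UNIV f"
  by (meson UNIV_I continuous_on_eq_continuous_within lipschitz_on_continuous_within)

text \<open>The one-sided bound \<open>h k x \<le> g x\<close> is the point: a lower bound for the
  integral of a Lipschitz minorant passes to the integral of \<open>g\<close>.\<close>

lemma lipschitz_approximation:
  fixes g :: "'v::metric_space \<Rightarrow> real"
  assumes g: "continuous_on UNIV g" "\<And>x. \<bar>g x\<bar> \<le> C"
  obtains h :: "nat \<Rightarrow> 'v \<Rightarrow> real" where
    "\<And>k. (real k)-lipschitz_on UNIV (h k)" "\<And>k x. \<bar>h k x\<bar> \<le> C" "\<And>k x. h k x \<le> g x"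
    "\<And>x. (\<lambda>k. h k x) \<longlonglongrightarrow> g x"
proof
  \<comment> \<open>inf-convolution of \<open>g\<close> with \<open>k\<close> times the distance\<close>
  define h where "h k x = (INF y. g y + real k * dist x y)" for k :: nat and x
  have lower: "- C \<le> g y + real k * dist x y" for k x y
  proof -
    have "0 \<le> real k * dist x y" by simp
    then show ?thesis using g(2)[of y] by linarith
  qed
  have bdd: "bdd_below (range (\<lambda>y. g y + real k * dist x y))" for k x
    by (rule bdd_belowI2[OF lower])
  have h_le: "h k x \<le> g y + real k * dist x y" for k x y
    unfolding h_def by (rule cINF_lower[OF bdd]) simp
  have h_ge: "m \<le> h k x" if "\<And>y. m \<le> g y + real k * dist x y" for m k x
    unfolding h_def by (rule cINF_greatest) (use that in auto)
  show h_le_g: "h k x \<le> g x" for k x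
    using h_le[of k x x] by simp
  show h_bound: "\<bar>h k x\<bar> \<le> C" for k x
    using h_ge[OF lower, of k x] h_le_g[of k x] g(2)[of x] by linarith
  have "h k x - real k * dist x x' \<le> h k x'" for k x x'
  proof (rule h_ge)
    fix y
    have "h k x \<le> g y + real k * dist x y" by (rule h_le)
    also have "real k * dist x y \<le> real k * (dist x x' + dist x' y)"
      by (intro mult_left_mono dist_triangle) auto
    finally show "h k x - real k * dist x x' \<le> g y + real k * dist x' y"
      by (simp add: algebra_simps)
  qed
  then show "(real k)-lipschitz_on UNIV (h k)" for k
    by (intro lipschitz_onI) (smt (verit) dist_commute dist_real_def, simp)
  show "(\<lambda>k. h k x) \<longlonglongrightarrow> g x" for x
  proof (rule order_tendstoI)
    fix a assume "a < g x"
    define \<epsilon> where "\<epsilon> = (g x - a) / 2"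
    have \<epsilon>: "\<epsilon> > 0" "a < g x - \<epsilon>" using \<open>a < g x\<close> by (auto simp: \<epsilon>_def field_simps)
    obtain \<delta> where \<delta>: "\<delta> > 0" "\<And>y. dist y x < \<delta> \<Longrightarrow> dist (g y) (g x) < \<epsilon>"
      using g(1) \<epsilon>(1) unfolding continuous_on_iff by (metis UNIV_I)
    \<comment> \<open>A point at distance at least \<open>\<delta>\<close> costs a penalty of at
      least \<open>2 * C\<close>, the largest possible oscillation of \<open>g\<close>; hence only
      points near \<open>x\<close> can lower the infimum.\<close>
    have "g x - \<epsilon> \<le> h k x" if k: "real k \<ge> 2 * C / \<delta>" for k
    proof (rule h_ge)
      fix y
      show "g x - \<epsilon> \<le> g y + real k * dist x y"
      proof (cases "dist y x < \<delta>")
        case True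
        then have "g x - \<epsilon> \<le> g y" using \<delta>(2)[OF True] by (auto simp: dist_real_def)
        then show ?thesis by (simp add: add_increasing2)
      next
        case False
        have "2 * C \<le> real k * \<delta>" using k \<delta>(1) by (simp add: field_simps)
        also have "\<dots> \<le> real k * dist x y" using False
          by (intro mult_left_mono) (auto simp: dist_commute)
        finally show ?thesis using g(2)[of x] g(2)[of y] \<epsilon>(1) by linarith
      qed
    qed
    then have "\<forall>\<^sub>F k in sequentially. g x - \<epsilon> \<le> h k x"
      using filterlim_at_top[THEN iffD1, OF filterlim_real_sequentially, rule_format, of "2 * C / \<delta>"]
      by (auto elim: eventually_mono)
    then show "\<forall>\<^sub>F k in sequentially. a < h k x"
      by (rule eventually_mono) (use \<epsilon> in auto)
  next
    fix a assume "g x < a"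
    then show "\<forall>\<^sub>F k in sequentially. h k x < a"
      by (intro always_eventually allI) (use h_le_g le_less_trans in blast)
  qed
qed

text \<open>Lipschitz minorants bound the limit inferior of the integrals from below; the same bound
  for \<open>- g\<close> supplies the limit superior.\<close>

lemma weakly_conv_bounded_continuous:
  fixes g :: "'v::metric_space \<Rightarrow> real"
  assumes M: "prob_space M" and L: "prob_space L"
    and X: "\<And>n. X n \<in> borel_measurable M" and Z: "Z \<in> borel_measurable L"
    and conv: "weakly_conv M X L Z"
    and g: "continuous_on UNIV g" "\<And>x. \<bar>g x\<bar> \<le> C"
  shows "(\<lambda>n. \<integral>\<omega>. g (X n \<omega>) \<partial>M) \<longlonglongrightarrow> (\<integral>\<omega>. g (Z \<omega>) \<partial>L)"
proof -
  interpret M: prob_space M by fact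
  interpret L: prob_space L by fact
  have lower: "\<forall>\<^sub>F n in sequentially. a < (\<integral>\<omega>. g (X n \<omega>) \<partial>M)"
    if g: "continuous_on UNIV g" "\<And>x. \<bar>g x\<bar> \<le> C" and a: "a < (\<integral>\<omega>. g (Z \<omega>) \<partial>L)"
    for g :: "'v \<Rightarrow> real" and a
  proof -
    from lipschitz_approximation[OF g]
    obtain h :: "nat \<Rightarrow> 'v \<Rightarrow> real" where h: "\<And>k. (real k)-lipschitz_on UNIV (h k)"
      "\<And>k x. \<bar>h k x\<bar> \<le> C" "\<And>k x. h k x \<le> g x" "\<And>x. (\<lambda>k. h k x) \<longlonglongrightarrow> g x"
      by metis
    note hc = lipschitz_on_UNIV_continuous[OF h(1)]
    have "(\<lambda>k. \<integral>\<omega>. h k (Z \<omega>) \<partial>L) \<longlonglongrightarrow> (\<integral>\<omega>. g (Z \<omega>) \<partial>L)"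
    proof (rule integral_dominated_convergence[where w = "\<lambda>_. C"])
      show "(\<lambda>\<omega>. g (Z \<omega>)) \<in> borel_measurable L"
        using L.integrable_bounded_continuous[OF Z g] by auto
      show "(\<lambda>\<omega>. h k (Z \<omega>)) \<in> borel_measurable L" for k
        using L.integrable_bounded_continuous[OF Z hc h(2)] by auto
    qed (use h in auto)
    then have "\<forall>\<^sub>F k in sequentially. a < (\<integral>\<omega>. h k (Z \<omega>) \<partial>L)"
      using a by (rule order_tendstoD)
    then obtain k where k: "a < (\<integral>\<omega>. h k (Z \<omega>) \<partial>L)"
      by (auto simp: eventually_sequentially)
    have "\<forall>\<^sub>F n in sequentially. a < (\<integral>\<omega>. h k (X n \<omega>) \<partial>M)"
      using weakly_convD[OF conv h(1,2)] k by (rule order_tendstoD)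
    then show ?thesis
    proof (rule eventually_mono)
      fix n assume "a < (\<integral>\<omega>. h k (X n \<omega>) \<partial>M)"
      also have "\<dots> \<le> (\<integral>\<omega>. g (X n \<omega>) \<partial>M)"
        using M.integrable_bounded_continuous[OF X hc h(2)] M.integrable_bounded_continuous[OF X g] h(3)
        by (intro integral_mono) auto
      finally show "a < (\<integral>\<omega>. g (X n \<omega>) \<partial>M)" .
    qed
  qed
  show ?thesis
  proof (rule order_tendstoI)
    fix a assume "(\<integral>\<omega>. g (Z \<omega>) \<partial>L) < a"
    then show "\<forall>\<^sub>F n in sequentially. (\<integral>\<omega>. g (X n \<omega>) \<partial>M) < a"
      using lower[of "\<lambda>x. - g x" "- a"] g by (simp add: continuous_on_minus)
  qed (use lower[OF g] in auto)
qed

text \<open>The composition \<open>f \<circ> h\<close> is in general only continuous, so the passage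
  from Lipschitz to bounded continuous test functions enters here.\<close>

lemma weakly_conv_continuous_map:
  fixes h :: "'v::metric_space \<Rightarrow> 'w::metric_space"
  assumes "prob_space M" "prob_space L" "\<And>n. X n \<in> borel_measurable M" "Z \<in> borel_measurable L"
    and conv: "weakly_conv M X L Z" and h: "continuous_on UNIV h"
  shows "weakly_conv M (\<lambda>n \<omega>. h (X n \<omega>)) L (\<lambda>\<omega>. h (Z \<omega>))"
  unfolding weakly_conv_def
proof safe
  fix f :: "'w \<Rightarrow> real" and C assume f: "C-lipschitz_on UNIV f" "bounded (range f)"
  obtain K where K: "\<And>x. \<bar>f x\<bar> \<le> K"
    using f(2) unfolding bounded_real by blast
  show "(\<lambda>n. \<integral>\<omega>. f (h (X n \<omega>)) \<partial>M) \<longlonglongrightarrow> (\<integral>\<omega>. f (h (Z \<omega>)) \<partial>L)"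
    using weakly_conv_bounded_continuous[OF assms(1-5), of "f \<circ> h" K]
      continuous_on_compose[OF h] continuous_on_subset[OF lipschitz_on_UNIV_continuous[OF f(1)]] K
    by auto
qed

text \<open>Independence is expressed by the law of the pair, which admits components of different
  types and feeds directly into Fubini's theorem.\<close>

definition indep_pair :: "'a measure \<Rightarrow> ('a \<Rightarrow> 'v::topological_space) \<Rightarrow> ('a \<Rightarrow> 'w::topological_space) \<Rightarrow> bool" where
  "indep_pair M X Y \<longleftrightarrow> X \<in> borel_measurable M \<and> Y \<in> borel_measurable M \<and>
     distr M (borel \<Otimes>\<^sub>M borel) (\<lambda>\<omega>. (X \<omega>, Y \<omega>)) = distr M borel X \<Otimes>\<^sub>M distr M borel Y"

lemma (in prob_space) indep_pair_integral:
  fixes f :: "'v::second_countable_topology \<times> 'w::second_countable_topology \<Rightarrow> real"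
  assumes "indep_pair M X Y" and f: "continuous_on UNIV f" "\<And>x. \<bar>f x\<bar> \<le> K"
  shows "(\<integral>\<omega>. f (X \<omega>, Y \<omega>) \<partial>M) = (\<integral>\<omega>. (\<integral>\<omega>'. f (X \<omega>, Y \<omega>') \<partial>M) \<partial>M)"
proof -
  have [measurable]: "X \<in> borel_measurable M" "Y \<in> borel_measurable M"
    and eq: "distr M (borel \<Otimes>\<^sub>M borel) (\<lambda>\<omega>. (X \<omega>, Y \<omega>)) = distr M borel X \<Otimes>\<^sub>M distr M borel Y"
    using assms(1) by (auto simp: indep_pair_def)
  have [measurable]: "f \<in> borel_measurable (borel \<Otimes>\<^sub>M borel)"
    unfolding borel_prod by (rule borel_measurable_continuous_onI[OF f(1)])
  interpret X: prob_space "distr M borel X" by (rule prob_space_distr) simp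
  interpret Y: prob_space "distr M borel Y" by (rule prob_space_distr) simp
  interpret XY: pair_prob_space "distr M borel X" "distr M borel Y" ..
  have "(\<integral>\<omega>. f (X \<omega>, Y \<omega>) \<partial>M) = (\<integral>z. f z \<partial>(distr M borel X \<Otimes>\<^sub>M distr M borel Y))"
    unfolding eq[symmetric] by (subst integral_distr) auto
  also have "\<dots> = (\<integral>x. (\<integral>y. f (x, y) \<partial>distr M borel Y) \<partial>distr M borel X)"
  proof (rule XY.integral_fst'[symmetric])
    show "integrable (distr M borel X \<Otimes>\<^sub>M distr M borel Y) f"
      by (rule XY.P.integrable_const_bound[where B = K]) (use f(2) in auto)
  qed
  also have "\<dots> = (\<integral>\<omega>. (\<integral>\<omega>'. f (X \<omega>, Y \<omega>') \<partial>M) \<partial>M)"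
    by (subst integral_distr) (auto simp: integral_distr)
  finally show ?thesis .
qed

text \<open>Changing only the first component of a pair moves the pair by exactly
  \<open>dist x x'\<close>, so averaging over the second component keeps both the Lipschitz constant
  and the bound.\<close>

lemma lipschitz_on_integral:
  assumes "prob_space M" "Y \<in> borel_measurable M"
    and f: "C-lipschitz_on UNIV (f :: 'v::metric_space \<times> 'w::metric_space \<Rightarrow> real)" "\<And>x. \<bar>f x\<bar> \<le> K"
  shows "C-lipschitz_on UNIV (\<lambda>x. \<integral>\<omega>. f (x, Y \<omega>) \<partial>M)" "\<bar>\<integral>\<omega>. f (x, Y \<omega>) \<partial>M\<bar> \<le> K"
proof -
  interpret prob_space M by fact
  note fc = lipschitz_on_UNIV_continuous[OF f(1)]
  have int: "integrable M (\<lambda>\<omega>. f (x, Y \<omega>))" for x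
    by (rule integrable_bounded_continuous[where f = "\<lambda>y. f (x, y)", OF assms(2) _ f(2)])
       (intro continuous_on_compose2[OF fc] continuous_intros, auto)
  have "(\<integral>\<omega>. \<bar>f (x, Y \<omega>)\<bar> \<partial>M) \<le> (\<integral>\<omega>. K \<partial>M)"
    using int f(2) by (intro integral_mono) auto
  then show "\<bar>\<integral>\<omega>. f (x, Y \<omega>) \<partial>M\<bar> \<le> K"
    by (intro order_trans[OF integral_abs_bound]) (simp add: prob_space)
  show "C-lipschitz_on UNIV (\<lambda>x. \<integral>\<omega>. f (x, Y \<omega>) \<partial>M)"
  proof (rule lipschitz_onI)
    fix x x' :: 'v
    have *: "\<bar>f (x, y) - f (x', y)\<bar> \<le> C * dist x x'" for y
      using lipschitz_onD[OF f(1), of "(x, y)" "(x', y)"] by (simp add: dist_Pair_Pair dist_real_def)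
    have "dist (\<integral>\<omega>. f (x, Y \<omega>) \<partial>M) (\<integral>\<omega>. f (x', Y \<omega>) \<partial>M) = \<bar>\<integral>\<omega>. f (x, Y \<omega>) - f (x', Y \<omega>) \<partial>M\<bar>"
      using int by (simp add: dist_real_def)
    also have "\<dots> \<le> (\<integral>\<omega>. \<bar>f (x, Y \<omega>) - f (x', Y \<omega>)\<bar> \<partial>M)" by (rule integral_abs_bound)
    also have "\<dots> \<le> (\<integral>\<omega>. C * dist x x' \<partial>M)"
      using int * by (intro integral_mono) auto
    finally show "dist (\<integral>\<omega>. f (x, Y \<omega>) \<partial>M) (\<integral>\<omega>. f (x', Y \<omega>) \<partial>M) \<le> C * dist x x'"
      by (simp add: prob_space)
  qed (rule lipschitz_on_nonneg[OF f(1)])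
qed

text \<open>By Fubini the claim concerns the integral of \<open>g n\<close> against the law of
  \<open>X n\<close>, where function and law both vary. Pointwise convergence of the equi-Lipschitz
  \<open>g n\<close> is uniform on finite sets. The loss away from an initial piece of a dense
  sequence is majorized by \<open>q m\<close>, which is itself bounded and Lipschitz, so its
  integral can be followed to the limit law.\<close>

lemma weakly_conv_pair:
  fixes X :: "nat \<Rightarrow> 'a \<Rightarrow> 'v::{metric_space, second_countable_topology}"
    and Y :: "nat \<Rightarrow> 'a \<Rightarrow> 'w::{metric_space, second_countable_topology}"
  assumes M: "prob_space M" and L: "prob_space L"
    and ind: "\<And>n. indep_pair M (X n) (Y n)" "indep_pair L Z W"
    and convX: "weakly_conv M X L Z" and convY: "weakly_conv M Y L W"
  shows "weakly_conv M (\<lambda>n \<omega>. (X n \<omega>, Y n \<omega>)) L (\<lambda>\<omega>. (Z \<omega>, W \<omega>))"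
  unfolding weakly_conv_def
proof safe
  fix f :: "'v \<times> 'w \<Rightarrow> real" and C assume f: "C-lipschitz_on UNIV f" "bounded (range f)"
  interpret M: prob_space M by fact
  interpret L: prob_space L by fact
  have X [measurable]: "X n \<in> borel_measurable M" and Y [measurable]: "Y n \<in> borel_measurable M" for n
    using ind(1) by (auto simp: indep_pair_def)
  have Z [measurable]: "Z \<in> borel_measurable L" and W [measurable]: "W \<in> borel_measurable L"
    using ind(2) by (auto simp: indep_pair_def)
  obtain K where K: "\<And>x. \<bar>f x\<bar> \<le> K"
    using f(2) unfolding bounded_real by blast
  have C: "C \<ge> 0" by (rule lipschitz_on_nonneg[OF f(1)])
  have K0: "K \<ge> 0" using K[of undefined] by linarith
  note fc = lipschitz_on_UNIV_continuous[OF f(1)]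
  define g where "g n x = (\<integral>\<omega>. f (x, Y n \<omega>) \<partial>M)" for n x
  define g' where "g' x = (\<integral>\<omega>. f (x, W \<omega>) \<partial>L)" for x
  have g: "C-lipschitz_on UNIV (g n)" "\<bar>g n x\<bar> \<le> K" for n x
    unfolding g_def using lipschitz_on_integral[OF M Y f(1) K] by auto
  have g': "C-lipschitz_on UNIV g'" "\<bar>g' x\<bar> \<le> K" for x
    unfolding g'_def using lipschitz_on_integral[OF L W f(1) K] by auto
  have g_conv: "(\<lambda>n. g n x) \<longlonglongrightarrow> g' x" for x
    unfolding g_def g'_def
  proof (rule weakly_convD[OF convY _ K])
    show "C-lipschitz_on UNIV (\<lambda>y. f (x, y))"
      using f(1) unfolding lipschitz_on_def by (metis UNIV_I dist_Pair_Pair dist_self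
        add_0 power_zero_numeral real_sqrt_abs abs_of_nonneg zero_le_dist)
  qed
  obtain D :: "'v set" where D: "countable D" "\<And>X. open X \<Longrightarrow> X \<noteq> {} \<Longrightarrow> \<exists>d\<in>D. d \<in> X"
    using countable_dense_setE by blast
  have "D \<noteq> {}" using D(2)[of UNIV] by auto
  define u where "u = from_nat_into D"
  have range_u: "range u = D" unfolding u_def using \<open>D \<noteq> {}\<close> D(1) by (rule range_from_nat_into)
  \<comment> \<open>Both \<open>g n\<close> and \<open>g'\<close> move by at most \<open>C\<close>
    times the distance to the nearest of the points \<open>u k\<close> with
    \<open>k \<le> m\<close>, which gives the factor \<open>2 * C\<close>; the cap
    \<open>2 * K\<close> is the trivial bound on their difference.\<close>
  define q where "q m x = min (2 * K) (2 * C * infdist x (u ` {..m}))" for m :: nat and x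
  have q_lip: "(2 * C)-lipschitz_on UNIV (q m)" for m
  proof (rule lipschitz_onI)
    fix x y
    have "\<bar>2 * C * infdist x (u ` {..m}) - 2 * C * infdist y (u ` {..m})\<bar>
      = 2 * C * \<bar>infdist x (u ` {..m}) - infdist y (u ` {..m})\<bar>"
      using C by (simp add: abs_mult flip: right_diff_distrib)
    also have "\<dots> \<le> 2 * C * dist x y"
      using C by (intro mult_left_mono infdist_triangle_abs) auto
    finally show "dist (q m x) (q m y) \<le> 2 * C * dist x y"
      unfolding q_def dist_real_def by linarith
  qed (use C in auto)
  have q_nonneg: "0 \<le> q m x" for m x
    unfolding q_def using K0 C infdist_nonneg[of x] by (auto intro!: mult_nonneg_nonneg)
  have q_bound: "\<bar>q m x\<bar> \<le> 2 * K" for m x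
    using q_nonneg[of m x] by (auto simp: q_def)
  have q_tendsto: "(\<lambda>m. q m x) \<longlonglongrightarrow> 0" for x
  proof (rule tendstoI)
    fix \<epsilon> :: real assume "\<epsilon> > 0"
    define \<delta> where "\<delta> = \<epsilon> / (2 * C + 1)"
    have \<delta>: "\<delta> > 0" "2 * C * \<delta> < \<epsilon>" using \<open>\<epsilon> > 0\<close> C by (auto simp: \<delta>_def field_simps)
    obtain d where "d \<in> D" "dist x d < \<delta>"
      using D(2)[of "ball x \<delta>"] \<delta>(1) by auto
    then obtain k where k: "d = u k" using range_u by blast
    have "q m x < \<epsilon>" if "m \<ge> k" for m
    proof -
      have "infdist x (u ` {..m}) \<le> \<delta>"
        using that \<open>dist x d < \<delta>\<close> by (intro infdist_le2[of d]) (auto simp: k)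
      then have "2 * C * infdist x (u ` {..m}) \<le> 2 * C * \<delta>"
        using C by (intro mult_left_mono) auto
      with \<delta>(2) show ?thesis by (auto simp: q_def)
    qed
    then show "\<forall>\<^sub>F m in sequentially. dist (q m x) 0 < \<epsilon>"
      using q_nonneg by (auto simp: eventually_sequentially)
  qed
  have diff: "\<bar>g n x - g' x\<bar> \<le> (\<Sum>k\<le>m. \<bar>g n (u k) - g' (u k)\<bar>) + q m x" for n m x
  proof -
    have "\<bar>g n x - g' x\<bar> \<le> (\<Sum>k\<le>m. \<bar>g n (u k) - g' (u k)\<bar>) + 2 * C * infdist x (u ` {..m})"
    proof -
      have "infdist x (u ` {..m}) = Min (dist x ` u ` {..m})"
        by (subst infdist_notempty) (auto intro!: cInf_eq_Min)
      also have "\<dots> \<in> dist x ` u ` {..m}" by (intro Min_in) auto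
      finally obtain k where k: "k \<le> m" "infdist x (u ` {..m}) = dist x (u k)" by auto
      have "\<bar>g n (u k) - g' (u k)\<bar> \<le> (\<Sum>k\<le>m. \<bar>g n (u k) - g' (u k)\<bar>)"
        using k(1) by (intro member_le_sum) auto
      moreover have "\<bar>g n x - g n (u k)\<bar> \<le> C * dist x (u k)" "\<bar>g' x - g' (u k)\<bar> \<le> C * dist x (u k)"
        using lipschitz_onD[OF g(1)] lipschitz_onD[OF g'(1)] by (auto simp: dist_real_def)
      ultimately show ?thesis unfolding k(2) by linarith
    qed
    moreover have "\<bar>g n x - g' x\<bar> \<le> (\<Sum>k\<le>m. \<bar>g n (u k) - g' (u k)\<bar>) + 2 * K"
    proof -
      have "0 \<le> (\<Sum>k\<le>m. \<bar>g n (u k) - g' (u k)\<bar>)" by (intro sum_nonneg) auto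
      then show ?thesis using g(2)[of n x] g'(2)[of x] by linarith
    qed
    ultimately show ?thesis by (simp add: q_def)
  qed
  have int: "integrable M (\<lambda>\<omega>. h (X n \<omega>))" if "C'-lipschitz_on UNIV h" "\<And>x. \<bar>h x\<bar> \<le> K'"
    for C' K' n and h :: "'v \<Rightarrow> real"
    using M.integrable_bounded_continuous[OF X lipschitz_on_UNIV_continuous] that by blast
  have est: "\<bar>(\<integral>\<omega>. g n (X n \<omega>) \<partial>M) - (\<integral>\<omega>. g' (X n \<omega>) \<partial>M)\<bar>
      \<le> (\<Sum>k\<le>m. \<bar>g n (u k) - g' (u k)\<bar>) + (\<integral>\<omega>. q m (X n \<omega>) \<partial>M)" for n m
  proof -
    have "\<bar>(\<integral>\<omega>. g n (X n \<omega>) \<partial>M) - (\<integral>\<omega>. g' (X n \<omega>) \<partial>M)\<bar> = \<bar>\<integral>\<omega>. g n (X n \<omega>) - g' (X n \<omega>) \<partial>M\<bar>"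
      using int[OF g] int[OF g'] by simp
    also have "\<dots> \<le> (\<integral>\<omega>. \<bar>g n (X n \<omega>) - g' (X n \<omega>)\<bar> \<partial>M)" by (rule integral_abs_bound)
    also have "\<dots> \<le> (\<integral>\<omega>. (\<Sum>k\<le>m. \<bar>g n (u k) - g' (u k)\<bar>) + q m (X n \<omega>) \<partial>M)"
      using int[OF g] int[OF g'] int[OF q_lip q_bound] diff by (intro integral_mono) auto
    also have "\<dots> = (\<Sum>k\<le>m. \<bar>g n (u k) - g' (u k)\<bar>) + (\<integral>\<omega>. q m (X n \<omega>) \<partial>M)"
      using int[OF q_lip q_bound] by (simp add: M.prob_space)
    finally show ?thesis .
  qed
  have "(\<lambda>n. (\<integral>\<omega>. g n (X n \<omega>) \<partial>M) - (\<integral>\<omega>. g' (X n \<omega>) \<partial>M)) \<longlonglongrightarrow> 0"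
  proof (rule tendstoI)
    fix \<epsilon> :: real assume "\<epsilon> > 0"
    have "(\<lambda>m. \<integral>\<omega>. q m (Z \<omega>) \<partial>L) \<longlonglongrightarrow> (\<integral>\<omega>. 0 \<partial>L)"
    proof (rule integral_dominated_convergence[where w = "\<lambda>_. 2 * K"])
      show "(\<lambda>\<omega>. q m (Z \<omega>)) \<in> borel_measurable L" for m
        using L.integrable_bounded_continuous[OF Z lipschitz_on_UNIV_continuous[OF q_lip] q_bound] by auto
    qed (use q_tendsto q_bound in auto)
    then have "\<forall>\<^sub>F m in sequentially. (\<integral>\<omega>. q m (Z \<omega>) \<partial>L) < \<epsilon>"
      using \<open>\<epsilon> > 0\<close> by (intro order_tendstoD) auto
    \<comment> \<open>The choice of \<open>m\<close> depends only on the limit law. It is fixed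
      before \<open>n\<close> tends to infinity, so that the finite sum over
      \<open>k \<le> m\<close> can vanish.\<close>
    then obtain m where m: "(\<integral>\<omega>. q m (Z \<omega>) \<partial>L) < \<epsilon>"
      by (auto simp: eventually_sequentially)
    have "(\<lambda>n. (\<Sum>k\<le>m. \<bar>g n (u k) - g' (u k)\<bar>) + (\<integral>\<omega>. q m (X n \<omega>) \<partial>M))
        \<longlonglongrightarrow> (\<Sum>k\<le>m. \<bar>g' (u k) - g' (u k)\<bar>) + (\<integral>\<omega>. q m (Z \<omega>) \<partial>L)"
      by (intro tendsto_intros g_conv weakly_convD[OF convX q_lip q_bound])
    then have "\<forall>\<^sub>F n in sequentially. (\<Sum>k\<le>m. \<bar>g n (u k) - g' (u k)\<bar>) + (\<integral>\<omega>. q m (X n \<omega>) \<partial>M) < \<epsilon>"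
      using m by (intro order_tendstoD) auto
    then show "\<forall>\<^sub>F n in sequentially. dist ((\<integral>\<omega>. g n (X n \<omega>) \<partial>M) - (\<integral>\<omega>. g' (X n \<omega>) \<partial>M)) 0 < \<epsilon>"
      by (rule eventually_mono) (use est[of _ m] in \<open>auto simp: dist_real_def intro: le_less_trans\<close>)
  qed
  moreover have "(\<lambda>n. \<integral>\<omega>. g' (X n \<omega>) \<partial>M) \<longlonglongrightarrow> (\<integral>\<omega>. g' (Z \<omega>) \<partial>L)"
    by (rule weakly_convD[OF convX g'])
  ultimately have "(\<lambda>n. \<integral>\<omega>. g n (X n \<omega>) \<partial>M) \<longlonglongrightarrow> (\<integral>\<omega>. g' (Z \<omega>) \<partial>L)"
    using tendsto_add by fastforce
  then show "(\<lambda>n. \<integral>\<omega>. f (X n \<omega>, Y n \<omega>) \<partial>M) \<longlonglongrightarrow> (\<integral>\<omega>. f (Z \<omega>, W \<omega>) \<partial>L)"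
    unfolding g_def g'_def M.indep_pair_integral[OF ind(1) fc K] L.indep_pair_integral[OF ind(2) fc K] .
qed

section \<open>Convergence in probability and finite dimensional distributions\<close>

lemma conv_in_probI:
  assumes "\<And>\<epsilon> \<delta>. \<epsilon> > 0 \<Longrightarrow> \<delta> > 0 \<Longrightarrow> \<forall>\<^sub>F t in F. measure M {\<omega>\<in>space M. \<bar>W t \<omega> - c\<bar> > \<epsilon>} < \<delta>"
  shows "conv_in_prob M W c F"
  unfolding conv_in_prob_def
proof (intro allI impI order_tendstoI)
  fix \<epsilon> a :: real assume "\<epsilon> > 0"
  show "\<forall>\<^sub>F t in F. a < measure M {\<omega>\<in>space M. \<bar>W t \<omega> - c\<bar> > \<epsilon>}" if "a < 0"
    using that by (intro always_eventually) (auto intro: less_le_trans)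
  show "\<forall>\<^sub>F t in F. measure M {\<omega>\<in>space M. \<bar>W t \<omega> - c\<bar> > \<epsilon>} < a" if "0 < a"
    using \<open>\<epsilon> > 0\<close> that by (rule assms)
qed

lemma conv_in_probD:
  assumes "conv_in_prob M W c F" "\<epsilon> > 0" "\<delta> > 0"
  shows "\<forall>\<^sub>F t in F. measure M {\<omega>\<in>space M. \<bar>W t \<omega> - c\<bar> > \<epsilon>} < \<delta>"
  by (rule order_tendstoD(2)[OF _ assms(3)]) (use assms(1,2) in \<open>simp add: conv_in_prob_def\<close>)

lemma conv_in_prob_add:
  assumes M: "prob_space M"
    and [measurable]: "\<And>t. V t \<in> borel_measurable M" "\<And>t. W t \<in> borel_measurable M"
    and V: "conv_in_prob M V a F" and W: "conv_in_prob M W b F"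
  shows "conv_in_prob M (\<lambda>t \<omega>. V t \<omega> + W t \<omega>) (a + b) F"
proof (rule conv_in_probI)
  interpret prob_space M by fact
  fix \<epsilon> \<delta> :: real assume "\<epsilon> > 0" "\<delta> > 0"
  then have "\<forall>\<^sub>F t in F. prob {\<omega>\<in>space M. \<bar>V t \<omega> - a\<bar> > \<epsilon> / 2} < \<delta> / 2"
    "\<forall>\<^sub>F t in F. prob {\<omega>\<in>space M. \<bar>W t \<omega> - b\<bar> > \<epsilon> / 2} < \<delta> / 2"
    using conv_in_probD[OF V, of "\<epsilon> / 2" "\<delta> / 2"] conv_in_probD[OF W, of "\<epsilon> / 2" "\<delta> / 2"] by auto
  then show "\<forall>\<^sub>F t in F. prob {\<omega>\<in>space M. \<bar>V t \<omega> + W t \<omega> - (a + b)\<bar> > \<epsilon>} < \<delta>"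
  proof eventually_elim
    case (elim t)
    have "prob {\<omega>\<in>space M. \<bar>V t \<omega> + W t \<omega> - (a + b)\<bar> > \<epsilon>}
      \<le> prob ({\<omega>\<in>space M. \<bar>V t \<omega> - a\<bar> > \<epsilon> / 2} \<union> {\<omega>\<in>space M. \<bar>W t \<omega> - b\<bar> > \<epsilon> / 2})"
      by (intro finite_measure_mono) (auto split: abs_split)
    also have "\<dots> \<le> prob {\<omega>\<in>space M. \<bar>V t \<omega> - a\<bar> > \<epsilon> / 2} + prob {\<omega>\<in>space M. \<bar>W t \<omega> - b\<bar> > \<epsilon> / 2}"
      by (intro measure_subadditive) auto
    finally show ?case using elim by simp
  qed
qed

lemma conv_in_prob_cmult:
  assumes "conv_in_prob M W a F"
  shows "conv_in_prob M (\<lambda>t \<omega>. c * W t \<omega>) (c * a) F"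
proof (cases "c = 0")
  case True
  then show ?thesis by (simp add: conv_in_prob_def)
next
  case False
  have "{\<omega>\<in>space M. \<bar>c * W t \<omega> - c * a\<bar> > \<epsilon>} = {\<omega>\<in>space M. \<bar>W t \<omega> - a\<bar> > \<epsilon> / \<bar>c\<bar>}" for t \<epsilon>
  proof -
    have "\<bar>c * W t \<omega> - c * a\<bar> = \<bar>c\<bar> * \<bar>W t \<omega> - a\<bar>" for \<omega>
      unfolding right_diff_distrib[symmetric] by (rule abs_mult)
    then show ?thesis using False by (simp only: pos_divide_less_eq zero_less_abs_iff mult.commute not_False_eq_True)
  qed
  then show ?thesis using assms False unfolding conv_in_prob_def by auto
qed

text \<open>A bounded Lipschitz function changes by at most \<open>C * \<delta>\<close> where the
  two variables are within \<open>\<delta>\<close> of each other, and by at most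
  \<open>2 * K\<close> on the remaining, unlikely event.\<close>

lemma weakly_conv_slutsky:
  fixes X Y :: "nat \<Rightarrow> 'a \<Rightarrow> 'v::{metric_space, second_countable_topology}"
  assumes M: "prob_space M"
    and [measurable]: "\<And>n. X n \<in> borel_measurable M" "\<And>n. Y n \<in> borel_measurable M"
    and conv: "weakly_conv M X L Z"
    and close: "conv_in_prob M (\<lambda>n \<omega>. dist (Y n \<omega>) (X n \<omega>)) 0 sequentially"
  shows "weakly_conv M Y L Z"
  unfolding weakly_conv_def
proof safe
  interpret prob_space M by fact
  fix f :: "'v \<Rightarrow> real" and C assume f: "C-lipschitz_on UNIV f" "bounded (range f)"
  obtain K where K: "\<And>x. \<bar>f x\<bar> \<le> K"
    using f(2) unfolding bounded_real by blast
  have C: "C \<ge> 0" by (rule lipschitz_on_nonneg[OF f(1)])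
  have K0: "K \<ge> 0" using K[of undefined] by linarith
  note fc = lipschitz_on_UNIV_continuous[OF f(1)]
  have int: "integrable M (\<lambda>\<omega>. f (X n \<omega>))" "integrable M (\<lambda>\<omega>. f (Y n \<omega>))" for n
    by (intro integrable_bounded_continuous[OF _ fc K]; simp)+
  have "(\<lambda>n. (\<integral>\<omega>. f (Y n \<omega>) \<partial>M) - (\<integral>\<omega>. f (X n \<omega>) \<partial>M)) \<longlonglongrightarrow> 0"
  proof (rule tendstoI)
    fix \<epsilon> :: real assume "\<epsilon> > 0"
    \<comment> \<open>Each constant keeps its contribution below half of \<open>\<epsilon>\<close>;
      the added 1 covers \<open>C = 0\<close> and \<open>K = 0\<close>.\<close>
    define \<delta> where "\<delta> = \<epsilon> / (2 * (C + 1))"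
    define \<rho> where "\<rho> = \<epsilon> / (2 * (2 * K + 1))"
    have \<delta>: "\<delta> > 0" "C * \<delta> < \<epsilon> / 2" using \<open>\<epsilon> > 0\<close> C by (auto simp: \<delta>_def field_simps)
    have \<rho>: "\<rho> > 0" "2 * K * \<rho> < \<epsilon> / 2" using \<open>\<epsilon> > 0\<close> K0 by (auto simp: \<rho>_def field_simps)
    have "\<forall>\<^sub>F n in sequentially. prob {\<omega>\<in>space M. \<bar>dist (Y n \<omega>) (X n \<omega>) - 0\<bar> > \<delta>} < \<rho>"
      by (rule conv_in_probD[OF close]) fact+
    then show "\<forall>\<^sub>F n in sequentially. dist ((\<integral>\<omega>. f (Y n \<omega>) \<partial>M) - (\<integral>\<omega>. f (X n \<omega>) \<partial>M)) 0 < \<epsilon>"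
    proof eventually_elim
      case (elim n)
      define D where "D = {\<omega>\<in>space M. dist (Y n \<omega>) (X n \<omega>) > \<delta>}"
      have [measurable]: "D \<in> sets M" unfolding D_def by measurable
      have iD: "integrable M (indicator D :: _ \<Rightarrow> real)"
        by (rule integrable_real_indicator) (simp_all add: less_top[symmetric])
      have "\<bar>f (Y n \<omega>) - f (X n \<omega>)\<bar> \<le> C * \<delta> + 2 * K * indicator D \<omega>" if "\<omega> \<in> space M" for \<omega>
      proof (cases "\<omega> \<in> D")
        case True
        have "0 \<le> C * \<delta>" using C \<delta>(1) by auto
        then show ?thesis using True K[of "Y n \<omega>"] K[of "X n \<omega>"] by simp
      next
        case False
        then have "dist (Y n \<omega>) (X n \<omega>) \<le> \<delta>" using that by (auto simp: D_def)
        then have "C * dist (Y n \<omega>) (X n \<omega>) \<le> C * \<delta>" using C by (intro mult_left_mono)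
        then show ?thesis using False lipschitz_onD[OF f(1), of "Y n \<omega>" "X n \<omega>"]
          by (auto simp: dist_real_def)
      qed
      then have "(\<integral>\<omega>. \<bar>f (Y n \<omega>) - f (X n \<omega>)\<bar> \<partial>M) \<le> (\<integral>\<omega>. C * \<delta> + 2 * K * indicator D \<omega> \<partial>M)"
        using int iD by (intro integral_mono) simp_all
      also have "\<dots> = C * \<delta> + 2 * K * prob D"
        using iD by (simp add: prob_space)
      also have "2 * K * prob D \<le> 2 * K * \<rho>"
        using elim K0 by (intro mult_left_mono) (auto simp: D_def)
      finally have "\<bar>\<integral>\<omega>. f (Y n \<omega>) - f (X n \<omega>) \<partial>M\<bar> < \<epsilon>"
        using \<delta>(2) \<rho>(2) by (intro le_less_trans[OF integral_abs_bound]) linarith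
      then show ?case using int by (simp add: dist_real_def)
    qed
  qed
  moreover have "(\<lambda>n. \<integral>\<omega>. f (X n \<omega>) \<partial>M) \<longlonglongrightarrow> (\<integral>\<omega>. f (Z \<omega>) \<partial>L)"
    by (rule weakly_convD[OF conv f(1) K])
  ultimately have "(\<lambda>n. ((\<integral>\<omega>. f (Y n \<omega>) \<partial>M) - (\<integral>\<omega>. f (X n \<omega>) \<partial>M)) + (\<integral>\<omega>. f (X n \<omega>) \<partial>M))
      \<longlonglongrightarrow> 0 + (\<integral>\<omega>. f (Z \<omega>) \<partial>L)"
    by (rule tendsto_add)
  then show "(\<lambda>n. \<integral>\<omega>. f (Y n \<omega>) \<partial>M) \<longlonglongrightarrow> (\<integral>\<omega>. f (Z \<omega>) \<partial>L)"
    by simp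
qed

text \<open>The metric on functions sums truncated coordinate distances with the weights
  \<open>(1/2)^n\<close>, whose total is 2.\<close>

lemma dist_fun_le:
  fixes x y :: "'i::countable \<Rightarrow> real"
  assumes "\<And>i. \<bar>x i - y i\<bar> \<le> \<delta>"
  shows "dist x y \<le> 2 * \<delta>"
proof -
  have s: "summable (\<lambda>n. (1/2)^n * min (dist (x (from_nat n)) (y (from_nat n))) 1)"
    by (rule summable_comparison_test'[of "\<lambda>n. (1/2)^n"]) (auto simp: summable_geometric_iff)
  have g: "(\<lambda>n. (1/2::real)^n * \<delta>) sums (2 * \<delta>)"
    using geometric_sums[of "1/2::real"] by (intro sums_mult2) auto
  have "dist x y \<le> (\<Sum>n. (1/2)^n * \<delta>)"
    unfolding dist_fun_def
    using s g assms by (intro suminf_le) (auto simp: sums_iff dist_real_def intro!: mult_left_mono min.coboundedI1)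
  then show ?thesis using g by (simp add: sums_iff)
qed

text \<open>Increments are the independent objects, so the times must be ordered, and they must
  start at 0 in order that values become sums of increments.\<close>

lemma mono_enumeration:
  fixes J :: "real set"
  assumes "finite J" "J \<subseteq> {0..}"
  obtains \<tau> :: "nat \<Rightarrow> real" where "mono \<tau>" "\<tau> 0 = 0" "finite (range \<tau>)" "J \<subseteq> range \<tau>"
proof -
  from assms have "\<exists>\<tau> d. mono \<tau> \<and> \<tau> 0 = 0 \<and> range \<tau> \<subseteq> insert 0 J \<and> J \<subseteq> \<tau> ` {..d::nat}"
  proof (induction J rule: finite_linorder_max_induct)
    case empty
    show ?case by (rule exI[of _ "\<lambda>_. 0"]) (auto simp: mono_def)
  next
    case (insert b J)
    then obtain \<tau> d where IH: "mono \<tau>" "\<tau> 0 = 0" "range \<tau> \<subseteq> insert 0 J" "J \<subseteq> \<tau> ` {..d::nat}" by auto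
    have le: "\<tau> j \<le> b" for j
    proof -
      have "\<tau> j \<in> insert 0 J" using IH(3) by auto
      then show ?thesis using insert.hyps(2) insert.prems by (auto intro: less_imp_le)
    qed
    \<comment> \<open>After index \<open>d\<close> the sequence jumps to the new maximum
      \<open>b\<close> and stays there. The values up to \<open>d\<close> already cover the old set,
      so nothing is lost.\<close>
    define \<tau>' where "\<tau>' j = (if j \<le> d then \<tau> j else b)" for j
    have "mono \<tau>'" using IH(1) le by (auto simp: mono_def \<tau>'_def)
    moreover have "\<tau>' 0 = 0" using IH(2) by (simp add: \<tau>'_def)
    moreover have "range \<tau>' \<subseteq> insert 0 (insert b J)" using IH(3) by (auto simp: \<tau>'_def)
    moreover have "insert b J \<subseteq> \<tau>' ` {..Suc d}"
    proof -
      have "b = \<tau>' (Suc d)" by (simp add: \<tau>'_def)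
      moreover have "x \<in> \<tau>' ` {..Suc d}" if x: "x \<in> J" for x
      proof -
        obtain j where "j \<le> d" "x = \<tau> j" using IH(4) x by auto
        then show ?thesis by (intro image_eqI[of _ _ j]) (auto simp: \<tau>'_def)
      qed
      ultimately show ?thesis by auto
    qed
    ultimately show ?case by blast
  qed
  then obtain \<tau> d where \<tau>: "mono \<tau>" "\<tau> 0 = 0" "range \<tau> \<subseteq> insert 0 J" "J \<subseteq> \<tau> ` {..d::nat}" by auto
  moreover have "finite (range \<tau>)" using \<tau>(3) assms(1) finite_subset by blast
  moreover have "J \<subseteq> range \<tau>" using \<tau>(4) by auto
  ultimately show thesis using that by blast
qed

lemma mono_from_zero_nonneg:
  fixes \<tau> :: "nat \<Rightarrow> real"
  assumes "mono \<tau>" "\<tau> 0 = 0"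
  shows "0 \<le> \<tau> j"
  using assms by (metis monoD zero_le)

text \<open>
  Vectors of values at finitely many times are encoded as points \<open>\<lambda>j. X (\<tau> j)\<close> of the metric space
  \<^typ>\<open>nat \<Rightarrow> real\<close>, where \<open>\<tau>\<close> is a sequence of times with finite range; this avoids types indexed by
  the number of times.
\<close>

lemma conv_fdd_imp_weakly_conv:
  fixes \<tau> :: "nat \<Rightarrow> real"
  assumes "conv_fdd M X L Z" "finite (range \<tau>)" "range \<tau> \<subseteq> {0..}"
  shows "weakly_conv M (\<lambda>n \<omega> j. X n (\<tau> j) \<omega>) L (\<lambda>\<omega> j. Z (\<tau> j) \<omega>)"
  unfolding weakly_conv_def
proof safe
  fix f :: "(nat \<Rightarrow> real) \<Rightarrow> real" and C assume f: "C-lipschitz_on UNIV f" "bounded (range f)"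
  define g where "g x = f (\<lambda>j. x (\<tau> j))" for x :: "real \<Rightarrow> real"
  have "continuous_map (product_topology (\<lambda>_. euclideanreal) (range \<tau>))
      (product_topology (\<lambda>_. euclideanreal) UNIV) (\<lambda>x j. x (\<tau> j))"
    by (subst continuous_map_componentwise_UNIV) (auto intro: continuous_map_product_projection)
  then have "continuous_map (product_topology (\<lambda>_. euclideanreal) (range \<tau>)) euclideanreal g"
    unfolding g_def euclidean_product_topology
    by (rule continuous_map_compose[unfolded comp_def]) (simp add: lipschitz_on_UNIV_continuous[OF f(1)])
  moreover have "bounded (g ` (range \<tau> \<rightarrow>\<^sub>E UNIV))"
    by (rule bounded_subset[OF f(2)]) (auto simp: g_def)
  ultimately have "(\<lambda>n. \<integral>\<omega>. g (\<lambda>t\<in>range \<tau>. X n t \<omega>) \<partial>M) \<longlonglongrightarrow> (\<integral>\<omega>. g (\<lambda>t\<in>range \<tau>. Z t \<omega>) \<partial>L)"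
    using assms unfolding conv_fdd_def by blast
  then show "(\<lambda>n. \<integral>\<omega>. f (\<lambda>j. X n (\<tau> j) \<omega>) \<partial>M) \<longlonglongrightarrow> (\<integral>\<omega>. f (\<lambda>j. Z (\<tau> j) \<omega>) \<partial>L)"
    by (simp add: g_def)
qed

text \<open>Every finite set of times lies in the range of an admissible \<open>\<tau>\<close>.
  Choosing one index \<open>idx t\<close> for each time turns a test function on \<open>J\<close>
  into a continuous function of the sequence.\<close>

lemma conv_fddI:
  assumes M: "prob_space M" and L: "prob_space L"
    and X: "\<And>n t. 0 \<le> t \<Longrightarrow> X n t \<in> borel_measurable M"
    and Z: "\<And>t. 0 \<le> t \<Longrightarrow> Z t \<in> borel_measurable L"
    and conv: "\<And>\<tau> :: nat \<Rightarrow> real. mono \<tau> \<Longrightarrow> \<tau> 0 = 0 \<Longrightarrow> finite (range \<tau>) \<Longrightarrow>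
      weakly_conv M (\<lambda>n \<omega> j. X n (\<tau> j) \<omega>) L (\<lambda>\<omega> j. Z (\<tau> j) \<omega>)"
  shows "conv_fdd M X L Z"
  unfolding conv_fdd_def
proof safe
  fix J :: "real set" and f :: "(real \<Rightarrow> real) \<Rightarrow> real"
  assume J: "finite J" "J \<subseteq> {0..}"
    and f: "continuous_map (product_topology (\<lambda>_. euclideanreal) J) euclideanreal f"
    "bounded (f ` (J \<rightarrow>\<^sub>E UNIV))"
  obtain K where K: "\<bar>f x\<bar> \<le> K" if "x \<in> J \<rightarrow>\<^sub>E UNIV" for x
    using f(2) unfolding bounded_real by blast
  obtain \<tau> :: "nat \<Rightarrow> real" where \<tau>: "mono \<tau>" "\<tau> 0 = 0" "finite (range \<tau>)" "J \<subseteq> range \<tau>"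
    using mono_enumeration[OF J] by blast
  define idx where "idx = inv \<tau>"
  have idx: "\<tau> (idx t) = t" if "t \<in> J" for t
    using \<tau>(4) that unfolding idx_def by (intro f_inv_into_f) auto
  define g where "g v = f (\<lambda>t\<in>J. v (idx t))" for v :: "nat \<Rightarrow> real"
  have "continuous_map (product_topology (\<lambda>_. euclideanreal) UNIV)
      (product_topology (\<lambda>_. euclideanreal) J) (\<lambda>v. \<lambda>t\<in>J. v (idx t))"
    by (subst continuous_map_componentwise) (auto intro: continuous_map_product_projection)
  then have "continuous_map (product_topology (\<lambda>_. euclideanreal) UNIV) euclideanreal g"
    unfolding g_def by (rule continuous_map_compose[OF _ f(1), unfolded comp_def])
  then have "continuous_on UNIV g"
    by (simp add: euclidean_product_topology)
  moreover have "\<bar>g v\<bar> \<le> K" for v unfolding g_def by (intro K) auto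
  ultimately have lim: "(\<lambda>n. \<integral>\<omega>. g (\<lambda>j. X n (\<tau> j) \<omega>) \<partial>M) \<longlonglongrightarrow> (\<integral>\<omega>. g (\<lambda>j. Z (\<tau> j) \<omega>) \<partial>L)"
    using mono_from_zero_nonneg[OF \<tau>(1,2)]
    by (intro weakly_conv_bounded_continuous[OF M L _ _ conv[OF \<tau>(1-3)]]
        measurable_coordinatewise_then_product X Z) auto
  have eq: "g (\<lambda>j. W (\<tau> j)) = f (\<lambda>t\<in>J. W t)" for W
    unfolding g_def by (rule arg_cong[where f = f]) (auto simp: idx restrict_def)
  show "(\<lambda>n. \<integral>\<omega>. f (\<lambda>t\<in>J. X n t \<omega>) \<partial>M) \<longlonglongrightarrow> (\<integral>\<omega>. f (\<lambda>t\<in>J. Z t \<omega>) \<partial>L)"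
    using lim unfolding eq[of "\<lambda>t. X _ t _"] eq[of "\<lambda>t. Z t _"] .
qed

text \<open>Closeness at single times is enough, since \<open>\<tau>\<close> takes finitely many
  values and a union bound over them controls the distance of the sequences. The threshold
  \<open>\<epsilon> / 2\<close> compensates the factor 2 in \<open>dist_fun_le\<close>, the level
  \<open>\<delta> / card T\<close> the number of events.\<close>

lemma conv_fdd_slutsky:
  assumes M: "prob_space M" and L: "prob_space L"
    and X: "\<And>n t. 0 \<le> t \<Longrightarrow> X n t \<in> borel_measurable M"
    and Y: "\<And>n t. 0 \<le> t \<Longrightarrow> Y n t \<in> borel_measurable M"
    and Z: "\<And>t. 0 \<le> t \<Longrightarrow> Z t \<in> borel_measurable L"
    and conv: "conv_fdd M X L Z"
    and close: "\<And>t. 0 \<le> t \<Longrightarrow> conv_in_prob M (\<lambda>n \<omega>. Y n t \<omega> - X n t \<omega>) 0 sequentially"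
  shows "conv_fdd M Y L Z"
proof (rule conv_fddI[OF M L Y Z])
  interpret prob_space M by fact
  fix \<tau> :: "nat \<Rightarrow> real" assume \<tau>: "mono \<tau>" "\<tau> 0 = 0" "finite (range \<tau>)"
  have nonneg: "0 \<le> \<tau> j" for j by (rule mono_from_zero_nonneg[OF \<tau>(1,2)])
  have [measurable]: "(\<lambda>\<omega> j. X n (\<tau> j) \<omega>) \<in> borel_measurable M" "(\<lambda>\<omega> j. Y n (\<tau> j) \<omega>) \<in> borel_measurable M" for n
    by (intro measurable_coordinatewise_then_product X Y nonneg)+
  have [measurable]: "X n t \<in> borel_measurable M" "Y n t \<in> borel_measurable M" if "t \<in> range \<tau>" for n t
    using that nonneg X Y by auto
  show "weakly_conv M (\<lambda>n \<omega> j. Y n (\<tau> j) \<omega>) L (\<lambda>\<omega> j. Z (\<tau> j) \<omega>)"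
  proof (rule weakly_conv_slutsky[OF M])
    show "weakly_conv M (\<lambda>n \<omega> j. X n (\<tau> j) \<omega>) L (\<lambda>\<omega> j. Z (\<tau> j) \<omega>)"
      using conv \<tau>(3) nonneg by (intro conv_fdd_imp_weakly_conv) auto
    show "conv_in_prob M (\<lambda>n \<omega>. dist (\<lambda>j. Y n (\<tau> j) \<omega>) (\<lambda>j. X n (\<tau> j) \<omega>)) 0 sequentially"
    proof (rule conv_in_probI)
      fix \<epsilon> \<delta> :: real assume "\<epsilon> > 0" "\<delta> > 0"
      define T where "T = range \<tau>"
      have T: "finite T" "T \<noteq> {}" using \<tau>(3) by (auto simp: T_def)
      have "\<forall>\<^sub>F n in sequentially. \<forall>t\<in>T. prob {\<omega>\<in>space M. \<bar>Y n t \<omega> - X n t \<omega> - 0\<bar> > \<epsilon> / 2} < \<delta> / card T"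
        using \<open>\<epsilon> > 0\<close> \<open>\<delta> > 0\<close> T nonneg
        by (intro eventually_ball_finite ballI conv_in_probD[OF close]) (auto simp: T_def card_gt_0_iff)
      then show "\<forall>\<^sub>F n in sequentially. prob {\<omega>\<in>space M. \<bar>dist (\<lambda>j. Y n (\<tau> j) \<omega>) (\<lambda>j. X n (\<tau> j) \<omega>) - 0\<bar> > \<epsilon>} < \<delta>"
      proof eventually_elim
        case (elim n)
        have "prob {\<omega>\<in>space M. \<bar>dist (\<lambda>j. Y n (\<tau> j) \<omega>) (\<lambda>j. X n (\<tau> j) \<omega>) - 0\<bar> > \<epsilon>}
          \<le> prob (\<Union>t\<in>T. {\<omega>\<in>space M. \<bar>Y n t \<omega> - X n t \<omega>\<bar> > \<epsilon> / 2})"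
        proof (rule finite_measure_mono)
          show "{\<omega>\<in>space M. \<bar>dist (\<lambda>j. Y n (\<tau> j) \<omega>) (\<lambda>j. X n (\<tau> j) \<omega>) - 0\<bar> > \<epsilon>}
            \<subseteq> (\<Union>t\<in>T. {\<omega>\<in>space M. \<bar>Y n t \<omega> - X n t \<omega>\<bar> > \<epsilon> / 2})"
          proof safe
            fix \<omega> assume *: "\<omega> \<in> space M" "\<epsilon> < \<bar>dist (\<lambda>j. Y n (\<tau> j) \<omega>) (\<lambda>j. X n (\<tau> j) \<omega>) - 0\<bar>"
            then have "\<not> (\<forall>j. \<bar>Y n (\<tau> j) \<omega> - X n (\<tau> j) \<omega>\<bar> \<le> \<epsilon> / 2)"
              using dist_fun_le[of "\<lambda>j. Y n (\<tau> j) \<omega>" "\<lambda>j. X n (\<tau> j) \<omega>" "\<epsilon> / 2"] by auto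
            then show "\<omega> \<in> (\<Union>t\<in>T. {\<omega>\<in>space M. \<bar>Y n t \<omega> - X n t \<omega>\<bar> > \<epsilon> / 2})"
              using * by (auto simp: T_def not_le)
          qed
          show "(\<Union>t\<in>T. {\<omega>\<in>space M. \<bar>Y n t \<omega> - X n t \<omega>\<bar> > \<epsilon> / 2}) \<in> events"
            using T(1) by (intro sets.finite_UN) (auto simp: T_def)
        qed
        also have "\<dots> \<le> (\<Sum>t\<in>T. prob {\<omega>\<in>space M. \<bar>Y n t \<omega> - X n t \<omega>\<bar> > \<epsilon> / 2})"
          using T(1) by (intro finite_measure_subadditive_finite) (auto simp: T_def)
        also have "\<dots> < (\<Sum>t\<in>T. \<delta> / card T)"
          using elim T by (intro sum_strict_mono) auto
        also have "\<dots> = \<delta>" using T by simp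
        finally show ?case .
      qed
    qed
  qed simp_all
qed

text \<open>This is tightness, demanded only eventually along the filter so that it also applies to
  real time.\<close>

definition bounded_in_prob :: "'a measure \<Rightarrow> ('t \<Rightarrow> 'a \<Rightarrow> real) \<Rightarrow> 't filter \<Rightarrow> bool" where
  "bounded_in_prob M W F \<longleftrightarrow>
     (\<forall>\<delta>>0. \<exists>T>0. \<forall>\<^sub>F t in F. measure M {\<omega>\<in>space M. \<bar>W t \<omega>\<bar> > T} < \<delta>)"

lemma weakly_conv_bounded_in_prob:
  fixes X :: "nat \<Rightarrow> 'a \<Rightarrow> real"
  assumes M: "prob_space M" and L: "prob_space L"
    and X [measurable]: "\<And>n. X n \<in> borel_measurable M" and Z [measurable]: "Z \<in> borel_measurable L"
    and conv: "weakly_conv M X L Z"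
  shows "bounded_in_prob M X sequentially"
  unfolding bounded_in_prob_def
proof (intro allI impI)
  interpret M: prob_space M by fact
  interpret L: prob_space L by fact
  fix \<delta> :: real assume "\<delta> > 0"
  \<comment> \<open>A continuous function between the indicators of
    \<open>\<bar>x\<bar> > m + 1\<close> and \<open>\<bar>x\<bar> > m\<close>; tail probabilities
    are thereby compared with integrals that converge.\<close>
  define cut :: "nat \<Rightarrow> real \<Rightarrow> real" where "cut m x = min 1 (max 0 (\<bar>x\<bar> - m))" for m x
  have c: "continuous_on UNIV (cut m)" and b: "\<bar>cut m x\<bar> \<le> 1" for m x
    unfolding cut_def by (auto intro!: continuous_intros)
  note [measurable] = borel_measurable_continuous_onI[OF c]
  have "(\<lambda>m. \<integral>\<omega>. cut m (Z \<omega>) \<partial>L) \<longlonglongrightarrow> (\<integral>\<omega>. 0 \<partial>L)"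
  proof (rule integral_dominated_convergence[where w = "\<lambda>_. 1"])
    show "AE \<omega> in L. (\<lambda>m. cut m (Z \<omega>)) \<longlonglongrightarrow> 0"
    proof (rule AE_I2, rule tendsto_eventually)
      fix \<omega>
      show "\<forall>\<^sub>F m in sequentially. cut m (Z \<omega>) = 0"
        using eventually_ge_at_top[of "nat \<lceil>\<bar>Z \<omega>\<bar>\<rceil>"]
        by eventually_elim (auto simp: cut_def max_def nat_le_iff ceiling_le_iff)
    qed
  qed (use b in auto)
  then have "\<forall>\<^sub>F m in sequentially. (\<integral>\<omega>. cut m (Z \<omega>) \<partial>L) < \<delta>"
    using \<open>\<delta> > 0\<close> by (intro order_tendstoD) auto
  then obtain m where m: "(\<integral>\<omega>. cut m (Z \<omega>) \<partial>L) < \<delta>"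
    by (auto simp: eventually_sequentially)
  have "\<forall>\<^sub>F n in sequentially. (\<integral>\<omega>. cut m (X n \<omega>) \<partial>M) < \<delta>"
    using weakly_conv_bounded_continuous[OF M L X Z conv c b] m by (rule order_tendstoD)
  then have "\<forall>\<^sub>F n in sequentially. measure M {\<omega>\<in>space M. \<bar>X n \<omega>\<bar> > real m + 1} < \<delta>"
  proof eventually_elim
    case (elim n)
    have "measure M {\<omega>\<in>space M. \<bar>X n \<omega>\<bar> > real m + 1} = (\<integral>\<omega>. indicator {\<omega>\<in>space M. \<bar>X n \<omega>\<bar> > real m + 1} \<omega> \<partial>M)"
      by simp
    also have "\<dots> \<le> (\<integral>\<omega>. cut m (X n \<omega>) \<partial>M)"
      using M.integrable_bounded_continuous[OF X c b]
      by (intro integral_mono integrable_real_indicator) (auto simp: less_top[symmetric] cut_def indicator_def)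
    finally show ?case using elim by simp
  qed
  then show "\<exists>T>0. \<forall>\<^sub>F n in sequentially. measure M {\<omega>\<in>space M. \<bar>X n \<omega>\<bar> > T} < \<delta>"
    by (intro exI[of _ "real m + 1"]) auto
qed

text \<open>A single time is encoded as a constant sequence; the coordinate at 0 leads back to real
  variables.\<close>

lemma conv_fdd_bounded_in_prob:
  assumes M: "prob_space M" and L: "prob_space L"
    and "\<And>n. X n t \<in> borel_measurable M" "Z t \<in> borel_measurable L" "conv_fdd M X L Z" "0 \<le> t"
  shows "bounded_in_prob M (\<lambda>n. X n t) sequentially"
proof -
  have "weakly_conv M (\<lambda>n \<omega> (j::nat). X n t \<omega>) L (\<lambda>\<omega> j. Z t \<omega>)"
    using conv_fdd_imp_weakly_conv[OF assms(5), of "\<lambda>_. t"] assms(6) by simp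
  then have "weakly_conv M (\<lambda>n. X n t) L (Z t)"
    using weakly_conv_continuous_map[OF M L _ _ _ continuous_on_product_coordinates[of 0],
        of "\<lambda>n \<omega> j. X n t \<omega>" "\<lambda>\<omega> j. Z t \<omega>"] assms(3,4)
    by (auto intro!: measurable_coordinatewise_then_product)
  then show ?thesis using assms by (intro weakly_conv_bounded_in_prob[OF M L]) auto
qed

section \<open>Terms that vanish or stay bounded in probability\<close>

lemma conv_in_prob_const:
  assumes "(a \<longlongrightarrow> l) F"
  shows "conv_in_prob M (\<lambda>t \<omega>. a t) l F"
proof (rule conv_in_probI)
  fix \<epsilon> \<delta> :: real assume "\<epsilon> > 0" "\<delta> > 0"
  then have "\<forall>\<^sub>F t in F. \<bar>a t - l\<bar> < \<epsilon>"
    using tendstoD[OF assms] by (auto simp: dist_real_def)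
  then show "\<forall>\<^sub>F t in F. measure M {\<omega>\<in>space M. \<bar>a t - l\<bar> > \<epsilon>} < \<delta>"
    by eventually_elim (use \<open>\<delta> > 0\<close> in auto)
qed

lemma conv_in_prob_cong:
  assumes "\<forall>\<^sub>F t in F. \<forall>\<omega>\<in>space M. V t \<omega> = W t \<omega>"
  shows "conv_in_prob M V c F \<longleftrightarrow> conv_in_prob M W c F"
proof -
  have "\<forall>\<^sub>F t in F. measure M {\<omega>\<in>space M. \<bar>V t \<omega> - c\<bar> > \<epsilon>} = measure M {\<omega>\<in>space M. \<bar>W t \<omega> - c\<bar> > \<epsilon>}" for \<epsilon>
    using assms by eventually_elim (auto intro!: arg_cong[where f = "measure M"])
  from tendsto_cong[OF this] show ?thesis unfolding conv_in_prob_def by simp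
qed

lemma conv_in_prob_imp_bounded_in_prob:
  assumes M: "prob_space M" and [measurable]: "\<And>t. W t \<in> borel_measurable M"
    and "conv_in_prob M W a F"
  shows "bounded_in_prob M W F"
  unfolding bounded_in_prob_def
proof (intro allI impI)
  interpret prob_space M by fact
  fix \<delta> :: real assume "\<delta> > 0"
  have "\<forall>\<^sub>F t in F. prob {\<omega>\<in>space M. \<bar>W t \<omega> - a\<bar> > 1} < \<delta>"
    using assms(3) \<open>\<delta> > 0\<close> by (intro conv_in_probD) auto
  then have "\<forall>\<^sub>F t in F. prob {\<omega>\<in>space M. \<bar>W t \<omega>\<bar> > \<bar>a\<bar> + 1} < \<delta>"
  proof eventually_elim
    case (elim t)
    have "prob {\<omega>\<in>space M. \<bar>W t \<omega>\<bar> > \<bar>a\<bar> + 1} \<le> prob {\<omega>\<in>space M. \<bar>W t \<omega> - a\<bar> > 1}"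
      by (intro finite_measure_mono) auto
    with elim show ?case by simp
  qed
  then show "\<exists>T>0. \<forall>\<^sub>F t in F. prob {\<omega>\<in>space M. \<bar>W t \<omega>\<bar> > T} < \<delta>"
    by (intro exI[of _ "\<bar>a\<bar> + 1"]) auto
qed

lemma conv_in_prob_zero_mult_bounded:
  assumes M: "prob_space M" and [measurable]: "\<And>t. W t \<in> borel_measurable M"
    and W: "bounded_in_prob M W F" and a: "(a \<longlongrightarrow> 0) F"
  shows "conv_in_prob M (\<lambda>t \<omega>. a t * W t \<omega>) 0 F"
proof (rule conv_in_probI)
  interpret prob_space M by fact
  fix \<epsilon> \<delta> :: real assume "\<epsilon> > 0" "\<delta> > 0"
  then obtain T where T: "T > 0" "\<forall>\<^sub>F t in F. prob {\<omega>\<in>space M. \<bar>W t \<omega>\<bar> > T} < \<delta>"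
    using W unfolding bounded_in_prob_def by blast
  have "\<forall>\<^sub>F t in F. \<bar>a t\<bar> < \<epsilon> / T"
    using tendstoD[OF a, of "\<epsilon> / T"] T(1) \<open>\<epsilon> > 0\<close> by (auto simp: dist_real_def)
  with T(2) show "\<forall>\<^sub>F t in F. prob {\<omega>\<in>space M. \<bar>a t * W t \<omega> - 0\<bar> > \<epsilon>} < \<delta>"
  proof eventually_elim
    case (elim t)
    have "\<bar>a t * W t \<omega>\<bar> \<le> \<epsilon>" if "\<bar>W t \<omega>\<bar> \<le> T" for \<omega>
    proof -
      have "\<bar>a t\<bar> * \<bar>W t \<omega>\<bar> \<le> \<epsilon> / T * T"
        using elim(2) that T(1) \<open>\<epsilon> > 0\<close> by (intro mult_mono) auto
      then show ?thesis using T(1) by (simp add: abs_mult)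
    qed
    then have "prob {\<omega>\<in>space M. \<bar>a t * W t \<omega> - 0\<bar> > \<epsilon>} \<le> prob {\<omega>\<in>space M. \<bar>W t \<omega>\<bar> > T}"
      by (intro finite_measure_mono) (force simp: not_le)+
    with elim(1) show ?case by simp
  qed
qed

section \<open>Sums with a random number of terms\<close>

text \<open>Naming the sigma-algebra of \<open>indep_families\<close> as a measure lets
  measurability with respect to the counts or the shocks alone be derived by the usual
  rules.\<close>

definition family_algebra ::
  "'a measure \<Rightarrow> 'i set \<Rightarrow> ('i \<Rightarrow> 'a \<Rightarrow> 'b::topological_space) \<Rightarrow> 'a measure" where
  "family_algebra M I X = vimage_algebra (space M) (\<lambda>\<omega>. \<lambda>i\<in>I. X i \<omega>) (PiM I (\<lambda>_. borel))"

lemma space_family_algebra [simp]: "space (family_algebra M I X) = space M"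
  by (simp add: family_algebra_def)

lemma measurable_family_algebra:
  assumes "i \<in> I"
  shows "X i \<in> borel_measurable (family_algebra M I X)"
proof -
  have "(\<lambda>\<omega>. \<lambda>i\<in>I. X i \<omega>) \<in> measurable (family_algebra M I X) (PiM I (\<lambda>_. borel))"
    unfolding family_algebra_def by (rule measurable_vimage_algebra1) (auto simp: space_PiM)
  from measurable_compose[OF this measurable_component_singleton[OF assms]]
  show ?thesis using assms by simp
qed

lemma indep_familiesD:
  assumes "indep_families M I X J Y"
  shows "prob_space.indep_set M (sets (family_algebra M I X)) (sets (family_algebra M J Y))"
    and "\<And>i. i \<in> I \<Longrightarrow> X i \<in> borel_measurable M" and "\<And>j. j \<in> J \<Longrightarrow> Y j \<in> borel_measurable M"
  using assms by (auto simp: indep_families_def family_algebra_def)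

text \<open>Independence of two families passes to functionals of them, in particular to whole
  sequences of values; the product law is identified on rectangles.\<close>

lemma indep_families_indep_pair:
  fixes U :: "'a \<Rightarrow> 'v::second_countable_topology" and V :: "'a \<Rightarrow> 'w::second_countable_topology"
  assumes M: "prob_space M" and ind: "indep_families M I X J Y"
    and U: "U \<in> borel_measurable (family_algebra M I X)"
    and V: "V \<in> borel_measurable (family_algebra M J Y)"
  shows "indep_pair M U V"
proof -
  interpret prob_space M by fact
  note set = indep_familiesD(1)[OF ind]
  have U' [measurable]: "U \<in> borel_measurable M"
    using measurable_sets[OF U] indep_setD_ev1[OF set] by (intro measurableI) auto
  have V' [measurable]: "V \<in> borel_measurable M"
    using measurable_sets[OF V] indep_setD_ev2[OF set] by (intro measurableI) auto
  interpret U: prob_space "distr M borel U" by (rule prob_space_distr) simp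
  interpret V: prob_space "distr M borel V" by (rule prob_space_distr) simp
  have "distr M borel U \<Otimes>\<^sub>M distr M borel V = distr M (borel \<Otimes>\<^sub>M borel) (\<lambda>\<omega>. (U \<omega>, V \<omega>))"
  proof (rule pair_measure_eqI)
    fix A B assume "A \<in> sets (distr M borel U)" "B \<in> sets (distr M borel V)"
    then have [measurable]: "A \<in> sets borel" "B \<in> sets borel" by auto
    have "emeasure (distr M (borel \<Otimes>\<^sub>M borel) (\<lambda>\<omega>. (U \<omega>, V \<omega>))) (A \<times> B)
        = emeasure M ((U -` A \<inter> space M) \<inter> (V -` B \<inter> space M))"
      by (subst emeasure_distr) (auto intro!: arg_cong[where f = "emeasure M"])
    also have "\<dots> = prob (U -` A \<inter> space M) * prob (V -` B \<inter> space M)"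
      using measurable_sets[OF U, of A] measurable_sets[OF V, of B]
      by (subst emeasure_eq_measure, subst indep_setD[OF set]) auto
    finally show "emeasure (distr M borel U) A * emeasure (distr M borel V) B
        = emeasure (distr M (borel \<Otimes>\<^sub>M borel) (\<lambda>\<omega>. (U \<omega>, V \<omega>))) (A \<times> B)"
      by (simp add: emeasure_distr emeasure_eq_measure ennreal_mult)
  qed (unfold_locales, simp)
  then show ?thesis by (simp add: indep_pair_def)
qed

text \<open>The event is split according to the value of \<open>K\<close>. Each piece factorizes by
  independence, the bound for fixed \<open>k\<close> applies, and the probabilities of the values of
  \<open>K\<close> add up to at most 1.\<close>

lemma (in prob_space) random_index_deviation:
  fixes K :: "'a \<Rightarrow> nat" and S :: "nat \<Rightarrow> 'a \<Rightarrow> real"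
  assumes ind: "indep_set \<A> \<B>"
    and K: "\<And>k. {\<omega>\<in>space M. K \<omega> = k} \<in> \<A>"
    and S: "\<And>k. {\<omega>\<in>space M. \<bar>S k \<omega> - S m \<omega>\<bar> > \<epsilon>} \<in> \<B>"
    and dev: "\<And>k. \<bar>real k - real m\<bar> \<le> \<delta> \<Longrightarrow> prob {\<omega>\<in>space M. \<bar>S k \<omega> - S m \<omega>\<bar> > \<epsilon>} \<le> c"
    and "0 \<le> c"
  shows "prob {\<omega>\<in>space M. \<bar>S (K \<omega>) \<omega> - S m \<omega>\<bar> > \<epsilon>}
    \<le> prob {\<omega>\<in>space M. \<bar>real (K \<omega>) - real m\<bar> > \<delta>} + c"
proof -
  \<comment> \<open>A finite set, since indices are natural numbers; all indices outside are charged
    to the event \<open>D\<close>.\<close>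
  define I where "I = {k. \<bar>real k - real m\<bar> \<le> \<delta>}"
  have "I \<subseteq> {..nat \<lceil>real m + \<delta>\<rceil>}"
    unfolding I_def by (auto simp: abs_le_iff) linarith
  then have I: "finite I" by (rule finite_subset) simp
  have K' [measurable]: "{\<omega>\<in>space M. K \<omega> = k} \<in> events" for k
    using indep_setD_ev1[OF ind] K by auto
  have S' [measurable]: "{\<omega>\<in>space M. \<bar>S k \<omega> - S m \<omega>\<bar> > \<epsilon>} \<in> events" for k
    using indep_setD_ev2[OF ind] S by auto
  have [measurable]: "K \<in> measurable M (count_space UNIV)"
  proof (rule measurable_count_space_eq2_countable[THEN iffD2], safe)
    fix k
    have "K -` {k} \<inter> space M = {\<omega>\<in>space M. K \<omega> = k}" by auto
    then show "K -` {k} \<inter> space M \<in> events" using K' by simp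
  qed auto
  define D where "D = {\<omega>\<in>space M. \<bar>real (K \<omega>) - real m\<bar> > \<delta>}"
  have [measurable]: "D \<in> events" unfolding D_def by measurable
  define E where "E k = {\<omega>\<in>space M. K \<omega> = k} \<inter> {\<omega>\<in>space M. \<bar>S k \<omega> - S m \<omega>\<bar> > \<epsilon>}" for k
  have [measurable]: "E k \<in> events" for k unfolding E_def by measurable
  have "prob {\<omega>\<in>space M. \<bar>S (K \<omega>) \<omega> - S m \<omega>\<bar> > \<epsilon>} \<le> prob (D \<union> (\<Union>k\<in>I. E k))"
    using I by (intro finite_measure_mono) (auto simp: D_def E_def I_def)
  also have "\<dots> \<le> prob D + prob (\<Union>k\<in>I. E k)"
    using I by (intro measure_subadditive) auto
  also have "prob (\<Union>k\<in>I. E k) \<le> (\<Sum>k\<in>I. prob (E k))"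
    using I by (intro finite_measure_subadditive_finite) auto
  also have "\<dots> = (\<Sum>k\<in>I. prob {\<omega>\<in>space M. K \<omega> = k} * prob {\<omega>\<in>space M. \<bar>S k \<omega> - S m \<omega>\<bar> > \<epsilon>})"
    unfolding E_def by (intro sum.cong refl indep_setD[OF ind] K S)
  also have "\<dots> \<le> (\<Sum>k\<in>I. prob {\<omega>\<in>space M. K \<omega> = k} * c)"
    using dev by (intro sum_mono mult_left_mono) (auto simp: I_def)
  also have "\<dots> = prob (\<Union>k\<in>I. {\<omega>\<in>space M. K \<omega> = k}) * c"
    unfolding sum_distrib_right[symmetric] using I
    by (subst finite_measure_finite_Union) (auto simp: disjoint_family_on_def)
  also have "\<dots> \<le> 1 * c" using \<open>0 \<le> c\<close> by (intro mult_right_mono) auto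
  finally show ?thesis by (simp add: D_def)
qed

text \<open>Mean and integrability are carried through the induction because they make the cross
  term integrable with expectation 0.\<close>

lemma (in prob_space) second_moment_sum_indep:
  fixes X :: "'i \<Rightarrow> 'a \<Rightarrow> real" and v :: real
  assumes "finite I" "indep_vars (\<lambda>_. borel) X I"
    and "\<And>i. i \<in> I \<Longrightarrow> integrable M (\<lambda>\<omega>. (X i \<omega>)\<^sup>2)"
    and "\<And>i. i \<in> I \<Longrightarrow> expectation (X i) = 0"
    and "\<And>i. i \<in> I \<Longrightarrow> expectation (\<lambda>\<omega>. (X i \<omega>)\<^sup>2) = v"
  shows "integrable M (\<lambda>\<omega>. (\<Sum>i\<in>I. X i \<omega>)\<^sup>2) \<and> expectation (\<lambda>\<omega>. \<Sum>i\<in>I. X i \<omega>) = 0 \<and>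
    expectation (\<lambda>\<omega>. (\<Sum>i\<in>I. X i \<omega>)\<^sup>2) = card I * v"
  using assms
proof (induction I rule: finite_induct)
  case (insert i I)
  have rv [measurable]: "X j \<in> borel_measurable M" if "j \<in> insert i I" for j
    using insert.prems(1) that by (auto simp: indep_vars_def2)
  have [measurable]: "X i \<in> borel_measurable M" "(\<lambda>\<omega>. \<Sum>j\<in>I. X j \<omega>) \<in> borel_measurable M"
    using rv by auto
  have IH: "integrable M (\<lambda>\<omega>. (\<Sum>i\<in>I. X i \<omega>)\<^sup>2)" "expectation (\<lambda>\<omega>. \<Sum>i\<in>I. X i \<omega>) = 0"
    "expectation (\<lambda>\<omega>. (\<Sum>i\<in>I. X i \<omega>)\<^sup>2) = card I * v"
    using insert.IH[OF indep_vars_subset[OF insert.prems(1)]] insert.prems by auto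
  have int: "integrable M (X i)" "integrable M (\<lambda>\<omega>. \<Sum>j\<in>I. X j \<omega>)"
    using insert.prems(2)[of i] IH(1) by (auto intro!: square_integrable_imp_integrable)
  have ind: "indep_var borel (X i) borel (\<lambda>\<omega>. \<Sum>j\<in>I. X j \<omega>)"
    using insert.hyps insert.prems(1) by (intro indep_vars_sum) auto
  have prod: "integrable M (\<lambda>\<omega>. X i \<omega> * (\<Sum>j\<in>I. X j \<omega>))"
    "expectation (\<lambda>\<omega>. X i \<omega> * (\<Sum>j\<in>I. X j \<omega>)) = 0"
    using indep_var_integrable[OF ind int] indep_var_lebesgue_integral[OF ind int] IH(2) by auto
  have eq: "(\<Sum>j\<in>insert i I. X j \<omega>)\<^sup>2 = (X i \<omega>)\<^sup>2 + 2 * (X i \<omega> * (\<Sum>j\<in>I. X j \<omega>)) + (\<Sum>j\<in>I. X j \<omega>)\<^sup>2" for \<omega>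
    using insert.hyps by (simp add: power2_sum)
  show ?case
    unfolding eq using insert.hyps insert.prems(2,3,4)[of i] int IH prod
    by (simp add: algebra_simps)
qed simp

text \<open>Up to sign the difference is a sum over the indices between \<open>m\<close> and
  \<open>k\<close>, whichever is larger; its variance is \<open>v\<close> times their number, and
  Chebyshev's inequality applies.\<close>

lemma (in prob_space) partial_sum_deviation:
  fixes e :: "nat \<Rightarrow> 'a \<Rightarrow> real" and v :: real
  assumes ind: "indep_vars (\<lambda>_. borel) e {1..}"
    and e: "\<And>k. k \<ge> 1 \<Longrightarrow> integrable M (\<lambda>\<omega>. (e k \<omega>)\<^sup>2)" "\<And>k. k \<ge> 1 \<Longrightarrow> expectation (e k) = 0"
      "\<And>k. k \<ge> 1 \<Longrightarrow> expectation (\<lambda>\<omega>. (e k \<omega>)\<^sup>2) = v"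
    and "\<epsilon> > 0"
  shows "prob {\<omega>\<in>space M. \<bar>(\<Sum>j=1..k. e j \<omega>) - (\<Sum>j=1..m. e j \<omega>)\<bar> > \<epsilon>} \<le> \<bar>real k - real m\<bar> * v / \<epsilon>\<^sup>2"
proof -
  define I where "I = {min k m<..max k m}"
  have card: "real (card I) = \<bar>real k - real m\<bar>" by (auto simp: I_def)
  have eq: "\<bar>(\<Sum>j=1..k. e j \<omega>) - (\<Sum>j=1..m. e j \<omega>)\<bar> = \<bar>\<Sum>j\<in>I. e j \<omega>\<bar>" for \<omega>
  proof -
    have *: "(\<Sum>j=1..b. e j \<omega>) = (\<Sum>j=1..a. e j \<omega>) + (\<Sum>j\<in>{a<..b}. e j \<omega>)" if "a \<le> b" for a b
    proof -
      have "{1..b} = {1..a} \<union> {a<..b}" using that by auto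
      then show ?thesis by (simp only:) (rule sum.union_disjoint, auto)
    qed
    show ?thesis
    proof (cases "k \<le> m")
      case True
      show ?thesis using *[OF True] True by (simp add: I_def)
    next
      case False
      then have "m \<le> k" by simp
      from *[OF this] this show ?thesis by (simp add: I_def min_def max_def)
    qed
  qed
  have [measurable]: "e j \<in> borel_measurable M" if "j \<in> I" for j
    using ind that by (auto simp: indep_vars_def2 I_def)
  have moments: "integrable M (\<lambda>\<omega>. (\<Sum>i\<in>I. e i \<omega>)\<^sup>2)" "expectation (\<lambda>\<omega>. \<Sum>i\<in>I. e i \<omega>) = 0"
    "expectation (\<lambda>\<omega>. (\<Sum>i\<in>I. e i \<omega>)\<^sup>2) = card I * v"
  proof -
    have "finite I" and I: "I \<subseteq> {1..}" and I_pos: "\<And>i. i \<in> I \<Longrightarrow> i \<ge> 1" by (auto simp: I_def)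
    from second_moment_sum_indep[OF this(1) indep_vars_subset[OF ind I] e(1)[OF I_pos] e(2)[OF I_pos] e(3)[OF I_pos]]
    show "integrable M (\<lambda>\<omega>. (\<Sum>i\<in>I. e i \<omega>)\<^sup>2)" "expectation (\<lambda>\<omega>. \<Sum>i\<in>I. e i \<omega>) = 0"
      "expectation (\<lambda>\<omega>. (\<Sum>i\<in>I. e i \<omega>)\<^sup>2) = card I * v"
      by blast+
  qed
  have "prob {\<omega>\<in>space M. \<bar>\<Sum>j\<in>I. e j \<omega>\<bar> > \<epsilon>}
      \<le> prob {\<omega>\<in>space M. \<epsilon> \<le> \<bar>(\<Sum>j\<in>I. e j \<omega>) - expectation (\<lambda>\<omega>. \<Sum>j\<in>I. e j \<omega>)\<bar>}"
    using moments(2) by (intro finite_measure_mono) auto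
  also have "\<dots> \<le> variance (\<lambda>\<omega>. \<Sum>j\<in>I. e j \<omega>) / \<epsilon>\<^sup>2"
    using moments(1) \<open>\<epsilon> > 0\<close> by (intro Chebyshev_inequality) auto
  finally show ?thesis unfolding eq card[symmetric] using moments by simp
qed

text \<open>Given the index, the variance of the scaled difference is
  \<open>(c t)\<^sup>2 * v\<close> times the distance of the two indices, and \<open>lim\<close>
  makes this small. The sigma-algebras \<open>G\<close> and \<open>H\<close> carry the independence
  of indices and summands.\<close>

lemma random_sum_conv_in_prob:
  fixes e :: "nat \<Rightarrow> 'a \<Rightarrow> real" and v :: real and K :: "'t \<Rightarrow> 'a \<Rightarrow> nat"
  assumes M: "prob_space M" and ind: "prob_space.indep_vars M (\<lambda>_. borel) e {1..}"
    and e: "\<And>k. k \<ge> 1 \<Longrightarrow> integrable M (\<lambda>\<omega>. (e k \<omega>)\<^sup>2)" "\<And>k. k \<ge> 1 \<Longrightarrow> prob_space.expectation M (e k) = 0"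
      "\<And>k. k \<ge> 1 \<Longrightarrow> prob_space.expectation M (\<lambda>\<omega>. (e k \<omega>)\<^sup>2) = v"
    and alg: "prob_space.indep_set M (sets G) (sets H)" "space G = space M" "space H = space M"
    and K: "\<And>t. K t \<in> measurable G (count_space UNIV)"
    and e_meas: "\<And>k. k \<ge> 1 \<Longrightarrow> e k \<in> borel_measurable H"
    and lim: "conv_in_prob M (\<lambda>t \<omega>. (c t)\<^sup>2 * (real (K t \<omega>) - real (m t))) 0 F"
  shows "conv_in_prob M (\<lambda>t \<omega>. c t * ((\<Sum>j=1..K t \<omega>. e j \<omega>) - (\<Sum>j=1..m t. e j \<omega>))) 0 F"
proof (rule conv_in_probI)
  interpret prob_space M by fact
  fix \<epsilon> \<delta> :: real assume "\<epsilon> > 0" "\<delta> > 0"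
  have "0 \<le> expectation (\<lambda>\<omega>. (e 1 \<omega>)\<^sup>2)" by simp
  also have "\<dots> = v" by (rule e(3)) simp
  finally have "v \<ge> 0" .
  \<comment> \<open>Chosen so that the Chebyshev bound
    \<open>\<theta> * v / \<epsilon>\<^sup>2\<close> is at most \<open>\<delta> / 2\<close>, also
    when \<open>v = 0\<close>.\<close>
  define \<theta> where "\<theta> = \<delta> * \<epsilon>\<^sup>2 / (2 * (v + 1))"
  have \<theta>: "\<theta> > 0" "\<theta> * v / \<epsilon>\<^sup>2 \<le> \<delta> / 2"
    using \<open>\<epsilon> > 0\<close> \<open>\<delta> > 0\<close> \<open>v \<ge> 0\<close> by (auto simp: \<theta>_def divide_simps mult_le_cancel_left)
  have "\<forall>\<^sub>F t in F. prob {\<omega>\<in>space M. \<bar>(c t)\<^sup>2 * (real (K t \<omega>) - real (m t)) - 0\<bar> > \<theta>} < \<delta> / 2"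
    using \<theta>(1) \<open>\<delta> > 0\<close> by (intro conv_in_probD[OF lim]) auto
  then show "\<forall>\<^sub>F t in F. prob {\<omega>\<in>space M. \<bar>c t * ((\<Sum>j=1..K t \<omega>. e j \<omega>) - (\<Sum>j=1..m t. e j \<omega>)) - 0\<bar> > \<epsilon>} < \<delta>"
  proof eventually_elim
    case (elim t)
    show ?case
    proof (cases "c t = 0")
      case True
      then show ?thesis using \<open>\<epsilon> > 0\<close> \<open>\<delta> > 0\<close> by simp
    next
      case False
      define \<epsilon>' where "\<epsilon>' = \<epsilon> / \<bar>c t\<bar>"
      have \<epsilon>': "\<epsilon>' > 0" using False \<open>\<epsilon> > 0\<close> by (simp add: \<epsilon>'_def)
      have scale: "\<bar>c t * x - 0\<bar> > \<epsilon> \<longleftrightarrow> \<bar>x\<bar> > \<epsilon>'" for x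
        using False by (simp add: \<epsilon>'_def abs_mult pos_divide_less_eq mult.commute)
      have scale': "\<bar>(c t)\<^sup>2 * x - 0\<bar> > \<theta> \<longleftrightarrow> \<bar>x\<bar> > \<theta> / (c t)\<^sup>2" for x
        using False by (simp add: abs_mult pos_divide_less_eq mult.commute)
      have "prob {\<omega>\<in>space M. \<bar>(\<Sum>j=1..K t \<omega>. e j \<omega>) - (\<Sum>j=1..m t. e j \<omega>)\<bar> > \<epsilon>'}
        \<le> prob {\<omega>\<in>space M. \<bar>real (K t \<omega>) - real (m t)\<bar> > \<theta> / (c t)\<^sup>2} + \<theta> / (c t)\<^sup>2 * v / \<epsilon>'\<^sup>2"
      proof (rule random_index_deviation[OF alg(1)])
        show "{\<omega>\<in>space M. K t \<omega> = k} \<in> sets G" for k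
        proof -
          have "{\<omega>\<in>space M. K t \<omega> = k} = K t -` {k} \<inter> space G" by (auto simp: alg)
          then show ?thesis using measurable_sets[OF K, of "{k}" t] by simp
        qed
        show "{\<omega>\<in>space M. \<bar>(\<Sum>j=1..k. e j \<omega>) - (\<Sum>j=1..m t. e j \<omega>)\<bar> > \<epsilon>'} \<in> sets H" for k
        proof -
          have [measurable]: "(\<lambda>\<omega>. \<Sum>j=1..i. e j \<omega>) \<in> borel_measurable H" for i
            by (intro borel_measurable_sum e_meas) auto
          have "{\<omega>\<in>space H. \<bar>(\<Sum>j=1..k. e j \<omega>) - (\<Sum>j=1..m t. e j \<omega>)\<bar> > \<epsilon>'} \<in> sets H"
            by measurable
          then show ?thesis by (simp add: alg)
        qed
        show "prob {\<omega>\<in>space M. \<bar>(\<Sum>j=1..k. e j \<omega>) - (\<Sum>j=1..m t. e j \<omega>)\<bar> > \<epsilon>'} \<le> \<theta> / (c t)\<^sup>2 * v / \<epsilon>'\<^sup>2"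
          if "\<bar>real k - real (m t)\<bar> \<le> \<theta> / (c t)\<^sup>2" for k
          using that \<open>v \<ge> 0\<close>
          by (intro order_trans[OF partial_sum_deviation[OF ind e \<epsilon>']] divide_right_mono mult_right_mono) auto
      qed (use \<theta>(1) \<open>v \<ge> 0\<close> in simp)
      also have "\<theta> / (c t)\<^sup>2 * v / \<epsilon>'\<^sup>2 = \<theta> * v / \<epsilon>\<^sup>2"
        using False by (simp add: \<epsilon>'_def power_divide)
      finally show ?thesis unfolding scale using elim \<theta>(2) unfolding scale' by linarith
    qed
  qed
qed

text \<open>The index may depend on the noise, so all indices up to \<open>T * n\<close> are
  controlled at once by the uniform hypothesis. Tightness of
  \<open>(c t)\<^sup>2 * real (K t \<omega>)\<close> keeps the index in this range with high
  probability.\<close>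

lemma ucp_noise_conv_in_prob:
  fixes \<eta> :: "nat \<Rightarrow> 'a \<Rightarrow> real" and K :: "'t \<Rightarrow> 'a \<Rightarrow> nat"
  assumes M: "prob_space M"
    and ucp: "ucp_to_zero M (\<lambda>n t \<omega>. real n powr (- 1 / 2) * (\<Sum>k=1..nat \<lfloor>real n * t\<rfloor>. \<eta> k \<omega>))"
    and meas: "\<And>k. k \<ge> 1 \<Longrightarrow> \<eta> k \<in> borel_measurable M"
    and K [measurable]: "\<And>t. K t \<in> measurable M (count_space UNIV)"
    and bdd: "bounded_in_prob M (\<lambda>t \<omega>. (c t)\<^sup>2 * real (K t \<omega>)) F"
    and c: "(c \<longlongrightarrow> 0) F" "\<forall>\<^sub>F t in F. c t > 0"
  shows "conv_in_prob M (\<lambda>t \<omega>. c t * (\<Sum>k=1..K t \<omega>. \<eta> k \<omega>)) 0 F"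
proof (rule conv_in_probI)
  interpret prob_space M by fact
  fix \<epsilon> \<delta> :: real assume "\<epsilon> > 0" "\<delta> > 0"
  then obtain T where T: "T > 0" "\<forall>\<^sub>F t in F. prob {\<omega>\<in>space M. \<bar>(c t)\<^sup>2 * real (K t \<omega>)\<bar> > T} < \<delta> / 2"
    using bdd half_gt_zero unfolding bounded_in_prob_def by blast
  define Z where "Z n t \<omega> = real n powr (- 1 / 2) * (\<Sum>k=1..nat \<lfloor>real n * t\<rfloor>. \<eta> k \<omega>)" for n t \<omega>
  define D where "D n = {\<omega>\<in>space M. \<exists>s\<in>{0..T}. \<bar>Z n s \<omega>\<bar> > \<epsilon> / 2}" for n
  have "(\<lambda>n. prob (D n)) \<longlonglongrightarrow> 0"
    using ucp \<open>\<epsilon> > 0\<close> unfolding ucp_to_zero_def D_def Z_def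
    by (auto dest!: spec[of _ "{0..T}"] spec[of _ "\<epsilon> / 2"])
  then have ev_D: "\<forall>\<^sub>F n in sequentially. prob (D n) < \<delta> / 2"
    using \<open>\<delta> > 0\<close> by (intro order_tendstoD) auto
  \<comment> \<open>The existential over real \<open>s\<close> involves only countably many integer
    parts, which makes the event measurable.\<close>
  have D_meas [measurable]: "D n \<in> events" for n
  proof -
    define I where "I = (\<lambda>s. nat \<lfloor>real n * s\<rfloor>) ` {0..T}"
    have "D n = (\<Union>i\<in>I. {\<omega>\<in>space M. \<bar>real n powr (- 1 / 2) * (\<Sum>k=1..i. \<eta> k \<omega>)\<bar> > \<epsilon> / 2})"
      by (auto simp: D_def Z_def I_def)
    also have "\<dots> \<in> events"
    proof (rule sets.countable_UN'')
      show "{\<omega>\<in>space M. \<bar>real n powr (- 1 / 2) * (\<Sum>k=1..i. \<eta> k \<omega>)\<bar> > \<epsilon> / 2} \<in> events" for i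
      proof -
        have [measurable]: "\<eta> k \<in> borel_measurable M" if "k \<in> {1..i}" for k
          using that meas by auto
        show ?thesis by measurable
      qed
    qed (auto simp: I_def)
    finally show ?thesis .
  qed
  \<comment> \<open>chosen so that the factor \<open>c t\<close> matches the normalization \<open>n\<^sup>-\<^sup>1\<^sup>/\<^sup>2\<close> of the noise\<close>
  define n where "n t = nat \<lceil>1 / (c t)\<^sup>2\<rceil>" for t
  have "filterlim (\<lambda>t. (c t)\<^sup>2) (at_right 0) F"
    unfolding filterlim_at using tendsto_power[OF c(1), of 2] c(2)
    by (auto elim: eventually_mono)
  then have "filterlim (\<lambda>t. 1 / (c t)\<^sup>2) at_top F"
    using filterlim_compose[OF filterlim_inverse_at_top_right] by (simp add: inverse_eq_divide)
  then have "\<forall>\<^sub>F t in F. real k \<le> 1 / (c t)\<^sup>2" for k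
    unfolding filterlim_at_top by blast
  then have "\<forall>\<^sub>F t in F. k \<le> n t" for k
  proof (rule eventually_mono)
    fix t assume "real k \<le> 1 / (c t)\<^sup>2"
    also have "\<dots> \<le> real (n t)" unfolding n_def by (rule real_nat_ceiling_ge)
    finally show "k \<le> n t" by simp
  qed
  then have "filterlim n at_top F"
    unfolding filterlim_at_top by blast
  then have "\<forall>\<^sub>F t in F. prob (D (n t)) < \<delta> / 2"
    using ev_D by (rule eventually_compose_filterlim[rotated])
  moreover have "\<forall>\<^sub>F t in F. \<bar>c t\<bar> < 1"
    using tendstoD[OF c(1), of 1] by (auto simp: dist_real_def)
  ultimately show "\<forall>\<^sub>F t in F. prob {\<omega>\<in>space M. \<bar>c t * (\<Sum>k=1..K t \<omega>. \<eta> k \<omega>) - 0\<bar> > \<epsilon>} < \<delta>"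
    using T(2) c(2)
  proof eventually_elim
    case (elim t)
    have n_ge: "real (n t) \<ge> 1 / (c t)\<^sup>2" unfolding n_def by (simp add: real_nat_ceiling_ge)
    have c1: "1 / (c t)\<^sup>2 \<ge> 1" using elim(2,4) by (simp add: abs_square_less_1 less_imp_le)
    then have n0: "real (n t) > 0" using n_ge by linarith
    have "real (n t) \<le> 1 / (c t)\<^sup>2 + 1"
      unfolding n_def using c1 by linarith
    \<comment> \<open>Rounding \<open>1 / (c t)\<^sup>2\<close> up costs at most a factor 4, hence a
      factor 2 after taking the root. This is why \<open>D\<close> is defined with the threshold
      \<open>\<epsilon> / 2\<close>.\<close>
    also have "\<dots> \<le> 4 / (c t)\<^sup>2" using c1 by linarith
    finally have "sqrt (real (n t)) \<le> sqrt (4 / (c t)\<^sup>2)" by simp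
    then have sq: "sqrt (real (n t)) \<le> 2 / c t" using elim(4) by (simp add: real_sqrt_divide)
    have "\<omega> \<in> {\<omega>\<in>space M. \<bar>(c t)\<^sup>2 * real (K t \<omega>)\<bar> > T} \<union> D (n t)"
      if \<omega>: "\<omega> \<in> space M" "\<bar>c t * (\<Sum>k=1..K t \<omega>. \<eta> k \<omega>) - 0\<bar> > \<epsilon>" for \<omega>
    proof (cases "\<bar>(c t)\<^sup>2 * real (K t \<omega>)\<bar> > T")
      case True
      then show ?thesis using \<omega> by auto
    next
      case False
      \<comment> \<open>At this time the integer part of \<open>real (n t) * s\<close> is exactly
        \<open>K t \<omega>\<close>.\<close>
      define s where "s = real (K t \<omega>) / real (n t)"
      have "1 \<le> (c t)\<^sup>2 * real (n t)"
        using n_ge elim(4) by (simp add: divide_le_eq mult.commute)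
      then have "real (K t \<omega>) * 1 \<le> real (K t \<omega>) * ((c t)\<^sup>2 * real (n t))"
        by (intro mult_left_mono) auto
      then have "s \<le> (c t)\<^sup>2 * real (K t \<omega>)"
        using n0 by (simp add: s_def pos_divide_le_eq mult_ac)
      also have "\<dots> \<le> T" using False by linarith
      finally have s: "s \<in> {0..T}" by (simp add: s_def)
      have "Z (n t) s \<omega> = (\<Sum>k=1..K t \<omega>. \<eta> k \<omega>) / sqrt (real (n t))"
        using n0 by (simp add: Z_def s_def powr_minus_divide powr_half_sqrt)
      then have Z_eq: "\<bar>Z (n t) s \<omega>\<bar> = \<bar>\<Sum>k=1..K t \<omega>. \<eta> k \<omega>\<bar> / sqrt (real (n t))"
        by simp
      have "\<epsilon> / 2 * sqrt (real (n t)) \<le> \<epsilon> / 2 * (2 / c t)"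
        using sq \<open>\<epsilon> > 0\<close> by (intro mult_left_mono) auto
      also have "\<dots> < \<bar>\<Sum>k=1..K t \<omega>. \<eta> k \<omega>\<bar>"
        using \<omega>(2) elim(4) by (simp add: abs_mult pos_divide_less_eq mult.commute)
      finally have "\<bar>Z (n t) s \<omega>\<bar> > \<epsilon> / 2"
        unfolding Z_eq using n0 by (simp add: pos_less_divide_eq)
      then show ?thesis using \<omega>(1) s by (auto simp: D_def)
    qed
    then have "prob {\<omega>\<in>space M. \<bar>c t * (\<Sum>k=1..K t \<omega>. \<eta> k \<omega>) - 0\<bar> > \<epsilon>}
      \<le> prob ({\<omega>\<in>space M. \<bar>(c t)\<^sup>2 * real (K t \<omega>)\<bar> > T} \<union> D (n t))"
      by (intro finite_measure_mono) auto
    also have "\<dots> \<le> prob {\<omega>\<in>space M. \<bar>(c t)\<^sup>2 * real (K t \<omega>)\<bar> > T} + prob (D (n t))"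
      by (intro measure_subadditive) auto
    finally show ?case using elim by linarith
  qed
qed

section \<open>Convergence of partial sums to Brownian motion\<close>

text \<open>Serves Brownian motion, which starts at 0 only almost surely.\<close>

lemma weakly_conv_AE_cong:
  assumes Z: "Z \<in> borel_measurable L" "Z' \<in> borel_measurable L" "AE \<omega> in L. Z \<omega> = Z' \<omega>"
    and "weakly_conv M X L Z"
  shows "weakly_conv M X L Z'"
proof -
  have "(\<integral>\<omega>. f (Z \<omega>) \<partial>L) = (\<integral>\<omega>. f (Z' \<omega>) \<partial>L)" if "C-lipschitz_on UNIV f" for f :: "_ \<Rightarrow> real" and C
  proof (rule integral_cong_AE)
    note [measurable] = Z(1,2) borel_measurable_continuous_onI[OF lipschitz_on_UNIV_continuous[OF that]]
    show "(\<lambda>\<omega>. f (Z \<omega>)) \<in> borel_measurable L" "(\<lambda>\<omega>. f (Z' \<omega>)) \<in> borel_measurable L"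
      by measurable
  qed (use Z(3) in auto)
  then show ?thesis using assms(4) unfolding weakly_conv_def by metis
qed

lemma weakly_conv_real_char:
  fixes X :: "nat \<Rightarrow> 'a \<Rightarrow> real"
  assumes M: "prob_space M" and L: "prob_space L"
    and X [measurable]: "\<And>n. X n \<in> borel_measurable M" and Z [measurable]: "Z \<in> borel_measurable L"
    and char: "\<And>t. (\<lambda>n. char (distr M borel (X n)) t) \<longlonglongrightarrow> char (distr L borel Z) t"
  shows "weakly_conv M X L Z"
  unfolding weakly_conv_def
proof safe
  interpret M: prob_space M by fact
  interpret L: prob_space L by fact
  fix f :: "real \<Rightarrow> real" and C assume f: "C-lipschitz_on UNIV f" "bounded (range f)"
  obtain K where K: "\<And>x. \<bar>f x\<bar> \<le> K"
    using f(2) unfolding bounded_real by blast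
  have fc: "continuous_on UNIV f" by (rule lipschitz_on_UNIV_continuous[OF f(1)])
  note [measurable] = borel_measurable_continuous_onI[OF fc]
  have rd: "real_distribution (distr M borel (X n))" "real_distribution (distr L borel Z)" for n
    by (intro M.real_distribution_distr L.real_distribution_distr; simp)+
  have "weak_conv_m (\<lambda>n. distr M borel (X n)) (distr L borel Z)"
    using rd char by (rule levy_continuity)
  from weak_conv_imp_integral_bdd_continuous_conv[OF rd(1) rd(2) this, of f K]
  have "(\<lambda>n. integral\<^sup>L (distr M borel (X n)) f) \<longlonglongrightarrow> integral\<^sup>L (distr L borel Z) f"
    using fc K by (simp add: continuous_on_eq_continuous_at)
  then show "(\<lambda>n. \<integral>\<omega>. f (X n \<omega>) \<partial>M) \<longlonglongrightarrow> (\<integral>\<omega>. f (Z \<omega>) \<partial>L)"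
    by (simp add: integral_distr)
qed

text \<open>Prepares an induction that splits off the last variable. Padding with 0 and repeating
  the last variable put both parts into the type of sequences, whatever \<open>m\<close> is.\<close>

lemma (in prob_space) indep_vars_indep_pair:
  fixes X :: "nat \<Rightarrow> 'a \<Rightarrow> real"
  assumes "indep_vars (\<lambda>_. borel) X {..<Suc m}"
  shows "indep_pair M (\<lambda>\<omega> j. if j < m then X j \<omega> else 0) (\<lambda>\<omega> (j::nat). X m \<omega>)"
proof -
  have "indep_var (PiM {..<m} (\<lambda>_. borel)) (\<lambda>\<omega>. \<lambda>j\<in>{..<m}. X j \<omega>) (PiM {m} (\<lambda>_. borel)) (\<lambda>\<omega>. \<lambda>j\<in>{m}. X j \<omega>)"
    using assms by (rule indep_var_restrict) auto
  moreover have "(\<lambda>v j. if j < m then v j else 0 :: real) \<in> borel_measurable (PiM {..<m} (\<lambda>_. borel))"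
  proof (rule measurable_coordinatewise_then_product)
    show "(\<lambda>v. if j < m then v j else 0 :: real) \<in> borel_measurable (PiM {..<m} (\<lambda>_. borel))" for j
      by (cases "j < m") (auto intro: measurable_component_singleton)
  qed
  moreover have "(\<lambda>v (j::nat). v m :: real) \<in> borel_measurable (PiM {m} (\<lambda>_. borel))"
    by (intro measurable_coordinatewise_then_product measurable_component_singleton) simp
  ultimately have "indep_var borel ((\<lambda>v j. if j < m then v j else 0) \<circ> (\<lambda>\<omega>. \<lambda>j\<in>{..<m}. X j \<omega>))
      borel ((\<lambda>v (j::nat). v m) \<circ> (\<lambda>\<omega>. \<lambda>j\<in>{m}. X j \<omega>))"
    by (rule indep_var_compose)
  then have "indep_var borel (\<lambda>\<omega> j. if j < m then X j \<omega> else 0) borel (\<lambda>\<omega> (j::nat). X m \<omega>)"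
    by (simp add: comp_def cong: if_cong)
  then show ?thesis
    by (simp add: indep_var_distribution_eq indep_pair_def)
qed

lemma continuous_on_pair_coordinate:
  "continuous_on UNIV (\<lambda>p :: (nat \<Rightarrow> real) \<times> (nat \<Rightarrow> real). fst p i)"
  "continuous_on UNIV (\<lambda>p :: (nat \<Rightarrow> real) \<times> (nat \<Rightarrow> real). snd p i)"
  by (rule continuous_on_compose2[OF continuous_on_product_coordinates continuous_on_fst[OF continuous_on_id]], simp)
     (rule continuous_on_compose2[OF continuous_on_product_coordinates continuous_on_snd[OF continuous_on_id]], simp)

text \<open>Induction on the number of coordinates: the last one is independent of the earlier ones,
  so the two weak limits combine to a limit of the pair, and a continuous map reassembles the
  sequence.\<close>

lemma weakly_conv_indep_coordinates:
  fixes X :: "nat \<Rightarrow> nat \<Rightarrow> 'a \<Rightarrow> real" and Z :: "nat \<Rightarrow> 'b \<Rightarrow> real"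
  assumes M: "prob_space M" and L: "prob_space L"
    and "\<And>n. prob_space.indep_vars M (\<lambda>_. borel) (X n) {..<m}"
    and "prob_space.indep_vars L (\<lambda>_. borel) Z {..<m}"
    and "\<And>j. j < m \<Longrightarrow> weakly_conv M (\<lambda>n. X n j) L (Z j)"
  shows "weakly_conv M (\<lambda>n \<omega> j. if j < m then X n j \<omega> else 0) L (\<lambda>\<omega> j. if j < m then Z j \<omega> else 0)"
  using assms(3-)
proof (induction m)
  case 0
  interpret M: prob_space M by fact
  interpret L: prob_space L by fact
  show ?case by (simp add: weakly_conv_def M.prob_space L.prob_space)
next
  case (Suc m)
  interpret M: prob_space M by fact
  interpret L: prob_space L by fact
  have XZ: "X n j \<in> borel_measurable M" "Z j \<in> borel_measurable L" if "j < Suc m" for n j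
    using Suc.prems(1)[of n] Suc.prems(2) that by (auto simp: M.indep_vars_def2 L.indep_vars_def2)
  have IH: "weakly_conv M (\<lambda>n \<omega> j. if j < m then X n j \<omega> else 0) L (\<lambda>\<omega> j. if j < m then Z j \<omega> else 0)"
    using M.indep_vars_subset[OF Suc.prems(1)] L.indep_vars_subset[OF Suc.prems(2)] Suc.prems(3)
    by (intro Suc.IH) auto
  have last: "weakly_conv M (\<lambda>n \<omega> (j::nat). X n m \<omega>) L (\<lambda>\<omega> j. Z m \<omega>)"
    by (rule weakly_conv_continuous_map[OF M L XZ(1) XZ(2) Suc.prems(3), where h = "\<lambda>x j. x"])
       (auto intro!: continuous_on_coordinatewise_then_product)
  \<comment> \<open>Appends the last variable at position \<open>m\<close>; it is read at index 0 of
    the constant second sequence.\<close>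
  define h :: "(nat \<Rightarrow> real) \<times> (nat \<Rightarrow> real) \<Rightarrow> nat \<Rightarrow> real"
    where "h p j = (if j < m then fst p j else if j = m then snd p 0 else 0)" for p j
  have h: "continuous_on UNIV h"
    unfolding h_def[abs_def]
  proof (rule continuous_on_coordinatewise_then_product)
    show "continuous_on UNIV (\<lambda>p :: (nat \<Rightarrow> real) \<times> (nat \<Rightarrow> real). if j < m then fst p j else if j = m then snd p 0 else 0)" for j
      by (cases "j < m"; cases "j = m") (simp_all add: continuous_on_pair_coordinate)
  qed
  have "weakly_conv M (\<lambda>n \<omega>. h (\<lambda>j. if j < m then X n j \<omega> else 0, \<lambda>j::nat. X n m \<omega>)) L
      (\<lambda>\<omega>. h (\<lambda>j. if j < m then Z j \<omega> else 0, \<lambda>j::nat. Z m \<omega>))"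
  proof (rule weakly_conv_continuous_map[OF M L _ _ _ h])
    show "weakly_conv M (\<lambda>n \<omega>. (\<lambda>j. if j < m then X n j \<omega> else 0, \<lambda>j::nat. X n m \<omega>)) L
      (\<lambda>\<omega>. (\<lambda>j. if j < m then Z j \<omega> else 0, \<lambda>j::nat. Z m \<omega>))"
      using M.indep_vars_indep_pair[OF Suc.prems(1)] L.indep_vars_indep_pair[OF Suc.prems(2)] IH last
      by (rule weakly_conv_pair[OF M L])
  qed (use M.indep_vars_indep_pair[OF Suc.prems(1)] L.indep_vars_indep_pair[OF Suc.prems(2)]
       in \<open>unfold indep_pair_def, intro borel_measurable_Pair; blast\<close>)+
  moreover have "h (\<lambda>j. if j < m then v j else 0, \<lambda>j. v m) = (\<lambda>j. if j < Suc m then v j else 0)" for v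
    by (auto simp: h_def less_Suc_eq)
  note this[of "\<lambda>j. X _ j _"] this[of "\<lambda>j. Z j _"]
  ultimately show ?case by simp
qed

section \<open>Central limit theorem through characteristic functions\<close>

lemma tendsto_exp_minus_one:
  fixes w :: complex
  shows "(\<lambda>n. real n * (exp (w / real n) - 1)) \<longlonglongrightarrow> w"
proof (cases "w = 0")
  case False
  have lim: "(\<lambda>h. (exp h - 1) / h) \<midarrow>0\<rightarrow> (1::complex)"
    using DERIV_exp[of "0::complex"] by (simp add: DERIV_def)
  have "(\<lambda>n. w / of_real (real n)) \<longlonglongrightarrow> 0"
    using tendsto_mult[OF tendsto_const lim_inverse_n, of w] by (simp add: divide_inverse)
  moreover have "\<forall>\<^sub>F n in sequentially. w / of_real (real n) \<noteq> 0"
    using eventually_gt_at_top[of 0] by eventually_elim (use False in simp)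
  ultimately have "(\<lambda>n. (exp (w / of_real (real n)) - 1) / (w / of_real (real n))) \<longlonglongrightarrow> 1"
    using lim by (rule tendsto_compose_eventually[rotated])
  then have "(\<lambda>n. w * ((exp (w / of_real (real n)) - 1) / (w / of_real (real n)))) \<longlonglongrightarrow> w * 1"
    by (intro tendsto_mult tendsto_const)
  moreover have "w * ((exp (w / of_real (real n)) - 1) / (w / of_real (real n))) = real n * (exp (w / real n) - 1)" for n
    using False by simp
  ultimately show ?thesis by simp
qed simp

text \<open>Comparison with \<open>u n\<close>, the exponential of \<open>r / n\<close>, whose
  powers converge explicitly. In the unit disc the \<open>k\<close>-th powers differ by at most
  \<open>k\<close> times the distance of the bases; \<open>r \<le> 0\<close> puts \<open>u n\<close>
  there.\<close>

lemma tendsto_power_exp: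
  fixes z :: "nat \<Rightarrow> complex" and r c :: real
  assumes z: "\<And>n. norm (z n) \<le> 1" "(\<lambda>n. real n * (z n - 1)) \<longlonglongrightarrow> of_real r" and "r \<le> 0"
    and k: "(\<lambda>n. real (k n) / real n) \<longlonglongrightarrow> c"
  shows "(\<lambda>n. z n ^ k n) \<longlonglongrightarrow> of_real (exp (c * r))"
proof -
  define u where "u n = exp (complex_of_real r / real n)" for n :: nat
  have u1: "norm (u n) \<le> 1" for n
    using \<open>r \<le> 0\<close> by (simp add: u_def divide_nonpos_nonneg)
  have "(\<lambda>n. real n * (z n - 1) - real n * (u n - 1)) \<longlonglongrightarrow> of_real r - of_real r"
    unfolding u_def by (intro tendsto_diff z(2) tendsto_exp_minus_one)
  then have "(\<lambda>n. (real (k n) / real n) * norm (real n * (z n - 1) - real n * (u n - 1))) \<longlonglongrightarrow> c * 0"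
    by (intro tendsto_mult k tendsto_norm_zero) simp
  then have bound: "(\<lambda>n. (real (k n) / real n) * norm (real n * (z n - 1) - real n * (u n - 1))) \<longlonglongrightarrow> 0"
    by simp
  have "(\<lambda>n. z n ^ k n - u n ^ k n) \<longlonglongrightarrow> 0"
  proof (rule Lim_null_comparison[OF _ bound])
    show "\<forall>\<^sub>F n in sequentially. norm (z n ^ k n - u n ^ k n)
        \<le> (real (k n) / real n) * norm (real n * (z n - 1) - real n * (u n - 1))"
      using eventually_gt_at_top[of 0]
    proof eventually_elim
      case (elim n)
      have "real n * (z n - 1) - real n * (u n - 1) = complex_of_real (real n) * (z n - u n)"
        by (simp add: algebra_simps)
      then have "(real (k n) / real n) * norm (real n * (z n - 1) - real n * (u n - 1)) = real (k n) * norm (z n - u n)"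
        using elim by (simp add: norm_mult)
      then show ?case using norm_power_diff[OF z(1) u1] by simp
    qed
  qed
  moreover have "(\<lambda>n. u n ^ k n) \<longlonglongrightarrow> of_real (exp (c * r))"
  proof -
    have "(\<lambda>n. exp (complex_of_real ((real (k n) / real n) * r))) \<longlonglongrightarrow> exp (of_real (c * r))"
      by (intro tendsto_intros k)
    moreover have "u n ^ k n = exp (complex_of_real ((real (k n) / real n) * r))" for n
      unfolding u_def exp_of_nat_mult[symmetric] by (simp add: field_simps)
    ultimately show ?thesis by (simp flip: exp_of_real)
  qed
  ultimately have "(\<lambda>n. (z n ^ k n - u n ^ k n) + u n ^ k n) \<longlonglongrightarrow> 0 + of_real (exp (c * r))"
    by (rule tendsto_add)
  then show ?thesis by simp
qed

text \<open>Second-order expansion of the characteristic function at \<open>u n\<close>, where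
  \<open>n * (u n)\<^sup>2 = \<theta>\<^sup>2\<close>. The remainder is governed by the minimum of a
  multiple of the square of \<open>X\<close> and a cubic term: the first is integrable, the second
  tends to 0, so dominated convergence applies under a second moment alone.\<close>

lemma (in prob_space) char_scaled_tendsto:
  fixes X :: "'a \<Rightarrow> real" and v \<theta> :: real
  assumes X [measurable]: "X \<in> borel_measurable M" and sq: "integrable M (\<lambda>\<omega>. (X \<omega>)\<^sup>2)"
    and mean: "expectation X = 0" and var: "expectation (\<lambda>\<omega>. (X \<omega>)\<^sup>2) = v"
  shows "(\<lambda>n. real n * (char (distr M borel X) (\<theta> * real n powr (- 1 / 2)) - 1)) \<longlonglongrightarrow> of_real (- v * \<theta>\<^sup>2 / 2)"
proof -
  have int: "integrable M X" using X sq by (rule square_integrable_imp_integrable)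
  define u where "u n = \<theta> * real n powr (- 1 / 2)" for n :: nat
  have u0: "u \<longlonglongrightarrow> 0"
    unfolding u_def using tendsto_mult[OF tendsto_const tendsto_neg_powr[OF _ filterlim_real_sequentially, of "- 1/2"], of \<theta>]
    by simp
  have u_sq: "real n * (u n)\<^sup>2 = \<theta>\<^sup>2" if "n > 0" for n
    using that by (simp add: u_def powr_minus_divide powr_half_sqrt power_divide)
  define R where "R n = expectation (\<lambda>\<omega>. min (6 * (X \<omega>)\<^sup>2) (\<bar>u n\<bar> * \<bar>X \<omega>\<bar> ^ 3))" for n
  have "R \<longlonglongrightarrow> expectation (\<lambda>\<omega>. 0)"
    unfolding R_def
  proof (rule integral_dominated_convergence[where w = "\<lambda>\<omega>. 6 * (X \<omega>)\<^sup>2"])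
    show "AE \<omega> in M. (\<lambda>n. min (6 * (X \<omega>)\<^sup>2) (\<bar>u n\<bar> * \<bar>X \<omega>\<bar> ^ 3)) \<longlonglongrightarrow> 0"
    proof (rule AE_I2)
      fix \<omega>
      have "(\<lambda>n. min (6 * (X \<omega>)\<^sup>2) (\<bar>u n\<bar> * \<bar>X \<omega>\<bar> ^ 3)) \<longlonglongrightarrow> min (6 * (X \<omega>)\<^sup>2) (\<bar>0\<bar> * \<bar>X \<omega>\<bar> ^ 3)"
        by (intro tendsto_intros u0)
      then show "(\<lambda>n. min (6 * (X \<omega>)\<^sup>2) (\<bar>u n\<bar> * \<bar>X \<omega>\<bar> ^ 3)) \<longlonglongrightarrow> 0" by simp
    qed
  qed (use sq in auto)
  then have "(\<lambda>n. \<theta>\<^sup>2 / 6 * R n) \<longlonglongrightarrow> \<theta>\<^sup>2 / 6 * 0"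
    by (intro tendsto_mult tendsto_const) simp
  then have lim: "(\<lambda>n. \<theta>\<^sup>2 / 6 * R n) \<longlonglongrightarrow> 0" by simp
  have "(\<lambda>n. real n * (char (distr M borel X) (u n) - 1) - of_real (- v * \<theta>\<^sup>2 / 2)) \<longlonglongrightarrow> 0"
  proof (rule Lim_null_comparison[OF _ lim])
    show "\<forall>\<^sub>F n in sequentially. norm (real n * (char (distr M borel X) (u n) - 1) - of_real (- v * \<theta>\<^sup>2 / 2))
        \<le> \<theta>\<^sup>2 / 6 * R n"
      using eventually_gt_at_top[of 0]
    proof eventually_elim
      case (elim n)
      have "cmod (char (distr M borel X) (u n) - (1 - (u n)\<^sup>2 * v / 2)) \<le> ((u n)\<^sup>2 / 6) * R n"
        unfolding R_def using X int sq mean var by (intro char_approx3') auto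
      then have *: "real n * cmod (char (distr M borel X) (u n) - (1 - (u n)\<^sup>2 * v / 2)) \<le> real n * (((u n)\<^sup>2 / 6) * R n)"
        by (intro mult_left_mono) auto
      have "of_real (- v * \<theta>\<^sup>2 / 2) = complex_of_real (real n) * of_real (- ((u n)\<^sup>2 * v / 2))"
        unfolding of_real_mult[symmetric] u_sq[OF elim, symmetric] by simp
      then have "real n * (char (distr M borel X) (u n) - 1) - of_real (- v * \<theta>\<^sup>2 / 2)
        = of_real (real n) * (char (distr M borel X) (u n) - (1 - (u n)\<^sup>2 * v / 2))"
        by (simp add: algebra_simps)
      then have "norm (real n * (char (distr M borel X) (u n) - 1) - of_real (- v * \<theta>\<^sup>2 / 2))
          = real n * cmod (char (distr M borel X) (u n) - (1 - (u n)\<^sup>2 * v / 2))"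
        by (simp only: norm_mult norm_of_real abs_of_nat)
      also note *
      also have "real n * (((u n)\<^sup>2 / 6) * R n) = \<theta>\<^sup>2 / 6 * R n"
        unfolding u_sq[OF elim, symmetric] by simp
      finally show ?case .
    qed
  qed
  then show ?thesis unfolding u_def by (rule Lim_null[THEN iffD2])
qed

text \<open>The factor \<open>a\<close> is kept apart from the density because \<open>a * Y\<close>
  has none when \<open>a = 0\<close>, which occurs if the shocks contribute no variance.\<close>

lemma char_distr_normal:
  assumes P: "prob_space P" and s: "s > 0"
    and Y: "distributed P lborel Y (\<lambda>x. ennreal (normal_density 0 s x))"
  shows "char (distr P borel (\<lambda>\<omega>. a * Y \<omega>)) \<theta> = of_real (exp (- (a * s * \<theta>)\<^sup>2 / 2))"
proof -
  interpret prob_space P by fact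
  have [measurable]: "Y \<in> borel_measurable P"
    using distributed_measurable[OF Y] by simp
  have "distributed P lborel (\<lambda>\<omega>. Y \<omega> / s) std_normal_density"
    using Y normal_standard_normal_convert[OF s, of Y 0] by simp
  then have "distr P lborel (\<lambda>\<omega>. Y \<omega> / s) = std_normal_distribution"
    by (simp add: distributed_def)
  then have std: "distr P borel (\<lambda>\<omega>. Y \<omega> / s) = std_normal_distribution"
    by (simp cong: distr_cong)
  have "char (distr P borel (\<lambda>\<omega>. a * Y \<omega>)) \<theta> = char (distr P borel (\<lambda>\<omega>. Y \<omega> / s)) (a * s * \<theta>)"
    using s by (simp add: char_def integral_distr field_simps)
  then show ?thesis unfolding std char_std_normal_distribution by simp
qed

lemma (in prob_space) char_distr_const: "char (distr M borel (\<lambda>\<omega>. c)) \<theta> = iexp (\<theta> * c)"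
  by (simp add: char_def integral_distr prob_space del: distr_const)

text \<open>A finite intersection of events splits by the first index into
  \<open>Q 1 \<inter> Q 2\<close>. Independence of the families separates the two sets, and
  independence within a family factorizes each of them.\<close>

lemma (in prob_space) indep_vars_two_families:
  fixes e :: "nat \<Rightarrow> nat \<Rightarrow> 'a \<Rightarrow> real"
  assumes ind: "\<And>i. i \<in> {1, 2} \<Longrightarrow> indep_vars (\<lambda>_. borel) (e i) {1..}"
    and fam: "indep_families M {1..} (e 1) {1..} (e 2)"
  shows "indep_vars (\<lambda>_. borel) (\<lambda>(i, k). e i k) ({1, 2} \<times> {1..})"
  unfolding indep_vars_def2
proof (intro conjI ballI indep_setsI)
  have rv: "e i k \<in> borel_measurable M" if "i \<in> {1, 2}" "k \<in> {1..}" for i k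
    using ind[OF that(1)] that(2) by (simp add: indep_vars_def2)
  show rv': "(case p of (i, k) \<Rightarrow> e i k) \<in> borel_measurable M" if "p \<in> {1, 2} \<times> {1..}" for p
    using that rv by auto
  show "{(case p of (i, k) \<Rightarrow> e i k) -` A \<inter> space M |A. A \<in> sets borel} \<subseteq> events" if "p \<in> {1, 2} \<times> {1..}" for p
    using measurable_sets[OF rv'[OF that]] by auto
  fix A :: "nat \<times> nat \<Rightarrow> 'a set" and J :: "(nat \<times> nat) set"
  assume J: "J \<noteq> {}" "J \<subseteq> {1, 2} \<times> {1..}" "finite J"
    and A: "\<forall>p\<in>J. A p \<in> {(case p of (i, k) \<Rightarrow> e i k) -` A \<inter> space M |A. A \<in> sets borel}"
  have "\<forall>p\<in>J. \<exists>B. A p = (case p of (i, k) \<Rightarrow> e i k) -` B \<inter> space M \<and> B \<in> sets borel"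
    using A by (simp only: mem_Collect_eq)
  from bchoice[OF this] obtain B
    where "\<forall>p\<in>J. A p = (case p of (i, k) \<Rightarrow> e i k) -` B p \<inter> space M \<and> B p \<in> sets borel" ..
  then have B: "\<And>p. p \<in> J \<Longrightarrow> B p \<in> sets borel"
    "\<And>p. p \<in> J \<Longrightarrow> A p = (case p of (i, k) \<Rightarrow> e i k) -` B p \<inter> space M"
    by simp_all
  define K where "K i = {k. (i, k) \<in> J}" for i
  have K: "finite (K i)" for i
    unfolding K_def by (rule finite_subset[OF _ finite_imageI[OF J(3), of snd]]) force
  have K_sub: "K i \<subseteq> {1..}" for i using J(2) by (auto simp: K_def)
  define Q where "Q i = {\<omega>\<in>space M. \<forall>k\<in>K i. e i k \<omega> \<in> B (i, k)}" for i
  have J_eq: "J = Pair 1 ` K 1 \<union> Pair 2 ` K 2"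
    using J(2) by (auto simp: K_def)
  have Q_prob: "prob (Q i) = (\<Prod>k\<in>K i. prob (A (i, k)))" if i: "i \<in> {1, 2}" for i
  proof (cases "K i = {}")
    case True
    then show ?thesis by (simp add: Q_def prob_space)
  next
    case False
    have "Q i = (\<Inter>k\<in>K i. e i k -` B (i, k) \<inter> space M)"
      using False by (auto simp: Q_def)
    also have "prob \<dots> = (\<Prod>k\<in>K i. prob (e i k -` B (i, k) \<inter> space M))"
      using False K K_sub B(1) by (intro indep_varsD[OF ind[OF i]]) (auto simp: K_def)
    also have "\<dots> = (\<Prod>k\<in>K i. prob (A (i, k)))"
      using B(2) by (intro prod.cong refl) (simp add: K_def)
    finally show ?thesis .
  qed
  have Q_sets: "Q i \<in> sets (family_algebra M {1..} (e i))" for i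
  proof -
    have "{\<omega>\<in>space (family_algebra M {1..} (e i)). \<forall>k\<in>K i. e i k \<omega> \<in> B (i, k)}
        \<in> sets (family_algebra M {1..} (e i))"
    proof (rule sets.sets_Collect_finite_All[OF _ K])
      fix k assume k: "k \<in> K i"
      then have "k \<in> {1..}" using K_sub by blast
      then have [measurable]: "e i k \<in> borel_measurable (family_algebra M {1..} (e i))"
        by (rule measurable_family_algebra)
      have [measurable]: "B (i, k) \<in> sets borel" using k B(1) by (simp add: K_def)
      show "{\<omega>\<in>space (family_algebra M {1..} (e i)). e i k \<omega> \<in> B (i, k)} \<in> sets (family_algebra M {1..} (e i))"
        by measurable
    qed
    then show ?thesis by (simp add: Q_def)
  qed
  have "(\<Inter>p\<in>J. A p) = Q 1 \<inter> Q 2"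
  proof (intro equalityI subsetI)
    fix \<omega> assume *: "\<omega> \<in> (\<Inter>p\<in>J. A p)"
    have "\<omega> \<in> space M"
    proof -
      obtain p where "p \<in> J" using J(1) by blast
      with * B(2)[OF this] show ?thesis by blast
    qed
    moreover have "e i k \<omega> \<in> B (i, k)" if "k \<in> K i" for i k
    proof -
      have "(i, k) \<in> J" using that by (simp add: K_def)
      with * B(2)[OF this] show ?thesis by auto
    qed
    ultimately show "\<omega> \<in> Q 1 \<inter> Q 2" by (simp add: Q_def)
  next
    fix \<omega> assume \<omega>: "\<omega> \<in> Q 1 \<inter> Q 2"
    show "\<omega> \<in> (\<Inter>p\<in>J. A p)"
    proof
      fix p assume "p \<in> J"
      then obtain i k where p: "p = (i, k)" "i = 1 \<or> i = 2" "k \<in> K i"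
        using J(2) by (auto simp: K_def)
      then show "\<omega> \<in> A p" using \<omega> B(2)[OF \<open>p \<in> J\<close>] by (auto simp: Q_def)
    qed
  qed
  also have "prob (Q 1 \<inter> Q 2) = prob (Q 1) * prob (Q 2)"
    by (rule indep_setD[OF indep_familiesD(1)[OF fam] Q_sets Q_sets])
  also have "\<dots> = (\<Prod>p\<in>J. prob (A p))"
    unfolding J_eq using K
    by (subst prod.union_disjoint) (auto simp: prod.reindex inj_on_def Q_prob)
  finally show "prob (\<Inter>p\<in>J. A p) = (\<Prod>p\<in>J. prob (A p))" .
qed

lemma (in prob_space) char_scaled_sum_indep:
  fixes X :: "'i \<Rightarrow> 'a \<Rightarrow> real"
  assumes "indep_vars (\<lambda>_. borel) X B"
  shows "char (distr M borel (\<lambda>\<omega>. c * (\<Sum>p\<in>B. X p \<omega>))) \<theta> = (\<Prod>p\<in>B. char (distr M borel (X p)) (\<theta> * c))"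
proof -
  have rv: "X p \<in> borel_measurable M" if "p \<in> B" for p
    using assms that by (simp add: indep_vars_def2)
  have "indep_vars (\<lambda>_. borel) (\<lambda>p \<omega>. c * X p \<omega>) B"
    using assms by (rule indep_vars_compose2) simp
  then have "char (distr M borel (\<lambda>\<omega>. \<Sum>p\<in>B. c * X p \<omega>)) \<theta> = (\<Prod>p\<in>B. char (distr M borel (\<lambda>\<omega>. c * X p \<omega>)) \<theta>)"
    by (rule char_distr_sum)
  also have "\<dots> = (\<Prod>p\<in>B. char (distr M borel (X p)) (\<theta> * c))"
  proof (rule prod.cong[OF refl])
    fix p assume "p \<in> B"
    note [measurable] = rv[OF this]
    show "char (distr M borel (\<lambda>\<omega>. c * X p \<omega>)) \<theta> = char (distr M borel (X p)) (\<theta> * c)"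
      by (simp add: char_def integral_distr mult_ac)
  qed
  finally show ?thesis by (simp add: sum_distrib_left)
qed

lemma tendsto_nat_floor_divide:
  fixes l t :: real
  assumes "0 \<le> l" "0 \<le> t"
  shows "(\<lambda>n. real (nat \<lfloor>l * real n * t\<rfloor>) / real n) \<longlonglongrightarrow> l * t"
proof -
  have "(\<lambda>n. real (nat \<lfloor>l * real n * t\<rfloor>) / real n - l * t) \<longlonglongrightarrow> 0"
  proof (rule Lim_null_comparison[OF _ lim_inverse_n])
    show "\<forall>\<^sub>F n in sequentially. norm (real (nat \<lfloor>l * real n * t\<rfloor>) / real n - l * t) \<le> inverse (real n)"
      using eventually_gt_at_top[of 0]
    proof eventually_elim
      case (elim n)
      have "0 \<le> l * real n * t" using assms by simp
      then have "\<bar>real (nat \<lfloor>l * real n * t\<rfloor>) - l * real n * t\<bar> \<le> 1"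
        by (simp add: abs_le_iff) linarith
      moreover have "real (nat \<lfloor>l * real n * t\<rfloor>) / real n - l * t = (real (nat \<lfloor>l * real n * t\<rfloor>) - l * real n * t) / real n"
        using elim by (simp add: field_simps)
      ultimately show ?case using elim by (simp add: abs_divide divide_right_mono inverse_eq_divide)
    qed
  qed
  then show ?thesis by (rule Lim_null[THEN iffD2])
qed

text \<open>An admissible sequence of times stops moving once it reaches its maximum, so only
  finitely many increments matter.\<close>

lemma mono_finite_range_eventually_const:
  fixes \<tau> :: "nat \<Rightarrow> real"
  assumes "mono \<tau>" "finite (range \<tau>)"
  obtains d where "\<And>j. \<tau> j = \<tau> (min j d)"
proof -
  have "Max (range \<tau>) \<in> range \<tau>" using assms(2) by (intro Max_in) auto
  then obtain d where d: "Max (range \<tau>) = \<tau> d" by auto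
  have "\<tau> j = \<tau> (min j d)" for j
  proof (cases "j \<le> d")
    case False
    then have "\<tau> d \<le> \<tau> j" using assms(1) by (simp add: monoD)
    moreover have "\<tau> j \<le> \<tau> d" unfolding d[symmetric] using assms(2) by (intro Max_ge) auto
    ultimately show ?thesis using False by (simp add: min_def)
  qed (simp add: min_def)
  then show thesis by (rule that)
qed

lemma brownian_increment_char:
  assumes P: "prob_space P" and B: "standard_brownian_motion P B" and "0 \<le> s" "s \<le> t"
  shows "char (distr P borel (\<lambda>\<omega>. \<sigma> * (B t \<omega> - B s \<omega>))) \<theta> = of_real (exp (- (\<sigma>\<^sup>2 * (t - s)) * \<theta>\<^sup>2 / 2))"
proof (cases "s = t")
  \<comment> \<open>At equal times the increment vanishes identically and has no density, so the
    normal case does not cover it.\<close>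
  case True
  interpret prob_space P by fact
  show ?thesis using True by (simp add: char_distr_const del: distr_const)
next
  case False
  then have "distributed P lborel (\<lambda>\<omega>. B t \<omega> - B s \<omega>) (\<lambda>x. ennreal (normal_density 0 (sqrt (t - s)) x))"
    using B assms(3,4) by (simp add: standard_brownian_motion_def)
  moreover have "sqrt (t - s) > 0" using False assms(4) by simp
  ultimately show ?thesis
    using char_distr_normal[OF P, of "sqrt (t - s)"] assms(4)
    by (simp add: power_mult_distrib)
qed

text \<open>Both shock families are indexed by one set of pairs, so an increment over a time
  interval is a single sum of independent variables. Its characteristic function is a product of two
  powers, one per family, and the limits multiply to that of a centred normal law with variance
  \<open>\<sigma>\<^sup>2\<close> times the length of the interval.\<close>

lemma partial_sums_conv_fdd:
  fixes e :: "nat \<Rightarrow> nat \<Rightarrow> 'a \<Rightarrow> real" and l v :: "nat \<Rightarrow> real" and \<sigma> :: real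
    and B :: "real \<Rightarrow> 'b \<Rightarrow> real"
  assumes M: "prob_space M" and P: "prob_space P"
    and ind: "prob_space.indep_vars M (\<lambda>_. borel) (\<lambda>(i, k). e i k) ({1, 2} \<times> {1..})"
    and id: "\<And>i k. i \<in> {1, 2} \<Longrightarrow> k \<ge> 1 \<Longrightarrow> distr M borel (e i k) = distr M borel (e i 1)"
    and sq: "\<And>i. i \<in> {1, 2} \<Longrightarrow> integrable M (\<lambda>\<omega>. (e i 1 \<omega>)\<^sup>2)"
    and mean: "\<And>i. i \<in> {1, 2} \<Longrightarrow> prob_space.expectation M (e i 1) = 0"
    and var: "\<And>i. i \<in> {1, 2} \<Longrightarrow> prob_space.expectation M (\<lambda>\<omega>. (e i 1 \<omega>)\<^sup>2) = v i"
    and l: "\<And>i. i \<in> {1, 2} \<Longrightarrow> 0 \<le> l i"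
    and B: "standard_brownian_motion P B"
    and \<sigma>: "\<sigma>\<^sup>2 = l 1 * v 1 + l 2 * v 2"
  shows "conv_fdd M (\<lambda>n t \<omega>. real n powr (- 1 / 2) *
      ((\<Sum>k=1..nat \<lfloor>l 1 * real n * t\<rfloor>. e 1 k \<omega>) + (\<Sum>k=1..nat \<lfloor>l 2 * real n * t\<rfloor>. e 2 k \<omega>)))
    P (\<lambda>t \<omega>. \<sigma> * B t \<omega>)" (is "conv_fdd M ?T P _")
proof (rule conv_fddI[OF M P])
  interpret M: prob_space M by fact
  interpret P: prob_space P by fact
  have e_meas: "e i k \<in> borel_measurable M" if "i \<in> {1, 2}" "k \<ge> 1" for i k
    using ind that unfolding M.indep_vars_def2 by force
  show "?T n t \<in> borel_measurable M" for n t
    by (intro borel_measurable_times borel_measurable_add borel_measurable_sum borel_measurable_const e_meas) auto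
  have B_meas [measurable]: "B t \<in> borel_measurable P" if "0 \<le> t" for t
    using B that by (simp add: standard_brownian_motion_def)
  show "(\<lambda>\<omega>. \<sigma> * B t \<omega>) \<in> borel_measurable P" if "0 \<le> t" for t
    using that by measurable
  fix \<tau> :: "nat \<Rightarrow> real" assume \<tau>: "mono \<tau>" "\<tau> 0 = 0" "finite (range \<tau>)"
  have \<tau>_nonneg: "0 \<le> \<tau> j" for j by (rule mono_from_zero_nonneg[OF \<tau>(1,2)])
  have \<tau>_Suc: "\<tau> j \<le> \<tau> (Suc j)" for j using \<tau>(1) by (simp add: monoD)
  obtain d where d: "\<And>j. \<tau> j = \<tau> (min j d)"
    using mono_finite_range_eventually_const[OF \<tau>(1,3)] by blast
  define a where "a i n j = nat \<lfloor>l i * real n * \<tau> j\<rfloor>" for i :: nat and n j :: nat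
  have a_mono: "a i n j \<le> a i n j'" if "i \<in> {1, 2}" "j \<le> j'" for i n j j'
    unfolding a_def using l[OF that(1)] monoD[OF \<tau>(1) that(2)]
    by (intro nat_mono floor_mono mult_left_mono) auto
  have a0: "a i n 0 = 0" for i n by (simp add: a_def \<tau>(2))
  define X where "X p = (case p of (i, k) \<Rightarrow> e i k)" for p
  \<comment> \<open>The shocks of both families that enter between the times \<open>\<tau> j\<close>
    and \<open>\<tau> (Suc j)\<close>; half-open intervals make consecutive blocks disjoint.\<close>
  define blk where "blk n j = Pair (1::nat) ` {a 1 n j<..a 1 n (Suc j)} \<union> Pair 2 ` {a 2 n j<..a 2 n (Suc j)}" for n j
  define D where "D n j \<omega> = real n powr (- 1 / 2) * (\<Sum>p\<in>blk n j. X p \<omega>)" for n j \<omega>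
  have blk_sub: "blk n j \<subseteq> {1, 2} \<times> {1..}" for n j by (auto simp: blk_def)
  have blk_fin: "finite (blk n j)" for n j by (simp add: blk_def)
  have ind': "M.indep_vars (\<lambda>_. borel) X ({1, 2} \<times> {1..})"
    using ind by (simp add: X_def[abs_def])
  have blk_sum: "(\<Sum>p\<in>blk n j. g p) = (\<Sum>k\<in>{a 1 n j<..a 1 n (Suc j)}. g (1, k)) + (\<Sum>k\<in>{a 2 n j<..a 2 n (Suc j)}. g (2, k))"
    for n j and g :: "_ \<Rightarrow> real"
    unfolding blk_def
    by (subst sum.union_disjoint) (auto simp: sum.reindex inj_on_def)
  have T_Suc: "?T n (\<tau> (Suc j)) \<omega> = ?T n (\<tau> j) \<omega> + D n j \<omega>" for n j \<omega>
  proof -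
    have split: "(\<Sum>k=1..a i n (Suc j). e i k \<omega>) = (\<Sum>k=1..a i n j. e i k \<omega>) + (\<Sum>k\<in>{a i n j<..a i n (Suc j)}. e i k \<omega>)"
      if "i \<in> {1, 2}" for i
    proof -
      have "{1..a i n (Suc j)} = {1..a i n j} \<union> {a i n j<..a i n (Suc j)}"
        using a_mono[OF that, of j "Suc j" n] by auto
      then show ?thesis by (simp only:) (rule sum.union_disjoint, auto)
    qed
    show ?thesis
      unfolding D_def blk_sum a_def[symmetric] using split[of 1] split[of 2]
      by (simp add: X_def algebra_simps)
  qed
  have T_sum: "?T n (\<tau> j) \<omega> = (\<Sum>i<j. D n i \<omega>)" for n j \<omega>
  proof (induction j)
    case 0
    show ?case by (simp add: \<tau>(2))
  next
    case (Suc j)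
    then show ?case unfolding T_Suc by simp
  qed
  have D_ind: "M.indep_vars (\<lambda>_. borel) (D n) {..<d}" for n
  proof -
    have "disjoint_family_on (blk n) {..<d}"
      unfolding disjoint_family_on_def
    proof (intro ballI impI)
      fix j j' :: nat assume "j \<noteq> j'"
      then consider "Suc j \<le> j'" | "Suc j' \<le> j" by linarith
      then show "blk n j \<inter> blk n j' = {}"
        by cases (use a_mono[of 1 _ _ n] a_mono[of 2 _ _ n] in \<open>fastforce simp: blk_def\<close>)+
    qed
    then have "M.indep_vars (\<lambda>j. PiM (blk n j) (\<lambda>_. borel)) (\<lambda>j \<omega>. \<lambda>p\<in>blk n j. X p \<omega>) {..<d}"
      using blk_sub by (intro M.indep_vars_restrict[OF ind']) auto
    then have "M.indep_vars (\<lambda>_. borel) (\<lambda>j \<omega>. real n powr (- 1 / 2) * (\<Sum>p\<in>blk n j. (\<lambda>p\<in>blk n j. X p \<omega>) p)) {..<d}"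
      by (rule M.indep_vars_compose2) (auto intro!: borel_measurable_times borel_measurable_sum measurable_component_singleton)
    then show ?thesis by (simp add: D_def[abs_def])
  qed
  define W where "W j \<omega> = \<sigma> * (B (\<tau> (Suc j)) \<omega> - B (\<tau> j) \<omega>)" for j \<omega>
  have W_meas [measurable]: "W j \<in> borel_measurable P" for j
    unfolding W_def using \<tau>_nonneg by measurable
  have X_meas: "X p \<in> borel_measurable M" if "p \<in> blk n j" for p n j
    using ind' subsetD[OF blk_sub that] by (simp only: M.indep_vars_def2)
  have D_meas [measurable]: "D n j \<in> borel_measurable M" for n j
    unfolding D_def[abs_def]
    by (intro borel_measurable_times borel_measurable_sum borel_measurable_const X_meas)
  have W_ind: "P.indep_vars (\<lambda>_. borel) W {..<d}"
  proof -
    have "P.indep_vars (\<lambda>_. borel) (\<lambda>j \<omega>. B (\<tau> (Suc j)) \<omega> - B (\<tau> j) \<omega>) {..<d}"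
      using B \<tau>(1,2) unfolding standard_brownian_motion_def by simp
    then show ?thesis unfolding W_def[abs_def] by (rule P.indep_vars_compose2) simp
  qed
  have DW: "weakly_conv M (\<lambda>n. D n j) P (W j)" for j
  proof (rule weakly_conv_real_char[OF M P D_meas W_meas])
    fix \<theta>
    define \<phi> where "\<phi> i n = char (distr M borel (e i 1)) (\<theta> * real n powr (- 1 / 2))" for i n
    define k where "k i n = a i n (Suc j) - a i n j" for i n
    have D_char: "char (distr M borel (D n j)) \<theta> = \<phi> 1 n ^ k 1 n * \<phi> 2 n ^ k 2 n" for n
    proof -
      have "char (distr M borel (D n j)) \<theta> = (\<Prod>p\<in>blk n j. char (distr M borel (X p)) (\<theta> * real n powr (- 1 / 2)))"
        unfolding D_def[abs_def] by (rule M.char_scaled_sum_indep[OF M.indep_vars_subset[OF ind' blk_sub]])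
      also have "\<dots> = (\<Prod>p\<in>blk n j. \<phi> (fst p) n)"
      proof (rule prod.cong[OF refl])
        fix p assume "p \<in> blk n j"
        then obtain i k where "p = (i, k)" "i \<in> {1, 2}" "k \<ge> 1" using blk_sub[of n j] by auto
        then show "char (distr M borel (X p)) (\<theta> * real n powr (- 1 / 2)) = \<phi> (fst p) n"
          using id[of i k] by (simp add: X_def \<phi>_def)
      qed
      also have "\<dots> = \<phi> 1 n ^ k 1 n * \<phi> 2 n ^ k 2 n"
        unfolding blk_def k_def
        by (subst prod.union_disjoint) (auto simp: prod.reindex inj_on_def)
      finally show ?thesis .
    qed
    have lim: "(\<lambda>n. \<phi> i n ^ k i n) \<longlonglongrightarrow> of_real (exp ((l i * (\<tau> (Suc j) - \<tau> j)) * (- v i * \<theta>\<^sup>2 / 2)))"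
      if i: "i \<in> {1, 2}" for i
    proof (rule tendsto_power_exp)
      interpret E: real_distribution "distr M borel (e i 1)"
        by (rule M.real_distribution_distr[OF e_meas[OF i order_refl]])
      show "norm (\<phi> i n) \<le> 1" for n unfolding \<phi>_def by (rule E.cmod_char_le_1)
      show "(\<lambda>n. real n * (\<phi> i n - 1)) \<longlonglongrightarrow> of_real (- v i * \<theta>\<^sup>2 / 2)"
        unfolding \<phi>_def
        by (rule M.char_scaled_tendsto[OF e_meas[OF i order_refl] sq[OF i] mean[OF i] var[OF i]])
      have "0 \<le> M.expectation (\<lambda>\<omega>. (e i 1 \<omega>)\<^sup>2)" by simp
      then have "0 \<le> v i" unfolding var[OF i] .
      then show "- v i * \<theta>\<^sup>2 / 2 \<le> 0" by simp
      \<comment> \<open>A block contains asymptotically \<open>l i * n\<close> times the length of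
        the time interval shocks of family \<open>i\<close>; rounding disappears after division by
        \<open>n\<close>.\<close>
      have "(\<lambda>n. real (a i n (Suc j)) / real n - real (a i n j) / real n) \<longlonglongrightarrow> l i * \<tau> (Suc j) - l i * \<tau> j"
        unfolding a_def using l[OF i] \<tau>_nonneg by (intro tendsto_diff tendsto_nat_floor_divide)
      then show "(\<lambda>n. real (k i n) / real n) \<longlonglongrightarrow> l i * (\<tau> (Suc j) - \<tau> j)"
        unfolding k_def using a_mono[OF i, of j "Suc j"] by (simp add: of_nat_diff diff_divide_distrib algebra_simps)
    qed
    have "(\<lambda>n. \<phi> 1 n ^ k 1 n * \<phi> 2 n ^ k 2 n) \<longlonglongrightarrow>
        of_real (exp ((l 1 * (\<tau> (Suc j) - \<tau> j)) * (- v 1 * \<theta>\<^sup>2 / 2))) *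
        of_real (exp ((l 2 * (\<tau> (Suc j) - \<tau> j)) * (- v 2 * \<theta>\<^sup>2 / 2)))"
      by (intro tendsto_mult lim) auto
    also have "complex_of_real (exp ((l 1 * (\<tau> (Suc j) - \<tau> j)) * (- v 1 * \<theta>\<^sup>2 / 2))) *
        of_real (exp ((l 2 * (\<tau> (Suc j) - \<tau> j)) * (- v 2 * \<theta>\<^sup>2 / 2))) = of_real (exp (- (\<sigma>\<^sup>2 * (\<tau> (Suc j) - \<tau> j)) * \<theta>\<^sup>2 / 2))"
      unfolding of_real_mult[symmetric] exp_add[symmetric] \<sigma> by (simp add: field_simps)
    finally show "(\<lambda>n. char (distr M borel (D n j)) \<theta>) \<longlonglongrightarrow> char (distr P borel (W j)) \<theta>"
      unfolding D_char W_def[abs_def] brownian_increment_char[OF P B \<tau>_nonneg \<tau>_Suc] .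
  qed
  have coord: "weakly_conv M (\<lambda>n \<omega> j. if j < d then D n j \<omega> else 0) P (\<lambda>\<omega> j. if j < d then W j \<omega> else 0)"
    by (rule weakly_conv_indep_coordinates[OF M P D_ind W_ind DW])
  \<comment> \<open>Rebuilds values from increments. The cap \<open>min j d\<close> fits the padding
    with 0 from coordinate \<open>d\<close> on, where the times no longer move.\<close>
  define h :: "(nat \<Rightarrow> real) \<Rightarrow> nat \<Rightarrow> real" where "h x j = (\<Sum>i<min j d. x i)" for x j
  have h_cont: "continuous_on UNIV h"
    unfolding h_def[abs_def]
    by (intro continuous_on_coordinatewise_then_product continuous_on_sum continuous_on_product_coordinates)
  have h_eq: "h (\<lambda>j. if j < d then x j else 0) = (\<lambda>j. \<Sum>i<min j d. x i)" for x
    by (auto simp: h_def intro!: sum.cong)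
  have "weakly_conv M (\<lambda>n \<omega>. h (\<lambda>j. if j < d then D n j \<omega> else 0)) P (\<lambda>\<omega>. h (\<lambda>j. if j < d then W j \<omega> else 0))"
    by (rule weakly_conv_continuous_map[OF M P _ _ coord h_cont];
        intro measurable_coordinatewise_then_product; measurable)
  then have sums: "weakly_conv M (\<lambda>n \<omega> j. \<Sum>i<min j d. D n i \<omega>) P (\<lambda>\<omega> j. \<Sum>i<min j d. W i \<omega>)"
    unfolding h_eq .
  have "(\<Sum>i<min j d. D n i \<omega>) = ?T n (\<tau> j) \<omega>" for n j \<omega>
    unfolding T_sum[symmetric] d[of j, symmetric] ..
  with sums have "weakly_conv M (\<lambda>n \<omega> j. ?T n (\<tau> j) \<omega>) P (\<lambda>\<omega> j. \<Sum>i<min j d. W i \<omega>)"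
    by simp
  then show "weakly_conv M (\<lambda>n \<omega> j. ?T n (\<tau> j) \<omega>) P (\<lambda>\<omega> j. \<sigma> * B (\<tau> j) \<omega>)"
  proof (rule weakly_conv_AE_cong[rotated 3])
    have "(\<Sum>i<min j d. W i \<omega>) = \<sigma> * (B (\<tau> j) \<omega> - B 0 \<omega>)" for j \<omega>
      unfolding W_def sum_distrib_left[symmetric] sum_lessThan_telescope[of "\<lambda>j. B (\<tau> j) \<omega>"] d[of j, symmetric] \<tau>(2) ..
    moreover have "AE \<omega> in P. B 0 \<omega> = 0"
      using B by (simp add: standard_brownian_motion_def)
    ultimately show "AE \<omega> in P. (\<lambda>j. \<Sum>i<min j d. W i \<omega>) = (\<lambda>j. \<sigma> * B (\<tau> j) \<omega>)"
      by (auto elim: eventually_mono)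
    show "(\<lambda>\<omega> j. \<Sum>i<min j d. W i \<omega>) \<in> borel_measurable P"
      by (intro measurable_coordinatewise_then_product) measurable
    show "(\<lambda>\<omega> j. \<sigma> * B (\<tau> j) \<omega>) \<in> borel_measurable P"
      using \<tau>_nonneg by (intro measurable_coordinatewise_then_product) measurable
  qed
qed

section \<open>The log-price\<close>

text \<open>Joint convergence holds because the two processes are independent both before and in the
  limit; a linear combination is then a continuous map. It serves the two counting processes as well
  as the pair formed by counts and shocks.\<close>

lemma conv_fdd_lincomb_indep:
  assumes M: "prob_space M" and L: "prob_space L"
    and indM: "\<And>n (\<tau> :: nat \<Rightarrow> real). range \<tau> \<subseteq> {0..} \<Longrightarrow> indep_pair M (\<lambda>\<omega> j. X n (\<tau> j) \<omega>) (\<lambda>\<omega> j. Y n (\<tau> j) \<omega>)"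
    and indL: "\<And>\<tau> :: nat \<Rightarrow> real. range \<tau> \<subseteq> {0..} \<Longrightarrow> indep_pair L (\<lambda>\<omega> j. Z (\<tau> j) \<omega>) (\<lambda>\<omega> j. W (\<tau> j) \<omega>)"
    and XZ: "conv_fdd M X L Z" and YW: "conv_fdd M Y L W"
  shows "conv_fdd M (\<lambda>n t \<omega>. a * X n t \<omega> + b * Y n t \<omega>) L (\<lambda>t \<omega>. a * Z t \<omega> + b * W t \<omega>)"
proof (rule conv_fddI[OF M L])
  \<comment> \<open>Together with constant time sequences this recovers measurability of single
    values from \<open>indep_pair\<close>.\<close>
  have coord: "(\<lambda>\<omega>. v \<omega> (0::nat)) \<in> borel_measurable S" if "v \<in> borel_measurable S" for v :: "'c \<Rightarrow> nat \<Rightarrow> real" and S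
    using measurable_compose[OF that borel_measurable_continuous_onI[OF continuous_on_product_coordinates]] .
  show "(\<lambda>\<omega>. a * X n t \<omega> + b * Y n t \<omega>) \<in> borel_measurable M" if "0 \<le> t" for n t
    using indM[of "\<lambda>_. t" n] that coord[of "\<lambda>\<omega> j. X n t \<omega>" M] coord[of "\<lambda>\<omega> j. Y n t \<omega>" M]
    by (auto simp: indep_pair_def)
  show "(\<lambda>\<omega>. a * Z t \<omega> + b * W t \<omega>) \<in> borel_measurable L" if "0 \<le> t" for t
    using indL[of "\<lambda>_. t"] that coord[of "\<lambda>\<omega> j. Z t \<omega>" L] coord[of "\<lambda>\<omega> j. W t \<omega>" L]
    by (auto simp: indep_pair_def)
  fix \<tau> :: "nat \<Rightarrow> real" assume \<tau>: "mono \<tau>" "\<tau> 0 = 0" "finite (range \<tau>)"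
  have rng: "range \<tau> \<subseteq> {0..}" using mono_from_zero_nonneg[OF \<tau>(1,2)] by auto
  define h :: "(nat \<Rightarrow> real) \<times> (nat \<Rightarrow> real) \<Rightarrow> nat \<Rightarrow> real" where "h p j = a * fst p j + b * snd p j" for p j
  have h: "continuous_on UNIV h"
    unfolding h_def[abs_def]
    by (intro continuous_on_coordinatewise_then_product continuous_on_add continuous_on_mult continuous_on_const
        continuous_on_pair_coordinate)
  note ind = indM[OF rng] indL[OF rng]
  have "weakly_conv M (\<lambda>n \<omega>. h (\<lambda>j. X n (\<tau> j) \<omega>, \<lambda>j. Y n (\<tau> j) \<omega>)) L (\<lambda>\<omega>. h (\<lambda>j. Z (\<tau> j) \<omega>, \<lambda>j. W (\<tau> j) \<omega>))"
  proof (rule weakly_conv_continuous_map[OF M L _ _ _ h])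
    show "weakly_conv M (\<lambda>n \<omega>. (\<lambda>j. X n (\<tau> j) \<omega>, \<lambda>j. Y n (\<tau> j) \<omega>)) L (\<lambda>\<omega>. (\<lambda>j. Z (\<tau> j) \<omega>, \<lambda>j. W (\<tau> j) \<omega>))"
      using ind conv_fdd_imp_weakly_conv[OF XZ \<tau>(3) rng] conv_fdd_imp_weakly_conv[OF YW \<tau>(3) rng]
      by (rule weakly_conv_pair[OF M L])
    show "(\<lambda>\<omega>. (\<lambda>j. X n (\<tau> j) \<omega>, \<lambda>j. Y n (\<tau> j) \<omega>)) \<in> borel_measurable M" for n
      using ind(1)[of n] unfolding indep_pair_def by (intro borel_measurable_Pair) simp_all
    show "(\<lambda>\<omega>. (\<lambda>j. Z (\<tau> j) \<omega>, \<lambda>j. W (\<tau> j) \<omega>)) \<in> borel_measurable L"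
      using ind(2) unfolding indep_pair_def by (intro borel_measurable_Pair) simp_all
  qed
  then show "weakly_conv M (\<lambda>n \<omega> j. a * X n (\<tau> j) \<omega> + b * Y n (\<tau> j) \<omega>) L (\<lambda>\<omega> j. a * Z (\<tau> j) \<omega> + b * W (\<tau> j) \<omega>)"
    by (simp add: h_def[abs_def])
qed

text \<open>Convergence in distribution sees only the law of the limit, which \<open>\<pi>\<close>
  preserves; thus the limit moves to a larger space with room for a Brownian motion.\<close>

lemma conv_fdd_distr:
  assumes M: "prob_space M" and L: "prob_space L" and P: "prob_space P"
    and \<pi> [measurable]: "\<pi> \<in> measurable P L" and distr: "distr P L \<pi> = L"
    and X: "\<And>n t. 0 \<le> t \<Longrightarrow> X n t \<in> borel_measurable M"
    and Z: "\<And>t. 0 \<le> t \<Longrightarrow> Z t \<in> borel_measurable L"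
    and conv: "conv_fdd M X L Z"
  shows "conv_fdd M X P (\<lambda>t \<omega>. Z t (\<pi> \<omega>))"
proof (rule conv_fddI[OF M P X])
  show "(\<lambda>\<omega>. Z t (\<pi> \<omega>)) \<in> borel_measurable P" if "0 \<le> t" for t
    using measurable_compose[OF \<pi> Z[OF that]] .
  fix \<tau> :: "nat \<Rightarrow> real" assume \<tau>: "mono \<tau>" "\<tau> 0 = 0" "finite (range \<tau>)"
  have rng: "range \<tau> \<subseteq> {0..}" using mono_from_zero_nonneg[OF \<tau>(1,2)] by auto
  have Z' [measurable]: "(\<lambda>\<omega> j. Z (\<tau> j) \<omega>) \<in> borel_measurable L"
    using rng by (intro measurable_coordinatewise_then_product Z) auto
  have eq: "(\<integral>\<omega>. f (\<lambda>j. Z (\<tau> j) (\<pi> \<omega>)) \<partial>P) = (\<integral>\<omega>. f (\<lambda>j. Z (\<tau> j) \<omega>) \<partial>L)"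
    if "C-lipschitz_on UNIV f" for f :: "(nat \<Rightarrow> real) \<Rightarrow> real" and C
  proof -
    have "(\<lambda>\<omega>. f (\<lambda>j. Z (\<tau> j) \<omega>)) \<in> borel_measurable L"
      by (rule measurable_compose[OF Z' borel_measurable_continuous_onI[OF lipschitz_on_UNIV_continuous[OF that]]])
    from integral_distr[OF \<pi> this] show ?thesis unfolding distr by simp
  qed
  show "weakly_conv M (\<lambda>n \<omega> j. X n (\<tau> j) \<omega>) P (\<lambda>\<omega> j. Z (\<tau> j) (\<pi> \<omega>))"
    unfolding weakly_conv_def
  proof safe
    fix f :: "(nat \<Rightarrow> real) \<Rightarrow> real" and C assume f: "C-lipschitz_on UNIV f" "bounded (range f)"
    show "(\<lambda>n. \<integral>\<omega>. f (\<lambda>j. X n (\<tau> j) \<omega>) \<partial>M) \<longlonglongrightarrow> (\<integral>\<omega>. f (\<lambda>j. Z (\<tau> j) (\<pi> \<omega>)) \<partial>P)"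
      unfolding eq[OF f(1)]
      using conv_fdd_imp_weakly_conv[OF conv \<tau>(3) rng] f unfolding weakly_conv_def by blast
  qed
qed

lemma conv_in_prob_dominated:
  assumes M: "prob_space M" and [measurable]: "\<And>t. W t \<in> borel_measurable M"
    and W: "conv_in_prob M W 0 F"
    and le: "\<forall>\<^sub>F t in F. \<forall>\<omega>\<in>space M. \<bar>V t \<omega>\<bar> \<le> \<bar>W t \<omega>\<bar>"
  shows "conv_in_prob M V 0 F"
proof (rule conv_in_probI)
  interpret prob_space M by fact
  fix \<epsilon> \<delta> :: real assume "\<epsilon> > 0" "\<delta> > 0"
  from conv_in_probD[OF W this] le
  show "\<forall>\<^sub>F t in F. prob {\<omega>\<in>space M. \<bar>V t \<omega> - 0\<bar> > \<epsilon>} < \<delta>"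
  proof eventually_elim
    case (elim t)
    have "prob {\<omega>\<in>space M. \<bar>V t \<omega> - 0\<bar> > \<epsilon>} \<le> prob {\<omega>\<in>space M. \<bar>W t \<omega> - 0\<bar> > \<epsilon>}"
      using elim(2) by (intro finite_measure_mono) force+
    with elim(1) show ?case by simp
  qed
qed

section \<open>Counts, the price and the passage to real time\<close>

lemma measurable_num_points:
  assumes [measurable]: "(\<lambda>\<omega>. emeasure (N \<omega>) {0<..t}) \<in> borel_measurable G"
  shows "num_points N t \<in> measurable G (count_space UNIV)"
  unfolding num_points_def[abs_def] measure_def by measurable

lemma num_points_mono:
  assumes "point_process M N" "\<omega> \<in> space M" "s \<le> t"
  shows "num_points N s \<omega> \<le> num_points N t \<omega>"
proof -
  have sets: "sets (N \<omega>) = sets borel" and fin: "\<And>S. S \<in> sets borel \<Longrightarrow> bounded S \<Longrightarrow> \<exists>n::nat. emeasure (N \<omega>) S = of_nat n"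
    using assms(1,2) by (auto simp: point_process_def)
  \<comment> \<open>\<open>measure\<close> assigns 0 to infinite mass, so finiteness is what makes
    it monotone here.\<close>
  have "emeasure (N \<omega>) {0<..t} \<noteq> \<infinity>"
    using fin[of "{0<..t}"] by (auto simp: ennreal_of_nat_eq_real_of_nat)
  then have "measure (N \<omega>) {0<..s} \<le> measure (N \<omega>) {0<..t}"
    using assms(3) by (intro measure_mono_fmeasurable) (auto simp: sets fmeasurable_def less_top[symmetric])
  then show ?thesis unfolding num_points_def by (intro nat_mono floor_mono)
qed

lemma measurable_random_sum:
  fixes g :: "nat \<Rightarrow> 'a \<Rightarrow> real"
  assumes "\<And>k. k \<ge> 1 \<Longrightarrow> g k \<in> borel_measurable M" and "K \<in> measurable M (count_space UNIV)"
  shows "(\<lambda>\<omega>. \<Sum>k=1..K \<omega>. g k \<omega>) \<in> borel_measurable M"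
proof (rule measurable_compose_countable[OF _ assms(2)])
  show "(\<lambda>\<omega>. \<Sum>k=1..i. g k \<omega>) \<in> borel_measurable M" for i
    by (intro borel_measurable_sum assms(1)) auto
qed

lemma log_price_eq:
  "log_price N \<mu> e \<eta> t \<omega> = \<mu> 1 * real (num_points (N 1) t \<omega>) + \<mu> 2 * real (num_points (N 2) t \<omega>) +
    ((\<Sum>k=1..num_points (N 1) t \<omega>. e 1 k \<omega>) + (\<Sum>k=1..num_points (N 2) t \<omega>. e 2 k \<omega>)) +
    ((\<Sum>k=1..num_points (N 1) t \<omega>. \<eta> 1 k \<omega>) + (\<Sum>k=1..num_points (N 2) t \<omega>. \<eta> 2 k \<omega>))"
  by (simp add: log_price_def sum.distrib mult.commute)

text \<open>The hypothesis speaks of integer times only. By monotonicity the count at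
  \<open>t\<close> lies between the counts at the neighbouring integers \<open>n\<close> and
  \<open>Suc n\<close>, and replacing \<open>l * t\<close> by its value there costs at most
  \<open>\<bar>l\<bar>\<close>.\<close>

lemma conv_in_prob_real_time:
  fixes K :: "real \<Rightarrow> 'a \<Rightarrow> nat"
  assumes M: "prob_space M" and K: "\<And>t. K t \<in> measurable M (count_space UNIV)"
    and mono: "\<And>\<omega> s t. \<omega> \<in> space M \<Longrightarrow> s \<le> t \<Longrightarrow> K s \<omega> \<le> K t \<omega>"
    and lim: "conv_in_prob M (\<lambda>n \<omega>. (real (K (real n) \<omega>) - l * real n) / real n) 0 sequentially"
  shows "conv_in_prob M (\<lambda>t \<omega>. real (K t \<omega>) / t) l at_top"
proof (rule conv_in_probI)
  interpret prob_space M by fact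
  fix \<epsilon> \<delta> :: real assume "\<epsilon> > 0" "\<delta> > 0"
  define D where "D n = {\<omega>\<in>space M. \<bar>(real (K (real n) \<omega>) - l * real n) / real n - 0\<bar> > \<epsilon> / 4}" for n
  have [measurable]: "D n \<in> events" for n
    unfolding D_def using K[of "real n"] by measurable
  have "\<forall>\<^sub>F n in sequentially. prob (D n) < \<delta> / 2"
    unfolding D_def using \<open>\<epsilon> > 0\<close> \<open>\<delta> > 0\<close> by (intro conv_in_probD[OF lim]) auto
  then obtain n0 where n0: "\<And>n. n \<ge> n0 \<Longrightarrow> prob (D n) < \<delta> / 2"
    by (auto simp: eventually_sequentially)
  have "\<forall>\<^sub>F t in at_top. t \<ge> max (real n0 + 1) (max 1 ((\<bar>l\<bar> + \<epsilon> / 4) / (\<epsilon> / 2)))"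
    by (rule eventually_ge_at_top)
  then show "\<forall>\<^sub>F t in at_top. prob {\<omega>\<in>space M. \<bar>real (K t \<omega>) / t - l\<bar> > \<epsilon>} < \<delta>"
  proof eventually_elim
    case (elim t)
    define n where "n = nat \<lfloor>t\<rfloor>"
    \<comment> \<open>The constant part \<open>\<bar>l\<bar> + \<epsilon> / 4\<close> of the error
      is now at most \<open>\<epsilon> * t / 2\<close>; the remaining part is
      \<open>\<epsilon> * t / 4\<close>.\<close>
    have t: "t \<ge> 1" "t > 0" "\<bar>l\<bar> + \<epsilon> / 4 \<le> \<epsilon> / 2 * t"
      using elim \<open>\<epsilon> > 0\<close> by (auto simp: divide_le_eq mult.commute)
    have n: "real n \<le> t" "t \<le> real (Suc n)" "n \<ge> n0" "n > 0"
      unfolding n_def using elim by linarith+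
    have "\<omega> \<in> D n \<union> D (Suc n)" if \<omega>: "\<omega> \<in> space M" "\<bar>real (K t \<omega>) / t - l\<bar> > \<epsilon>" for \<omega>
    proof (rule ccontr)
      assume "\<not> \<omega> \<in> D n \<union> D (Suc n)"
      then have *: "\<bar>(real (K (real n) \<omega>) - l * real n) / real n\<bar> \<le> \<epsilon> / 4"
        "\<bar>(real (K (real (Suc n)) \<omega>) - l * real (Suc n)) / real (Suc n)\<bar> \<le> \<epsilon> / 4"
        using \<omega>(1) by (auto simp: D_def not_less)
      have b1: "\<bar>real (K (real n) \<omega>) - l * real n\<bar> \<le> \<epsilon> / 4 * real n"
        using *(1) n(4) by (simp add: abs_divide pos_divide_le_eq)
      have b2: "\<bar>real (K (real (Suc n)) \<omega>) - l * real (Suc n)\<bar> \<le> \<epsilon> / 4 * real (Suc n)"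
        using *(2) by (simp only: abs_divide abs_of_nat pos_divide_le_eq of_nat_0_less_iff zero_less_Suc)
      have K_le: "real (K (real n) \<omega>) \<le> real (K t \<omega>)" "real (K t \<omega>) \<le> real (K (real (Suc n)) \<omega>)"
        using mono[OF \<omega>(1)] n(1,2) by auto
      have l1: "\<bar>l * real n - l * t\<bar> \<le> \<bar>l\<bar>"
        using n(1,2) mult_left_mono[of "\<bar>real n - t\<bar>" 1 "\<bar>l\<bar>"] by (simp add: abs_mult flip: right_diff_distrib)
      have l2: "\<bar>l * real (Suc n) - l * t\<bar> \<le> \<bar>l\<bar>"
        using n(1,2) mult_left_mono[of "\<bar>real (Suc n) - t\<bar>" 1 "\<bar>l\<bar>"] by (simp only: abs_mult flip: right_diff_distrib) simp
      have e1: "\<epsilon> / 4 * real n \<le> \<epsilon> / 4 * (t + 1)" "\<epsilon> / 4 * real (Suc n) \<le> \<epsilon> / 4 * (t + 1)"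
        using n(1) \<open>\<epsilon> > 0\<close> by (intro mult_left_mono; simp)+
      have "\<bar>real (K t \<omega>) - l * t\<bar> \<le> \<bar>l\<bar> + \<epsilon> / 4 * (t + 1)"
        using b1 b2 K_le l1 l2 e1 by linarith
      also have "\<dots> \<le> \<epsilon> * t"
      proof -
        have "\<epsilon> / 4 * (t + 1) = \<epsilon> / 4 + \<epsilon> * t / 4" "\<epsilon> / 2 * t = \<epsilon> * t / 2"
          by (simp_all add: field_simps)
        then show ?thesis using t(3) mult_pos_pos[OF \<open>\<epsilon> > 0\<close> t(2)] by linarith
      qed
      finally have "\<bar>real (K t \<omega>) / t - l\<bar> \<le> \<epsilon>"
        using t(2) by (simp add: abs_le_iff field_simps)
      with \<omega>(2) show False by simp
    qed
    then have "prob {\<omega>\<in>space M. \<bar>real (K t \<omega>) / t - l\<bar> > \<epsilon>} \<le> prob (D n \<union> D (Suc n))"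
      by (intro finite_measure_mono) auto
    also have "\<dots> \<le> prob (D n) + prob (D (Suc n))"
      by (intro measure_subadditive) auto
    finally show ?case using n0[of n] n0[of "Suc n"] n(3) by linarith
  qed
qed

text \<open>The law of large numbers comes with \<gamma> < 1 because at \<gamma> = 1 the
  fluctuations of the counts can be of the order of time itself, as for a random intensity. The same
  law fixes the variance of the Brownian term when both \<open>\<mu> i\<close> are 0. That variance
  also rests on the independence of the two shock families, since correlated families could add a
  covariance. As \<open>L\<close> may be too small to carry a Brownian motion independent of the
  \<open>A i\<close>, the limit lives on any \<open>P\<close> that projects onto \<open>L\<close>
  with the right law; \<open>\<sigma>\<close> is fixed before \<open>P\<close>. If every process
  with \<open>lam i > 0\<close> has shocks of variance 0, the Brownian part degenerates.\<close>

theorem proposition2p1: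
  fixes M :: "'a measure" and L :: "'b measure"
    and N :: "nat \<Rightarrow> 'a \<Rightarrow> real measure"
    and e \<eta> :: "nat \<Rightarrow> nat \<Rightarrow> 'a \<Rightarrow> real"
    and \<mu> lam s :: "nat \<Rightarrow> real" and \<gamma> :: real
    and A :: "nat \<Rightarrow> real \<Rightarrow> 'b \<Rightarrow> real"
  assumes "prob_space M" and "prob_space L"
    and "\<forall>i\<in>{1,2}. point_process M (N i)"
    and "\<forall>i\<in>{1,2}. prob_space.indep_vars M (\<lambda>_. borel) (e i) {1..}"
    and "\<forall>i\<in>{1,2}. \<forall>k\<ge>1. distr M borel (e i k) = distr M borel (e i 1)"
    and "\<forall>i\<in>{1,2}. \<forall>k\<ge>1. integrable M (\<lambda>\<omega>. (e i k \<omega>)\<^sup>2) \<and>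
           prob_space.expectation M (e i k) = 0 \<and> prob_space.variance M (e i k) = (s i)\<^sup>2"
    and "indep_families M
           ({1,2} \<times> sets borel) (\<lambda>(i, S) \<omega>. emeasure (N i \<omega>) S)
           ({1,2} \<times> {1..}) (\<lambda>(i, k). e i k)"
    and "indep_families M
           ({1,2} \<times> {1..}) (\<lambda>(i, k). \<eta> i k)
           ({1,2} \<times> {1..}) (\<lambda>(i, k). e i k)"
    and "indep_families M
           (sets borel) (\<lambda>S \<omega>. emeasure (N 1 \<omega>) S)
           (sets borel) (\<lambda>S \<omega>. emeasure (N 2 \<omega>) S)"
    and "\<gamma> \<ge> 1 / 2"
    and "\<forall>i\<in>{1,2}. \<forall>t\<ge>0. A i t \<in> borel_measurable L"
    and "indep_families L {0..} (A 1) {0..} (A 2)"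
    and "\<exists>i\<in>{1,2}. \<exists>t\<ge>0. \<not> (AE \<omega> in L. A i t \<omega> = 0)"
    and "\<forall>i\<in>{1,2}. conv_fdd M
           (\<lambda>n t \<omega>. real n powr (- \<gamma>) *
              (real (num_points (N i) (real n * t) \<omega>) - lam i * real n * t)) L (A i)"
    and "\<forall>i\<in>{1,2}. ucp_to_zero M
           (\<lambda>n t \<omega>. real n powr (- 1 / 2) * (\<Sum>k=1..nat \<lfloor>real n * t\<rfloor>. \<eta> i k \<omega>))"
  shows "(\<gamma> < 1 \<longrightarrow>
           conv_in_prob M (\<lambda>t \<omega>. log_price N \<mu> e \<eta> t \<omega> / t) (lam 1 * \<mu> 1 + lam 2 * \<mu> 2) at_top)
    \<and> (\<gamma> > 1 / 2 \<longrightarrow>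
           conv_fdd M
             (\<lambda>n t \<omega>. real n powr (- \<gamma>) *
                (log_price N \<mu> e \<eta> (real n * t) \<omega> - (lam 1 * \<mu> 1 + lam 2 * \<mu> 2) * real n * t))
             L (\<lambda>t \<omega>. \<mu> 1 * A 1 t \<omega> + \<mu> 2 * A 2 t \<omega>))
    \<and> ((\<gamma> = 1 / 2 \<or> (\<mu> 1 = 0 \<and> \<mu> 2 = 0 \<and> \<gamma> < 1)) \<and> indep_families M {1..} (e 1) {1..} (e 2) \<longrightarrow>
         (\<exists>\<sigma>\<ge>0. ((\<exists>i\<in>{1,2}. lam i > 0 \<and> s i \<noteq> 0) \<longrightarrow> \<sigma> > 0) \<and>
           (\<forall>(P :: 'c measure) \<pi> B.
              prob_space P \<and> \<pi> \<in> measurable P L \<and> distr P L \<pi> = L \<and>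
              standard_brownian_motion P B \<and>
              indep_families P ({1,2} \<times> {0..}) (\<lambda>(i, t) \<omega>. A i t (\<pi> \<omega>)) {0..} B \<longrightarrow>
              conv_fdd M
                (\<lambda>n t \<omega>. real n powr (- 1 / 2) *
                   (log_price N \<mu> e \<eta> (real n * t) \<omega> - (lam 1 * \<mu> 1 + lam 2 * \<mu> 2) * real n * t))
                P (\<lambda>t \<omega>. \<mu> 1 * A 1 t (\<pi> \<omega>) + \<mu> 2 * A 2 t (\<pi> \<omega>) + \<sigma> * B t \<omega>))))"
proof -
  interpret M: prob_space M by fact
  interpret L: prob_space L by fact
  note M = assms(1) and L = assms(2) and pp = assms(3) and \<gamma> = assms(10) and A_meas = assms(11)
  let ?FN = "family_algebra M ({1,2} \<times> sets borel) (\<lambda>(i, S) \<omega>. emeasure (N i \<omega>) S)"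
  let ?Fe = "family_algebra M ({1,2} \<times> {1..}) (\<lambda>(i, k). e i k)"
  define K where "K i t = num_points (N i) t" for i t
  define S where "S i m \<omega> = (\<Sum>k=1..m. e i k \<omega>)" for i m \<omega>
  define H where "H i m \<omega> = (\<Sum>k=1..m. \<eta> i k \<omega>)" for i m \<omega>
  define R where "R t \<omega> = (S 1 (K 1 t \<omega>) \<omega> + S 2 (K 2 t \<omega>) \<omega>) + (H 1 (K 1 t \<omega>) \<omega> + H 2 (K 2 t \<omega>) \<omega>)" for t \<omega>
  have price: "log_price N \<mu> e \<eta> t \<omega> = \<mu> 1 * real (K 1 t \<omega>) + \<mu> 2 * real (K 2 t \<omega>) + R t \<omega>" for t \<omega>
    unfolding log_price_eq R_def S_def H_def K_def by simp

  \<comment> \<open>Measurability of counts, shocks and noise\<close>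
  have K_FN: "K i t \<in> measurable ?FN (count_space UNIV)" if "i \<in> {1,2}" for i t
    unfolding K_def
    using measurable_family_algebra[of "(i, {0<..t})" "{1,2} \<times> sets borel" "\<lambda>(i, S) \<omega>. emeasure (N i \<omega>) S" M] that
    by (intro measurable_num_points) simp
  have K_fam: "K i t \<in> measurable (family_algebra M (sets borel) (\<lambda>S \<omega>. emeasure (N i \<omega>) S)) (count_space UNIV)" for i t
    unfolding K_def
    using measurable_family_algebra[of "{0<..t}" "sets borel" "\<lambda>S \<omega>. emeasure (N i \<omega>) S" M]
    by (intro measurable_num_points) simp
  have K_meas: "K i t \<in> measurable M (count_space UNIV)" if "i \<in> {1,2}" for i t
    unfolding K_def using pp that by (intro measurable_num_points) (auto simp: point_process_def)
  have K_real: "(\<lambda>\<omega>. real (K i t \<omega>)) \<in> borel_measurable M" if "i \<in> {1,2}" for i t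
    using K_meas[OF that] by measurable
  have e_Fe: "e i k \<in> borel_measurable ?Fe" if "i \<in> {1,2}" "k \<ge> 1" for i k
    using measurable_family_algebra[of "(i, k)" "{1,2} \<times> {1..}" "\<lambda>(i, k). e i k" M] that by simp
  have e_meas: "e i k \<in> borel_measurable M" if "i \<in> {1,2}" "k \<ge> 1" for i k
    using indep_familiesD(3)[OF assms(7), of "(i, k)"] that by simp
  have \<eta>_meas: "\<eta> i k \<in> borel_measurable M" if "i \<in> {1,2}" "k \<ge> 1" for i k
    using indep_familiesD(2)[OF assms(8), of "(i, k)"] that by simp
  have e_ind: "M.indep_vars (\<lambda>_. borel) (e i) {1..}" if "i \<in> {1,2}" for i
    using assms(4) that by blast
  have e_id: "distr M borel (e i k) = distr M borel (e i 1)" if "i \<in> {1,2}" "k \<ge> 1" for i k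
    using assms(5) that by blast
  have e_sq: "integrable M (\<lambda>\<omega>. (e i k \<omega>)\<^sup>2)" and e_mean: "M.expectation (e i k) = 0"
    and e_var: "M.expectation (\<lambda>\<omega>. (e i k \<omega>)\<^sup>2) = (s i)\<^sup>2" if "i \<in> {1,2}" "k \<ge> 1" for i k
  proof -
    have *: "integrable M (\<lambda>\<omega>. (e i k \<omega>)\<^sup>2)" "M.expectation (e i k) = 0" "M.variance (e i k) = (s i)\<^sup>2"
      using assms(6) that by blast+
    then show "integrable M (\<lambda>\<omega>. (e i k \<omega>)\<^sup>2)" "M.expectation (e i k) = 0" by blast+
    show "M.expectation (\<lambda>\<omega>. (e i k \<omega>)\<^sup>2) = (s i)\<^sup>2" using *(3) unfolding *(2) by simp
  qed
  have S_meas: "(\<lambda>\<omega>. S i (K i t \<omega>) \<omega>) \<in> borel_measurable M" if "i \<in> {1,2}" for i t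
    unfolding S_def using e_meas[OF that] K_meas[OF that] by (rule measurable_random_sum)
  have S_meas': "(\<lambda>\<omega>. S i m \<omega>) \<in> borel_measurable M" if "i \<in> {1,2}" for i m
    unfolding S_def by (intro borel_measurable_sum e_meas[OF that]) auto
  have H_meas: "(\<lambda>\<omega>. H i (K i t \<omega>) \<omega>) \<in> borel_measurable M" if "i \<in> {1,2}" for i t
    unfolding H_def using \<eta>_meas[OF that] K_meas[OF that] by (rule measurable_random_sum)
  have meas [measurable]:
    "(\<lambda>\<omega>. real (K 1 t \<omega>)) \<in> borel_measurable M" "(\<lambda>\<omega>. real (K 2 t \<omega>)) \<in> borel_measurable M"
    "(\<lambda>\<omega>. S 1 (K 1 t \<omega>) \<omega>) \<in> borel_measurable M" "(\<lambda>\<omega>. S 2 (K 2 t \<omega>) \<omega>) \<in> borel_measurable M"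
    "(\<lambda>\<omega>. S 1 m \<omega>) \<in> borel_measurable M" "(\<lambda>\<omega>. S 2 m \<omega>) \<in> borel_measurable M"
    "(\<lambda>\<omega>. H 1 (K 1 t \<omega>) \<omega>) \<in> borel_measurable M" "(\<lambda>\<omega>. H 2 (K 2 t \<omega>) \<omega>) \<in> borel_measurable M" for t m
    by (intro K_real S_meas S_meas' H_meas; simp)+
  have R_meas [measurable]: "R t \<in> borel_measurable M" for t
    unfolding R_def[abs_def] by measurable
  have price_meas [measurable]: "log_price N \<mu> e \<eta> t \<in> borel_measurable M" for t
    unfolding price[abs_def] by measurable

  \<comment> \<open>Shock and noise sums at random indices\<close>
  have shocks: "conv_in_prob M (\<lambda>t \<omega>. c t * (S i (K i (u t) \<omega>) \<omega> - S i (m t) \<omega>)) 0 F"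
    if i: "i \<in> {1,2}" and "conv_in_prob M (\<lambda>t \<omega>. (c t)\<^sup>2 * (real (K i (u t) \<omega>) - real (m t))) 0 F"
    for i and c u :: "'t \<Rightarrow> real" and m and F
    unfolding S_def
    by (rule random_sum_conv_in_prob[OF M e_ind[OF i] e_sq[OF i] e_mean[OF i] e_var[OF i]
          indep_familiesD(1)[OF assms(7)] space_family_algebra space_family_algebra K_FN[OF i] e_Fe[OF i] that(2)])
  have noise: "conv_in_prob M (\<lambda>t \<omega>. c t * H i (K i (u t) \<omega>) \<omega>) 0 F"
    if i: "i \<in> {1,2}" and "bounded_in_prob M (\<lambda>t \<omega>. (c t)\<^sup>2 * real (K i (u t) \<omega>)) F"
      "(c \<longlongrightarrow> 0) F" "\<forall>\<^sub>F t in F. c t > 0"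
    for i and c u :: "'t \<Rightarrow> real" and F
    unfolding H_def using assms(15) i
    by (intro ucp_noise_conv_in_prob[OF M _ \<eta>_meas[OF i] K_meas[OF i] that(2-4)]) auto
  \<comment> \<open>The normalization \<open>c\<close>, the times \<open>u\<close> and the filter
    are left free, so that one statement covers real time with \<open>1 / t\<close> and integer
    scaling with \<open>n powr (- \<gamma>)\<close>.\<close>
  have remainder: "conv_in_prob M (\<lambda>t \<omega>. c t * R (u t) \<omega>) 0 F"
    if c: "\<And>i. i \<in> {1,2} \<Longrightarrow> conv_in_prob M (\<lambda>t \<omega>. (c t)\<^sup>2 * real (K i (u t) \<omega>)) 0 F"
      "(c \<longlongrightarrow> 0) F" "\<forall>\<^sub>F t in F. c t > 0"
    for c u :: "'t \<Rightarrow> real" and F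
  proof -
    have K12: "(\<lambda>\<omega>. (c t)\<^sup>2 * real (K i (u t) \<omega>)) \<in> borel_measurable M" if "i \<in> {1,2}" for i t
      using K_real[OF that] by measurable
    \<comment> \<open>Comparison with the index 0, where the sum is empty.\<close>
    have s: "conv_in_prob M (\<lambda>t \<omega>. c t * S i (K i (u t) \<omega>) \<omega>) 0 F" if i: "i \<in> {1,2}" for i
      using shocks[OF i, of c u "\<lambda>_. 0" F] c(1)[OF i] by (simp add: S_def)
    have h: "conv_in_prob M (\<lambda>t \<omega>. c t * H i (K i (u t) \<omega>) \<omega>) 0 F" if i: "i \<in> {1,2}" for i
      using conv_in_prob_imp_bounded_in_prob[OF M K12[OF i] c(1)[OF i]] c(2,3) by (rule noise[OF i])
    have "conv_in_prob M (\<lambda>t \<omega>. (c t * S 1 (K 1 (u t) \<omega>) \<omega> + c t * S 2 (K 2 (u t) \<omega>) \<omega>) +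
        (c t * H 1 (K 1 (u t) \<omega>) \<omega> + c t * H 2 (K 2 (u t) \<omega>) \<omega>)) ((0 + 0) + (0 + 0)) F"
      by (intro conv_in_prob_add[OF M] s h; (measurable | simp))
    then show ?thesis by (simp add: R_def algebra_simps)
  qed

  \<comment> \<open>Fluctuations of the counts\<close>
  define W where "W i n t \<omega> = real n powr (- \<gamma>) * (real (K i (real n * t) \<omega>) - lam i * real n * t)" for i n t \<omega>
  have W_conv: "conv_fdd M (W i) L (A i)" if "i \<in> {1,2}" for i
    using assms(14) that unfolding W_def[abs_def] K_def by blast
  have W_meas: "W i n t \<in> borel_measurable M" if "i \<in> {1,2}" for i n t
    unfolding W_def[abs_def] using K_real[OF that] by measurable
  have A_meas': "A i t \<in> borel_measurable L" if "i \<in> {1,2}" "0 \<le> t" for i t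
    using A_meas that by blast
  have W_bdd: "bounded_in_prob M (\<lambda>n. W i n t) sequentially" if "i \<in> {1,2}" "0 \<le> t" for i t
    using W_meas[OF that(1)] A_meas'[OF that] W_conv[OF that(1)] that(2)
    by (intro conv_fdd_bounded_in_prob[OF M L]) auto
  \<comment> \<open>Convergence of each \<open>W i\<close> becomes joint convergence through the
    independence of the two point processes and of their limits.\<close>
  have W_conv2: "conv_fdd M (\<lambda>n t \<omega>. \<mu> 1 * W 1 n t \<omega> + \<mu> 2 * W 2 n t \<omega>) L (\<lambda>t \<omega>. \<mu> 1 * A 1 t \<omega> + \<mu> 2 * A 2 t \<omega>)"
  proof (rule conv_fdd_lincomb_indep[OF M L _ _ W_conv W_conv])
    fix n and \<tau> :: "nat \<Rightarrow> real" assume \<tau>: "range \<tau> \<subseteq> {0..}"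
    have "(\<lambda>\<omega> j. W i n (\<tau> j) \<omega>) \<in> borel_measurable (family_algebra M (sets borel) (\<lambda>S \<omega>. emeasure (N i \<omega>) S))" for i
      unfolding W_def
      by (intro measurable_coordinatewise_then_product borel_measurable_times borel_measurable_diff borel_measurable_const
          measurable_compose[OF K_fam]) simp
    then show "indep_pair M (\<lambda>\<omega> j. W 1 n (\<tau> j) \<omega>) (\<lambda>\<omega> j. W 2 n (\<tau> j) \<omega>)"
      by (intro indep_families_indep_pair[OF M assms(9)])
    have "(\<lambda>\<omega> j. A i (\<tau> j) \<omega>) \<in> borel_measurable (family_algebra L {0..} (A i))" for i
      using \<tau> by (intro measurable_coordinatewise_then_product measurable_family_algebra) auto
    then show "indep_pair L (\<lambda>\<omega> j. A 1 (\<tau> j) \<omega>) (\<lambda>\<omega> j. A 2 (\<tau> j) \<omega>)"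
      by (intro indep_families_indep_pair[OF L assms(12)])
  qed auto
  \<comment> \<open>Normalizing by \<open>n\<close> instead of \<open>n powr \<gamma>\<close>
    multiplies the tight \<open>W\<close> by \<open>n powr (\<gamma> - 1)\<close>, which vanishes
    for \<gamma> < 1. At \<open>n = 0\<close> both expressions are 0 by convention.\<close>
  have lln: "conv_in_prob M (\<lambda>n \<omega>. (real (K i (real n * t) \<omega>) - lam i * real n * t) / real n) 0 sequentially"
    if "\<gamma> < 1" "i \<in> {1,2}" "0 \<le> t" for i t
  proof -
    have "(\<lambda>n. real n powr (\<gamma> - 1)) \<longlonglongrightarrow> 0"
      using that(1) by (intro tendsto_neg_powr filterlim_real_sequentially) simp
    then have "conv_in_prob M (\<lambda>n \<omega>. real n powr (\<gamma> - 1) * W i n t \<omega>) 0 sequentially"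
      by (rule conv_in_prob_zero_mult_bounded[OF M W_meas[OF that(2)] W_bdd[OF that(2,3)]])
    moreover have "real n powr (\<gamma> - 1) * W i n t \<omega> = (real (K i (real n * t) \<omega>) - lam i * real n * t) / real n" for n \<omega>
      by (cases "n = 0") (simp_all add: W_def powr_diff powr_minus field_simps)
    ultimately show ?thesis by simp
  qed

  have part1: "conv_in_prob M (\<lambda>t \<omega>. log_price N \<mu> e \<eta> t \<omega> / t) (lam 1 * \<mu> 1 + lam 2 * \<mu> 2) at_top"
    if "\<gamma> < 1"
  proof -
    have rate: "conv_in_prob M (\<lambda>t \<omega>. real (K i t \<omega>) / t) (lam i) at_top" if i: "i \<in> {1,2}" for i
    proof (rule conv_in_prob_real_time[OF M K_meas[OF i]])
      show "K i r \<omega> \<le> K i t \<omega>" if "\<omega> \<in> space M" "r \<le> t" for r t \<omega>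
        unfolding K_def using pp i that by (intro num_points_mono[of M]) auto
      show "conv_in_prob M (\<lambda>n \<omega>. (real (K i (real n) \<omega>) - lam i * real n) / real n) 0 sequentially"
        using lln[OF \<open>\<gamma> < 1\<close> i, of 1] by simp
    qed
    have inv0: "((\<lambda>t::real. 1 / t) \<longlongrightarrow> 0) at_top"
      using tendsto_inverse_0_at_top[OF filterlim_ident] by (simp add: inverse_eq_divide)
    \<comment> \<open>One factor \<open>1 / t\<close> turns the count into a convergent rate, the
      other sends the product to 0.\<close>
    have "conv_in_prob M (\<lambda>t \<omega>. (1 / t)\<^sup>2 * real (K i t \<omega>)) 0 at_top" if i: "i \<in> {1,2}" for i
    proof -
      have m: "(\<lambda>\<omega>. real (K i t \<omega>) / t) \<in> borel_measurable M" for t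
        using K_real[OF i] by measurable
      show ?thesis
        using conv_in_prob_zero_mult_bounded[OF M m conv_in_prob_imp_bounded_in_prob[OF M m rate[OF i]] inv0]
        by (simp add: power2_eq_square)
    qed
    then have rem: "conv_in_prob M (\<lambda>t \<omega>. 1 / t * R t \<omega>) 0 at_top"
      using remainder[of "\<lambda>t. 1 / t" "\<lambda>t. t" at_top] inv0 eventually_gt_at_top[of "0::real"] by simp
    have main: "conv_in_prob M (\<lambda>t \<omega>. \<mu> 1 * (real (K 1 t \<omega>) / t) + \<mu> 2 * (real (K 2 t \<omega>) / t))
        (\<mu> 1 * lam 1 + \<mu> 2 * lam 2) at_top"
      by (intro conv_in_prob_add[OF M] conv_in_prob_cmult rate; (measurable | simp))
    have "conv_in_prob M (\<lambda>t \<omega>. (\<mu> 1 * (real (K 1 t \<omega>) / t) + \<mu> 2 * (real (K 2 t \<omega>) / t)) + 1 / t * R t \<omega>)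
        ((\<mu> 1 * lam 1 + \<mu> 2 * lam 2) + 0) at_top"
      by (rule conv_in_prob_add[OF M _ _ main rem]; measurable)
    then show ?thesis by (simp add: price add_divide_distrib mult.commute)
  qed

  have part2: "conv_fdd M
      (\<lambda>n t \<omega>. real n powr (- \<gamma>) *
         (log_price N \<mu> e \<eta> (real n * t) \<omega> - (lam 1 * \<mu> 1 + lam 2 * \<mu> 2) * real n * t))
      L (\<lambda>t \<omega>. \<mu> 1 * A 1 t \<omega> + \<mu> 2 * A 2 t \<omega>)"
    if "\<gamma> > 1 / 2"
  proof (rule conv_fdd_slutsky[OF M L _ _ _ W_conv2])
    show "(\<lambda>\<omega>. \<mu> 1 * W 1 n t \<omega> + \<mu> 2 * W 2 n t \<omega>) \<in> borel_measurable M" for n t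
      using W_meas by (intro borel_measurable_add borel_measurable_times borel_measurable_const) auto
    show "(\<lambda>\<omega>. \<mu> 1 * A 1 t \<omega> + \<mu> 2 * A 2 t \<omega>) \<in> borel_measurable L" if "0 \<le> t" for t
      using A_meas' that by (intro borel_measurable_add borel_measurable_times borel_measurable_const) auto
    show "(\<lambda>\<omega>. real n powr (- \<gamma>) *
         (log_price N \<mu> e \<eta> (real n * t) \<omega> - (lam 1 * \<mu> 1 + lam 2 * \<mu> 2) * real n * t)) \<in> borel_measurable M" for n t
      by measurable
    fix t :: real assume "0 \<le> t"
    have c0: "(\<lambda>n. real n powr (- \<gamma>)) \<longlonglongrightarrow> 0"
      using that by (intro tendsto_neg_powr filterlim_real_sequentially) simp
    have "conv_in_prob M (\<lambda>n \<omega>. real n powr (- \<gamma>) * R (real n * t) \<omega>) 0 sequentially"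
    proof (rule remainder[OF _ c0])
      show "\<forall>\<^sub>F n in sequentially. real n powr (- \<gamma>) > 0"
        using eventually_gt_at_top[of 0] by eventually_elim simp
      fix i :: nat assume i: "i \<in> {1,2}"
      \<comment> \<open>The squared normalization times the count is a vanishing multiple of
        \<open>W\<close> plus a drift of order \<open>n powr (1 - 2 * \<gamma>)\<close>; here
        \<gamma> > 1/2 enters.\<close>
      have "(\<lambda>n. real n powr (1 - 2 * \<gamma>)) \<longlonglongrightarrow> 0"
        using that by (intro tendsto_neg_powr filterlim_real_sequentially) simp
      from tendsto_mult[OF tendsto_const this, of "lam i * t"]
      have "conv_in_prob M (\<lambda>n \<omega>. lam i * t * real n powr (1 - 2 * \<gamma>)) 0 sequentially"
        by (intro conv_in_prob_const) simp
      moreover have "conv_in_prob M (\<lambda>n \<omega>. real n powr (- \<gamma>) * W i n t \<omega>) 0 sequentially"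
        using W_meas[OF i] W_bdd[OF i \<open>0 \<le> t\<close>] c0 by (rule conv_in_prob_zero_mult_bounded[OF M])
      ultimately have "conv_in_prob M (\<lambda>n \<omega>. real n powr (- \<gamma>) * W i n t \<omega> + lam i * t * real n powr (1 - 2 * \<gamma>)) (0 + 0) sequentially"
        using W_meas[OF i] by (intro conv_in_prob_add[OF M]) auto
      moreover have "real n powr (- \<gamma>) * W i n t \<omega> + lam i * t * real n powr (1 - 2 * \<gamma>) = (real n powr (- \<gamma>))\<^sup>2 * real (K i (real n * t) \<omega>)" for n \<omega>
      proof (cases "n = 0")
        case False
        have "real n powr (1 - 2 * \<gamma>) = (real n powr (- \<gamma>))\<^sup>2 * real n"
          using False by (simp add: powr_diff powr_minus power2_eq_square powr_add[symmetric] field_simps)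
        then show ?thesis by (simp add: W_def power2_eq_square algebra_simps)
      qed simp
      ultimately show "conv_in_prob M (\<lambda>n \<omega>. (real n powr (- \<gamma>))\<^sup>2 * real (K i (real n * t) \<omega>)) 0 sequentially"
        by simp
    qed
    then show "conv_in_prob M (\<lambda>n \<omega>. real n powr (- \<gamma>) *
         (log_price N \<mu> e \<eta> (real n * t) \<omega> - (lam 1 * \<mu> 1 + lam 2 * \<mu> 2) * real n * t)
         - (\<mu> 1 * W 1 n t \<omega> + \<mu> 2 * W 2 n t \<omega>)) 0 sequentially"
      by (simp add: price W_def algebra_simps)
  qed

  \<comment> \<open>For \<open>\<gamma> < 1\<close> the law of large numbers forces \<open>lam i \<ge> 0\<close>; taking the positive part avoids having to prove it.\<close>
  define lp where "lp i = max 0 (lam i)" for i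
  \<comment> \<open>The square is the variance per unit of time: shocks of family \<open>i\<close>
    arrive at rate \<open>lam i\<close> and have variance \<open>(s i)\<^sup>2\<close>.\<close>
  define \<sigma> where "\<sigma> = sqrt (lp 1 * (s 1)\<^sup>2 + lp 2 * (s 2)\<^sup>2)"
  have lp: "0 \<le> lp i" for i by (simp add: lp_def)
  have \<sigma>_sq: "\<sigma>\<^sup>2 = lp 1 * (s 1)\<^sup>2 + lp 2 * (s 2)\<^sup>2" and \<sigma>_nonneg: "0 \<le> \<sigma>"
    unfolding \<sigma>_def using lp by (auto intro!: real_sqrt_pow2 add_nonneg_nonneg mult_nonneg_nonneg)
  have \<sigma>_pos: "\<sigma> > 0" if "\<exists>i\<in>{1,2}. lam i > 0 \<and> s i \<noteq> 0"
  proof -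
    from that obtain i where i: "i \<in> {1,2}" "lam i > 0 \<and> s i \<noteq> 0" by (rule bexE)
    have "lp i * (s i)\<^sup>2 > 0" using i by (simp add: lp_def)
    then have "lp 1 * (s 1)\<^sup>2 + lp 2 * (s 2)\<^sup>2 > 0"
    proof -
      have "0 \<le> lp j * (s j)\<^sup>2" for j using lp by simp
      from this[of 1] this[of 2] \<open>lp i * (s i)\<^sup>2 > 0\<close> show ?thesis
        using i(1) unfolding insert_iff by (elim disjE) (simp_all add: add_pos_nonneg add_nonneg_pos)
    qed
    then show ?thesis by (simp add: \<sigma>_def)
  qed
  have part3: "conv_fdd M
      (\<lambda>n t \<omega>. real n powr (- 1 / 2) *
         (log_price N \<mu> e \<eta> (real n * t) \<omega> - (lam 1 * \<mu> 1 + lam 2 * \<mu> 2) * real n * t))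
      P (\<lambda>t \<omega>. \<mu> 1 * A 1 t (\<pi> \<omega>) + \<mu> 2 * A 2 t (\<pi> \<omega>) + \<sigma> * B t \<omega>)"
    if cs: "\<gamma> = 1 / 2 \<or> (\<mu> 1 = 0 \<and> \<mu> 2 = 0 \<and> \<gamma> < 1)" and fam: "indep_families M {1..} (e 1) {1..} (e 2)"
      and P: "prob_space P" and \<pi>: "\<pi> \<in> measurable P L" "distr P L \<pi> = L" and B: "standard_brownian_motion P B"
      and indP: "indep_families P ({1,2} \<times> {0..}) (\<lambda>(i, t) \<omega>. A i t (\<pi> \<omega>)) {0..} B"
    for P :: "'c measure" and \<pi> B
  proof -
    interpret P: prob_space P by fact
    have "\<gamma> < 1" using cs by auto
    define m where "m i n t = nat \<lfloor>lp i * real n * t\<rfloor>" for i n t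
    \<comment> \<open>Up to vanishing terms the normalized price is \<open>U + V\<close>.
      \<open>U\<close> depends on the counts alone and \<open>V\<close>, having deterministic
      indices, on the shocks alone, so the two are independent.\<close>
    define U where "U n t \<omega> = real n powr (- 1 / 2) * (\<mu> 1 * (real (K 1 (real n * t) \<omega>) - lam 1 * real n * t) +
      \<mu> 2 * (real (K 2 (real n * t) \<omega>) - lam 2 * real n * t))" for n t \<omega>
    define V where "V n t \<omega> = real n powr (- 1 / 2) * (S 1 (m 1 n t) \<omega> + S 2 (m 2 n t) \<omega>)" for n t \<omega>
    define Z where "Z t \<omega> = \<mu> 1 * A 1 t (\<pi> \<omega>) + \<mu> 2 * A 2 t (\<pi> \<omega>)" for t \<omega>
    have A\<pi>_meas: "(\<lambda>\<omega>. A i t (\<pi> \<omega>)) \<in> borel_measurable P" if "i \<in> {1,2}" "0 \<le> t" for i t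
      using measurable_compose[OF \<pi>(1) A_meas'[OF that]] .
    have Z_meas: "Z t \<in> borel_measurable P" if "0 \<le> t" for t
      unfolding Z_def[abs_def] using A\<pi>_meas that
      by (intro borel_measurable_add borel_measurable_times borel_measurable_const) auto
    have B_meas: "B t \<in> borel_measurable P" if "0 \<le> t" for t
      using B that by (simp add: standard_brownian_motion_def)
    have U_meas [measurable]: "U n t \<in> borel_measurable M" and V_meas [measurable]: "V n t \<in> borel_measurable M" for n t
      unfolding U_def[abs_def] V_def[abs_def] by measurable
    have U_conv: "conv_fdd M U P Z"
    \<comment> \<open>At \<gamma> = 1/2 the counts fluctuate on the scale of the shocks and
      \<open>U\<close> is a combination of the \<open>W i\<close>. Otherwise both
      \<open>\<mu> i\<close> are 0, so \<open>U\<close> and \<open>Z\<close> vanish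
      identically.\<close>
    proof (cases "\<gamma> = 1 / 2")
      case True
      have "conv_fdd M (\<lambda>n t \<omega>. \<mu> 1 * W 1 n t \<omega> + \<mu> 2 * W 2 n t \<omega>) P Z"
        unfolding Z_def[abs_def] using W_meas A_meas'
        by (intro conv_fdd_distr[OF M L P \<pi> _ _ W_conv2] borel_measurable_add borel_measurable_times borel_measurable_const) auto
      moreover have "(\<lambda>n t \<omega>. \<mu> 1 * W 1 n t \<omega> + \<mu> 2 * W 2 n t \<omega>) = U"
        by (simp add: fun_eq_iff U_def W_def True algebra_simps)
      ultimately show ?thesis by simp
    next
      case False
      then have "U = (\<lambda>n t \<omega>. 0)" "Z = (\<lambda>t \<omega>. 0)" using cs by (auto simp: fun_eq_iff U_def Z_def)
      then show ?thesis by (simp add: conv_fdd_def M.prob_space P.prob_space)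
    qed
    have V_conv: "conv_fdd M V P (\<lambda>t \<omega>. \<sigma> * B t \<omega>)"
      unfolding V_def[abs_def] S_def m_def
      using M.indep_vars_two_families[OF e_ind fam] e_id e_sq[OF _ order_refl] e_mean[OF _ order_refl] e_var[OF _ order_refl] lp B \<sigma>_sq
      by (rule partial_sums_conv_fdd[OF M P])
    have UV: "conv_fdd M (\<lambda>n t \<omega>. 1 * U n t \<omega> + 1 * V n t \<omega>) P (\<lambda>t \<omega>. 1 * Z t \<omega> + 1 * (\<sigma> * B t \<omega>))"
    proof (rule conv_fdd_lincomb_indep[OF M P _ _ U_conv V_conv])
      fix n and \<tau> :: "nat \<Rightarrow> real" assume \<tau>: "range \<tau> \<subseteq> {0..}"
      have K12: "(\<lambda>\<omega>. real (K 1 t \<omega>)) \<in> borel_measurable ?FN" "(\<lambda>\<omega>. real (K 2 t \<omega>)) \<in> borel_measurable ?FN" for t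
        by (rule measurable_compose[OF K_FN]; simp)+
      have S_Fe: "(\<lambda>\<omega>. S i j \<omega>) \<in> borel_measurable ?Fe" if "i \<in> {1,2}" for i j
        unfolding S_def by (intro borel_measurable_sum e_Fe[OF that]) simp
      have S12: "(\<lambda>\<omega>. S 1 j \<omega>) \<in> borel_measurable ?Fe" "(\<lambda>\<omega>. S 2 j \<omega>) \<in> borel_measurable ?Fe" for j
        by (rule S_Fe, simp)+
      show "indep_pair M (\<lambda>\<omega> j. U n (\<tau> j) \<omega>) (\<lambda>\<omega> j. V n (\<tau> j) \<omega>)"
      proof (rule indep_families_indep_pair[OF M assms(7)])
        show "(\<lambda>\<omega> j. U n (\<tau> j) \<omega>) \<in> borel_measurable ?FN"
          unfolding U_def
          by (intro measurable_coordinatewise_then_product borel_measurable_add borel_measurable_times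
              borel_measurable_diff borel_measurable_const K12)
        show "(\<lambda>\<omega> j. V n (\<tau> j) \<omega>) \<in> borel_measurable ?Fe"
          unfolding V_def
          by (intro measurable_coordinatewise_then_product borel_measurable_add borel_measurable_times
              borel_measurable_const S12)
      qed
      show "indep_pair P (\<lambda>\<omega> j. Z (\<tau> j) \<omega>) (\<lambda>\<omega> j. \<sigma> * B (\<tau> j) \<omega>)"
      proof (rule indep_families_indep_pair[OF P indP])
        have "(\<lambda>\<omega>. A i (\<tau> j) (\<pi> \<omega>)) \<in> borel_measurable (family_algebra P ({1,2} \<times> {0..}) (\<lambda>(i, t) \<omega>. A i t (\<pi> \<omega>)))"
          if "i \<in> {1,2}" for i j
          using measurable_family_algebra[of "(i, \<tau> j)" "{1,2} \<times> {0..}" "\<lambda>(i, t) \<omega>. A i t (\<pi> \<omega>)" P] that \<tau> by auto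
        then show "(\<lambda>\<omega> j. Z (\<tau> j) \<omega>) \<in> borel_measurable (family_algebra P ({1,2} \<times> {0..}) (\<lambda>(i, t) \<omega>. A i t (\<pi> \<omega>)))"
          unfolding Z_def
          by (intro measurable_coordinatewise_then_product borel_measurable_add borel_measurable_times borel_measurable_const) auto
        show "(\<lambda>\<omega> j. \<sigma> * B (\<tau> j) \<omega>) \<in> borel_measurable (family_algebra P {0..} B)"
          using \<tau> by (intro measurable_coordinatewise_then_product borel_measurable_times borel_measurable_const
              measurable_family_algebra) auto
      qed
    qed
    have "conv_fdd M
      (\<lambda>n t \<omega>. real n powr (- 1 / 2) *
         (log_price N \<mu> e \<eta> (real n * t) \<omega> - (lam 1 * \<mu> 1 + lam 2 * \<mu> 2) * real n * t))
      P (\<lambda>t \<omega>. 1 * Z t \<omega> + 1 * (\<sigma> * B t \<omega>))"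
    proof (rule conv_fdd_slutsky[OF M P _ _ _ UV])
      show "(\<lambda>\<omega>. 1 * U n t \<omega> + 1 * V n t \<omega>) \<in> borel_measurable M" for n t
        by measurable
      show "(\<lambda>\<omega>. 1 * Z t \<omega> + 1 * (\<sigma> * B t \<omega>)) \<in> borel_measurable P" if "0 \<le> t" for t
        using Z_meas[OF that] B_meas[OF that] by measurable
      show "(\<lambda>\<omega>. real n powr (- 1 / 2) *
         (log_price N \<mu> e \<eta> (real n * t) \<omega> - (lam 1 * \<mu> 1 + lam 2 * \<mu> 2) * real n * t)) \<in> borel_measurable M" for n t
        by measurable
      fix t :: real assume t: "0 \<le> t"
      define c where "c n = real n powr (- 1 / 2)" for n :: nat
      have c0: "c \<longlonglongrightarrow> 0"
        unfolding c_def by (intro tendsto_neg_powr filterlim_real_sequentially) simp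
      have c_pos: "\<forall>\<^sub>F n in sequentially. c n > 0"
        unfolding c_def using eventually_gt_at_top[of 0] by eventually_elim simp
      have c_sq: "(c n)\<^sup>2 = 1 / real n" for n
        by (cases "n = 0") (simp_all add: c_def powr_minus_divide powr_half_sqrt power_divide)
      have X_meas: "(\<lambda>\<omega>. (real (K i (real n * t) \<omega>) - lam i * real n * t) / real n) \<in> borel_measurable M" if "i \<in> {1,2}" for i n
        using K_real[OF that] by measurable
      \<comment> \<open>Rounding the expected count to an integer costs at most 1, which the factor
        \<open>(c n)\<^sup>2\<close>, equal to \<open>1 / n\<close>, makes negligible.\<close>
      have dev: "conv_in_prob M (\<lambda>n \<omega>. (c n)\<^sup>2 * (real (K i (real n * t) \<omega>) - real (m i n t))) 0 sequentially"
        if i: "i \<in> {1,2}" for i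
      proof (rule conv_in_prob_dominated[OF M])
        have "conv_in_prob M (\<lambda>n \<omega>. \<bar>(real (K i (real n * t) \<omega>) - lam i * real n * t) / real n\<bar>) 0 sequentially"
          using lln[OF \<open>\<gamma> < 1\<close> i t] by (simp add: conv_in_prob_def)
        from conv_in_prob_add[OF M _ _ this conv_in_prob_const[OF lim_inverse_n]]
        show "conv_in_prob M (\<lambda>n \<omega>. \<bar>(real (K i (real n * t) \<omega>) - lam i * real n * t) / real n\<bar> + inverse (real n)) 0 sequentially"
          using borel_measurable_abs[OF X_meas[OF i]] by simp
        show "(\<lambda>\<omega>. \<bar>(real (K i (real n * t) \<omega>) - lam i * real n * t) / real n\<bar> + inverse (real n)) \<in> borel_measurable M" for n
          using borel_measurable_abs[OF X_meas[OF i]] by measurable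
        show "\<forall>\<^sub>F n in sequentially. \<forall>\<omega>\<in>space M. \<bar>(c n)\<^sup>2 * (real (K i (real n * t) \<omega>) - real (m i n t))\<bar>
          \<le> \<bar>\<bar>(real (K i (real n * t) \<omega>) - lam i * real n * t) / real n\<bar> + inverse (real n)\<bar>"
        proof (intro always_eventually allI ballI)
          fix n \<omega>
          have "\<bar>real (K i (real n * t) \<omega>) - real (m i n t)\<bar> \<le> \<bar>real (K i (real n * t) \<omega>) - lam i * real n * t\<bar> + 1"
          proof (cases "lam i \<ge> 0")
            case True
            then have "0 \<le> lam i * real n * t" using t by simp
            then have "\<bar>real (m i n t) - lam i * real n * t\<bar> \<le> 1"
              using True unfolding m_def lp_def by (simp add: abs_le_iff max_def) linarith
            then show ?thesis by linarith
          next
            \<comment> \<open>For negative \<open>lam i\<close> the index \<open>m i n t\<close> is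
              0, and the count is no larger than its distance from the nonpositive drift.\<close>
            case False
            then have "lam i * real n * t \<le> 0" using t by (simp add: mult_nonpos_nonneg)
            moreover have "m i n t = 0" using False by (simp add: m_def lp_def)
            ultimately show ?thesis by simp
          qed
          then have "\<bar>real (K i (real n * t) \<omega>) - real (m i n t)\<bar> / real n \<le> (\<bar>real (K i (real n * t) \<omega>) - lam i * real n * t\<bar> + 1) / real n"
            by (rule divide_right_mono) simp
          then show "\<bar>(c n)\<^sup>2 * (real (K i (real n * t) \<omega>) - real (m i n t))\<bar>
            \<le> \<bar>\<bar>(real (K i (real n * t) \<omega>) - lam i * real n * t) / real n\<bar> + inverse (real n)\<bar>"
            unfolding c_sq by (simp add: abs_mult abs_divide add_divide_distrib inverse_eq_divide)
        qed
      qed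
      have sh: "conv_in_prob M (\<lambda>n \<omega>. c n * (S i (K i (real n * t) \<omega>) \<omega> - S i (m i n t) \<omega>)) 0 sequentially"
        if "i \<in> {1,2}" for i
        using shocks[OF that dev[OF that]] .
      have hn: "conv_in_prob M (\<lambda>n \<omega>. c n * H i (K i (real n * t) \<omega>) \<omega>) 0 sequentially" if i: "i \<in> {1,2}" for i
      proof (rule noise[OF i _ c0 c_pos])
        have "conv_in_prob M (\<lambda>n \<omega>. (real (K i (real n * t) \<omega>) - lam i * real n * t) / real n + lam i * t) (0 + lam i * t) sequentially"
          using X_meas[OF i] by (intro conv_in_prob_add[OF M] lln[OF \<open>\<gamma> < 1\<close> i t] conv_in_prob_const tendsto_const) auto
        \<comment> \<open>Only eventually: at \<open>n = 0\<close> the left side is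
          \<open>lam i * t\<close> and the right side is 0.\<close>
        moreover have "\<forall>\<^sub>F n in sequentially. \<forall>\<omega>\<in>space M.
            (real (K i (real n * t) \<omega>) - lam i * real n * t) / real n + lam i * t = (c n)\<^sup>2 * real (K i (real n * t) \<omega>)"
          using eventually_gt_at_top[of 0] by eventually_elim (simp add: c_sq field_simps)
        ultimately have "conv_in_prob M (\<lambda>n \<omega>. (c n)\<^sup>2 * real (K i (real n * t) \<omega>)) (0 + lam i * t) sequentially"
          by (simp only: conv_in_prob_cong)
        then show "bounded_in_prob M (\<lambda>n \<omega>. (c n)\<^sup>2 * real (K i (real n * t) \<omega>)) sequentially"
          using K_real[OF i] by (intro conv_in_prob_imp_bounded_in_prob[OF M]) auto
      qed
      have "conv_in_prob M (\<lambda>n \<omega>.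
          (c n * (S 1 (K 1 (real n * t) \<omega>) \<omega> - S 1 (m 1 n t) \<omega>) + c n * (S 2 (K 2 (real n * t) \<omega>) \<omega> - S 2 (m 2 n t) \<omega>)) +
          (c n * H 1 (K 1 (real n * t) \<omega>) \<omega> + c n * H 2 (K 2 (real n * t) \<omega>) \<omega>)) ((0 + 0) + (0 + 0)) sequentially"
        by (intro conv_in_prob_add[OF M] sh hn; (measurable | simp))
      then show "conv_in_prob M (\<lambda>n \<omega>. real n powr (- 1 / 2) *
         (log_price N \<mu> e \<eta> (real n * t) \<omega> - (lam 1 * \<mu> 1 + lam 2 * \<mu> 2) * real n * t)
         - (1 * U n t \<omega> + 1 * V n t \<omega>)) 0 sequentially"
        unfolding price R_def U_def V_def c_def[symmetric] by (simp add: algebra_simps)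
    qed
    then show ?thesis by (simp add: Z_def)
  qed

  show ?thesis
  proof (intro conjI impI)
    assume c: "(\<gamma> = 1 / 2 \<or> (\<mu> 1 = 0 \<and> \<mu> 2 = 0 \<and> \<gamma> < 1)) \<and> indep_families M {1..} (e 1) {1..} (e 2)"
    show "\<exists>\<sigma>\<ge>0. ((\<exists>i\<in>{1,2}. lam i > 0 \<and> s i \<noteq> 0) \<longrightarrow> \<sigma> > 0) \<and>
           (\<forall>(P :: 'c measure) \<pi> B.
              prob_space P \<and> \<pi> \<in> measurable P L \<and> distr P L \<pi> = L \<and>
              standard_brownian_motion P B \<and>
              indep_families P ({1,2} \<times> {0..}) (\<lambda>(i, t) \<omega>. A i t (\<pi> \<omega>)) {0..} B \<longrightarrow>
              conv_fdd M
                (\<lambda>n t \<omega>. real n powr (- 1 / 2) *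
                   (log_price N \<mu> e \<eta> (real n * t) \<omega> - (lam 1 * \<mu> 1 + lam 2 * \<mu> 2) * real n * t))
                P (\<lambda>t \<omega>. \<mu> 1 * A 1 t (\<pi> \<omega>) + \<mu> 2 * A 2 t (\<pi> \<omega>) + \<sigma> * B t \<omega>))"
    proof (rule exI[of _ \<sigma>], intro conjI impI allI \<sigma>_nonneg)
      show "\<sigma> > 0" if "\<exists>i\<in>{1,2}. lam i > 0 \<and> s i \<noteq> 0" using that by (rule \<sigma>_pos)
      fix P :: "'c measure" and \<pi> B
      assume "prob_space P \<and> \<pi> \<in> measurable P L \<and> distr P L \<pi> = L \<and> standard_brownian_motion P B \<and>
        indep_families P ({1,2} \<times> {0..}) (\<lambda>(i, t) \<omega>. A i t (\<pi> \<omega>)) {0..} B"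
      with c show "conv_fdd M
          (\<lambda>n t \<omega>. real n powr (- 1 / 2) *
             (log_price N \<mu> e \<eta> (real n * t) \<omega> - (lam 1 * \<mu> 1 + lam 2 * \<mu> 2) * real n * t))
          P (\<lambda>t \<omega>. \<mu> 1 * A 1 t (\<pi> \<omega>) + \<mu> 2 * A 2 t (\<pi> \<omega>) + \<sigma> * B t \<omega>)"
        by (elim conjE) (rule part3)
    qed
  qed (fact part1 part2)+
qed

end
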